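(* (1) For every integer $r \geq 3$, $$(r+2)n + o(n) \leq \mathrm{tsat}(n,K_r) \leq (r+3)n+o(n)$$ as $n \to \infty$. (2) For $r=3$, $$\left(5+\tfrac{2}{3}\right)n + o(n) \leq \mathrm{tsat}(n,K_3) \leq 6n+o(n)$$ as $n\to\infty$.
   Context: All graphs are finite and simple. Two distinct vertices $v,w$ are twins if they have the same (open) neighbourhood; a graph is twin-free if it has no pair of twins. A graph $G$ is $K_r$-saturated if $G$ contains no $K_r$ but adding any missing edge to $G$ creates a $K_r$. For integers $r\ge 3$ and sufficiently large $n$ (such graphs exist for all large $n$), $\mathrm{tsat}(n,K_r)$ is the minimum number of edges in a twin-free $K_r$-saturated graph on $n$ vertices. The $o(n)$ terms are for fixed $r$ as $n\to\infty$. *)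

theory Defs
  imports Complex_Main "HOL-Library.Ramsey" "HOL-Library.Landau_Symbols"
begin

definition simple_graph :: "'a set \<Rightarrow> 'a set set \<Rightarrow> bool" where
  "simple_graph V E \<longleftrightarrow> finite V \<and> E \<subseteq> nsets V 2"

definition neighbourhood :: "'a set \<Rightarrow> 'a set set \<Rightarrow> 'a \<Rightarrow> 'a set" where
  "neighbourhood V E v = {w \<in> V. {v, w} \<in> E}"

definition twins :: "'a set \<Rightarrow> 'a set set \<Rightarrow> 'a \<Rightarrow> 'a \<Rightarrow> bool" where
  "twins V E v w \<longleftrightarrow> v \<noteq> w \<and> neighbourhood V E v = neighbourhood V E w"

definition twin_free :: "'a set \<Rightarrow> 'a set set \<Rightarrow> bool" where
  "twin_free V E \<longleftrightarrow> (\<forall>v\<in>V. \<forall>w\<in>V. \<not> twins V E v w)"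

definition contains_K :: "nat \<Rightarrow> 'a set \<Rightarrow> 'a set set \<Rightarrow> bool" where
  "contains_K r V E \<longleftrightarrow> (\<exists>S\<in>nsets V r. clique S E)"

definition K_saturated :: "nat \<Rightarrow> 'a set \<Rightarrow> 'a set set \<Rightarrow> bool" where
  "K_saturated r V E \<longleftrightarrow>
     \<not> contains_K r V E \<and> (\<forall>e \<in> nsets V 2 - E. contains_K r V (insert e E))"

text \<open>Every finite graph has a copy with vertices in \<^typ>\<open>nat\<close>, so it suffices to consider those.
  On \<^typ>\<open>nat\<close> the infimum of a nonempty set is its minimum. The infimum of the empty set is
  one fixed (unspecified) number, so a lower bound on \<open>tsat n r\<close> that tends to infinity with \<open>n\<close>
  entails that the graphs in question exist for all large \<open>n\<close>.\<close>

definition tsat :: "nat \<Rightarrow> nat \<Rightarrow> nat" where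
  "tsat n r = Inf {card E | (V :: nat set) E.
     simple_graph V E \<and> card V = n \<and> twin_free V E \<and> K_saturated r V E}"

end

theory Submission
  imports Defs
begin

text \<open>
  Lower bound. Put \<open>s = r - 2\<close> and let the graph have \<open>O(n)\<close> edges. The vertices of degree at least a large
  constant \<open>L\<close> are few, and a set-pair argument shows that only boundedly many of the others have a
  neighbour of degree below \<open>L\<close>. These two kinds of vertices form the core \<open>Q\<close>, of size \<open>o(n)\<close>; the neighbourhoods
  of the remaining vertices are distinct maximal \<open>K\<^sub>s\<^sub>+\<^sub>1\<close>-free subsets of \<open>Q\<close>, any two of which share a
  \<open>K\<^sub>s\<close>. So they all contain one of boundedly many cliques \<open>A\<close> of size \<open>s\<close>, and those with at most
  three further elements are, up to \<open>O(|Q|)\<close> exceptions, maximal independent triples in triangle-free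
  subgraphs of \<open>Q\<close>. A triangle-free graph with \<open>m\<close> vertices has at most \<open>m + O(1)\<close> maximal independent
  triples, so almost all degrees are at least \<open>s + 4 = r + 2\<close>.

  For \<open>r = 3\<close> the vertices of degree \<open>5\<close> are counted by maximal independent quadruples in a triangle-free
  graph with \<open>m\<close> vertices and \<open>e\<close> edges. The degrees in a quadruple sum to at least \<open>m - 4\<close>, and a vertex \<open>v\<close>
  lies in at most \<open>m - deg v + O(1)\<close> quadruples; by convexity there are at most \<open>3/2 e + O(m)\<close>
  quadruples, so vertices of degree \<open>5\<close> are paid for by the edges inside \<open>Q\<close>.

  Upper bound. Join a vertex \<open>X\<close> to many vertices whose other neighbours are distinct maximal independent
  \<open>5\<close>-sets of a graph with \<open>o(n)\<close> vertices and edges, and then add \<open>r - 3\<close> universal vertices.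
\<close>

subsection \<open>Maximal independent triples in triangle-free graphs\<close>

text \<open>As \<open>L\<close> is a constant, the core is only known to be at most a small multiple
  of the degree sum, up to a constant. So every count of exceptional vertices has to be linear in
  the size of the core; a quadratic one would say nothing. For \<open>r + 2\<close> any linear bound
  on triples would do, but the factor 1 matters for the quadruples: those at \<open>v\<close> are
  bounded by the number of non-neighbours of \<open>v\<close>, and this leads to \<open>3/2\<close>.
  The obstacle to the bound on triples is a vertex lying in many of them, which cannot pay its
  share. The pairs completing it to triples are then disjoint, and this rigidity limits the triples
  at the other two vertices enough for those to pay. The value 5 + 2/3: a vertex of degree 5 falls
  short of 6 by one edge, but with at most \<open>3/2 e\<close> quadruples it is matched by 2/3 of
  an edge inside the core.\<close>

lemma card5: "card {a,b,c,d,e} \<le> 5"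
  by (intro order.trans[OF card_insert_le_m1]) (auto simp: card_insert_if)

lemma other_element:
  assumes "s \<in> S" "2 \<le> card S" obtains x where "x \<in> S" "x \<noteq> s"
proof -
  have "card (S - {s}) \<noteq> 0" using assms by simp
  then have "S - {s} \<noteq> {}" by (metis card.empty)
  then show ?thesis using that by auto
qed

lemma two_other_elements:
  assumes "s \<in> S" "3 \<le> card S"
  obtains x y where "x \<in> S" "y \<in> S" "x \<noteq> s" "y \<noteq> s" "x \<noteq> y"
proof -
  obtain x where x: "x \<in> S" "x \<noteq> s" using other_element[of s S] assms by auto
  have "2 \<le> card (S - {s})" using assms by simp
  then obtain y where "y \<in> S - {s}" "y \<noteq> x" using other_element[of x "S - {s}"] x by auto
  then show ?thesis using that x by auto
qed

lemma three_other_elements: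
  assumes "s \<in> S" "4 \<le> card S"
  obtains x y z where "x \<in> S" "y \<in> S" "z \<in> S" "x \<noteq> s" "y \<noteq> s" "z \<noteq> s" "x \<noteq> y" "x \<noteq> z" "y \<noteq> z"
proof -
  obtain x where x: "x \<in> S" "x \<noteq> s" using other_element[of s S] assms by auto
  have "3 \<le> card (S - {s})" using assms by simp
  then obtain y z where "y \<in> S - {s}" "z \<in> S - {s}" "y \<noteq> x" "z \<noteq> x" "y \<noteq> z"
    using two_other_elements[of x "S - {s}"] x by auto
  then show ?thesis using that x by auto
qed

locale sym_graph =
  fixes adj :: "'a \<Rightarrow> 'a \<Rightarrow> bool" (infix \<open>\<sim>\<close> 50)
  assumes sym: "u \<sim> v \<Longrightarrow> v \<sim> u" and irrefl: "\<not> u \<sim> u"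
begin

text \<open>The host set \<open>X\<close> is an argument because links, which live on
  \<open>non_nbrs X v\<close>, are treated by the same notion.\<close>

definition mis :: "'a set \<Rightarrow> 'a set \<Rightarrow> bool" where
  "mis X R \<longleftrightarrow> R \<subseteq> X \<and> (\<forall>u\<in>R. \<forall>v\<in>R. \<not> u \<sim> v) \<and> (\<forall>z\<in>X - R. \<exists>u\<in>R. z \<sim> u)"

definition non_nbrs :: "'a set \<Rightarrow> 'a \<Rightarrow> 'a set" where
  "non_nbrs X v = {u \<in> X. u \<noteq> v \<and> \<not> v \<sim> u}"

definition deg :: "'a set \<Rightarrow> 'a \<Rightarrow> nat" where
  "deg X v = card {u \<in> X. v \<sim> u}"

lemma non_nbrs_subset: "non_nbrs X v \<subseteq> X"
  by (auto simp: non_nbrs_def)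

lemma mis_link: "mis X R \<Longrightarrow> v \<in> R \<Longrightarrow> mis (non_nbrs X v) (R - {v})"
  unfolding mis_def non_nbrs_def using sym by blast

lemma card_non_nbrs:
  assumes "finite X" "v \<in> X" shows "card (non_nbrs X v) + deg X v + 1 = card X"
proof -
  have "X = insert v (non_nbrs X v) \<union> {u\<in>X. v \<sim> u}" using assms by (auto simp: non_nbrs_def)
  moreover have "insert v (non_nbrs X v) \<inter> {u\<in>X. v \<sim> u} = {}" using irrefl by (auto simp: non_nbrs_def)
  moreover have "finite (non_nbrs X v)" "v \<notin> non_nbrs X v" using assms by (auto simp: non_nbrs_def)
  ultimately have "card X = card (insert v (non_nbrs X v)) + card {u\<in>X. v \<sim> u}"
    using assms(1) by (metis (no_types, lifting) card_Un_disjoint finite_Un)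
  then show ?thesis using \<open>finite (non_nbrs X v)\<close> \<open>v \<notin> non_nbrs X v\<close> by (simp add: deg_def)
qed

end

locale triangle_free = sym_graph +
  fixes X :: "'a set"
  assumes fin: "finite X"
    and tf: "\<lbrakk>u \<in> X; v \<in> X; w \<in> X; u \<sim> v; v \<sim> w; u \<sim> w\<rbrakk> \<Longrightarrow> False"
begin

text \<open>Six non-neighbours guarantee one outside any five given vertices, a witness needed
  repeatedly below. The maximal independent triples violating this are counted in
  \<open>card_near_universal_triples\<close>.\<close>

definition triples :: "'a set set" where
  "triples = {R. mis X R \<and> card R = 3 \<and> (\<forall>v\<in>R. 6 \<le> card (non_nbrs X v))}"

definition tri :: "'a \<Rightarrow> 'a \<Rightarrow> 'a \<Rightarrow> bool" where
  "tri a b c \<longleftrightarrow> a \<noteq> b \<and> a \<noteq> c \<and> b \<noteq> c \<and> {a, b, c} \<in> triples"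

abbreviation t :: "'a \<Rightarrow> nat" where
  "t v \<equiv> card {R \<in> triples. v \<in> R}"

lemma finite_triples: "finite triples"
  by (rule finite_subset[of _ "Pow X"]) (auto simp: triples_def mis_def fin)

lemma tri_swap12: "tri a b c \<Longrightarrow> tri b a c"
  by (auto simp: tri_def insert_commute)

lemma tri_swap23: "tri a b c \<Longrightarrow> tri a c b"
  by (auto simp: tri_def insert_commute)

lemma triD:
  assumes "tri a b c"
  shows "a \<in> X" "b \<in> X" "c \<in> X" "a \<noteq> b" "a \<noteq> c" "b \<noteq> c"
    "\<not> a \<sim> b" "\<not> a \<sim> c" "\<not> b \<sim> c" "\<not> b \<sim> a" "\<not> c \<sim> a" "\<not> c \<sim> b"
  using assms by (auto simp: tri_def triples_def mis_def)

lemma tri_dom: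
  assumes "tri a b c" "z \<in> X" "z \<noteq> a" "z \<noteq> b" "z \<noteq> c"
  shows "z \<sim> a \<or> z \<sim> b \<or> z \<sim> c"
  using assms by (auto simp: tri_def triples_def mis_def)

lemma tri_card: "tri a b c \<Longrightarrow> 6 \<le> card (non_nbrs X a)"
  by (auto simp: tri_def triples_def)

lemma tri_intro: "{a, b, c} \<in> triples \<Longrightarrow> tri a b c"
  by (auto simp: tri_def triples_def card_insert_if split: if_splits)

lemma triples_E:
  assumes "R \<in> triples" "v \<in> R"
  obtains b c where "R = {v, b, c}" "tri v b c"
proof -
  have "card (R - {v}) = 2" using assms by (auto simp: triples_def)
  then obtain b c where "R - {v} = {b, c}" by (auto simp: card_2_iff)
  then have "R = {v, b, c}" using assms by auto
  then show ?thesis using that tri_intro assms by blast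
qed

section \<open>Links in which two pairs share a vertex\<close>

text \<open>The triple \<open>{a, b, c'}\<close> must dominate \<open>c\<close>, and only
  \<open>c'\<close> can do so. A further vertex adjacent to neither \<open>a\<close> nor
  \<open>b\<close> would be adjacent to both \<open>c\<close> and \<open>c'\<close>, a
  triangle.\<close>

lemma shared_pair:
  assumes T: "tri a b c" and T': "tri a b c'" and "c \<noteq> c'"
  shows shared_pair_adj: "c \<sim> c'"
    and shared_pair_nbr: "\<And>y. \<lbrakk>y \<in> X; y \<noteq> a; \<not> y \<sim> a; y \<notin> {b, c, c'}\<rbrakk> \<Longrightarrow> y \<sim> b"
proof -
  show cc: "c \<sim> c'"
    using tri_dom[OF T'] triD[OF T] triD[OF T'] \<open>c \<noteq> c'\<close> by blast
  fix y assume y: "y \<in> X" "y \<noteq> a" "\<not> y \<sim> a" "y \<notin> {b, c, c'}"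
  show "y \<sim> b"
  proof (rule ccontr)
    assume "\<not> y \<sim> b"
    then have "y \<sim> c" "y \<sim> c'" using tri_dom[OF T] tri_dom[OF T'] y by auto
    then show False using tf cc y triD[OF T] triD[OF T'] by blast
  qed
qed

lemma obtain_non_nbr:
  assumes "tri a b c" "card B \<le> 5" "finite B"
  obtains z where "z \<in> X" "z \<noteq> a" "\<not> z \<sim> a" "z \<notin> B"
proof -
  have "finite (non_nbrs X a)" using fin by (auto simp: non_nbrs_def)
  have "\<not> non_nbrs X a \<subseteq> B"
    using tri_card[OF assms(1)] assms(2,3) card_mono[of B "non_nbrs X a"] by linarith
  then show ?thesis using that sym by (auto simp: non_nbrs_def)
qed

text \<open>A third pair avoids \<open>b\<close>, since its other vertex would be adjacent to
  \<open>b\<close>. So one of its vertices dominates \<open>b\<close>, and then the other one can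
  only be \<open>c\<close> or \<open>c'\<close>.\<close>

lemma shared_pair_third:
  assumes T: "tri a b c" and T': "tri a b c'" and "c \<noteq> c'"
    and P: "tri a p q" and ne: "{p, q} \<noteq> {b, c}" "{p, q} \<noteq> {b, c'}"
  obtains y where "y \<notin> {b, c, c'}" "tri a y c" "{p, q} = {y, c}"
  | y where "y \<notin> {b, c, c'}" "tri a y c'" "{p, q} = {y, c'}"
proof -
  note D = triD[OF T] triD[OF T'] triD[OF P]
  note nb = shared_pair_nbr[OF T T' \<open>c \<noteq> c'\<close>]
  have *: "thesis" if P: "tri a p q" and ne: "{p, q} \<noteq> {b, c}" "{p, q} \<noteq> {b, c'}" and pb: "p \<sim> b"
    and 1: "\<And>y. y \<notin> {b, c, c'} \<Longrightarrow> tri a y c \<Longrightarrow> {p, q} = {y, c} \<Longrightarrow> thesis"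
    and 2: "\<And>y. y \<notin> {b, c, c'} \<Longrightarrow> tri a y c' \<Longrightarrow> {p, q} = {y, c'} \<Longrightarrow> thesis" for p q thesis
  proof -
    note D' = triD[OF P]
    have p: "p \<notin> {b, c, c'}" using pb irrefl D sym by blast
    have "q \<noteq> b" using D' pb sym by blast
    have "q \<in> {c, c'}"
    proof (rule ccontr)
      assume q: "q \<notin> {c, c'}"
      then have qb: "q \<sim> b" using nb[of q] D' \<open>q \<noteq> b\<close> by auto
      \<comment> \<open>A sixth non-neighbour of \<open>a\<close>: it is adjacent to
        \<open>b\<close> and to one of \<open>p\<close>, \<open>q\<close>, which are both adjacent
        to \<open>b\<close>.\<close>
      obtain z where z: "z \<in> X" "z \<noteq> a" "\<not> z \<sim> a" "z \<notin> {b,c,c',p,q}"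
        by (rule obtain_non_nbr[OF T card5]) blast
      then have zb: "z \<sim> b" using nb[of z] by auto
      have "z \<sim> p \<or> z \<sim> q" using tri_dom[OF P] z by auto
      then show False using tf[of z p b] tf[of z q b] zb pb qb z D D' by blast
    qed
    then show thesis using 1 2 P p by auto
  qed
  have "p \<noteq> b" "q \<noteq> b"
  proof -
    have False if P: "tri a b q" and n: "q \<noteq> c" "q \<noteq> c'" for q
      using nb[of q] triD[OF P] n sym by blast
    then show "p \<noteq> b" "q \<noteq> b" using P tri_swap23 ne by (metis insert_commute)+
  qed
  then have "p \<sim> b \<or> q \<sim> b" using tri_dom[OF P, of b] D sym by blast
  then show ?thesis
  proof
    assume "p \<sim> b" then show ?thesis using *[OF P ne] that by blast
  next
    assume q: "q \<sim> b"
    have "{q, p} \<noteq> {b, c}" "{q, p} \<noteq> {b, c'}" "{q, p} = {p, q}" using ne by (simp_all add: insert_commute)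
    then show ?thesis using *[OF tri_swap23[OF P] _ _ q] that by (smt (verit, best))
  qed
qed

text \<open>Both \<open>y\<close> and \<open>z\<close> are adjacent to \<open>b\<close>, hence not
  to each other, so \<open>{a, y, c}\<close> has only \<open>c\<close> left to dominate
  \<open>z\<close>.\<close>

lemma shared_pair_nbr_third:
  assumes T: "tri a b c" and T': "tri a b c'" and "c \<noteq> c'"
    and P: "tri a y c" and "y \<noteq> b"
    and z: "z \<in> X" "z \<noteq> a" "\<not> z \<sim> a" "z \<notin> {b, c, c', y}"
  shows "z \<sim> c"
proof -
  note D = triD[OF T] triD[OF T'] triD[OF P]
  note nb = shared_pair_nbr[OF T T' \<open>c \<noteq> c'\<close>]
  have "y \<noteq> c'" using shared_pair_adj[OF T T' \<open>c \<noteq> c'\<close>] D sym by blast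
  then have "y \<sim> b" "z \<sim> b" using nb[of y] nb[of z] z D \<open>y \<noteq> b\<close> by auto
  then have "\<not> z \<sim> y" using tf[of z y b] D z by blast
  then show ?thesis using tri_dom[OF P] z by auto
qed

lemma shared_pair_unique:
  assumes T: "tri a b c" and T': "tri a b c'" and "c \<noteq> c'"
    and P: "tri a y c" and "y \<noteq> b" and P': "tri a y' c" and "y' \<noteq> b"
  shows "y = y'"
proof (rule ccontr)
  assume "y \<noteq> y'"
  have "y' \<noteq> c'" using shared_pair_adj[OF T T' \<open>c \<noteq> c'\<close>] triD[OF P'] sym by blast
  then have "y' \<sim> c"
    using shared_pair_nbr_third[OF T T' \<open>c \<noteq> c'\<close> P \<open>y \<noteq> b\<close>, of y'] triD[OF P'] \<open>y \<noteq> y'\<close> \<open>y' \<noteq> b\<close> by auto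
  then show False using triD[OF P'] by auto
qed

text \<open>Pairs through \<open>c\<close> and through \<open>c'\<close> together would make a sixth
  non-neighbour of \<open>a\<close> adjacent to both ends of the edge from \<open>c\<close> to
  \<open>c'\<close>.\<close>

lemma shared_pair_one_side:
  assumes T: "tri a b c" and T': "tri a b c'" and "c \<noteq> c'"
    and P: "tri a y c" and "y \<noteq> b" and P': "tri a y' c'" and "y' \<noteq> b"
  shows False
proof -
  obtain z where z: "z \<in> X" "z \<noteq> a" "\<not> z \<sim> a" "z \<notin> {b,c,c',y,y'}"
    by (rule obtain_non_nbr[OF T card5]) blast
  have "z \<sim> c" "z \<sim> c'"
    using shared_pair_nbr_third[OF T T' \<open>c \<noteq> c'\<close> P \<open>y \<noteq> b\<close>, of z] z
      shared_pair_nbr_third[OF T' T \<open>c \<noteq> c'\<close>[symmetric] P' \<open>y' \<noteq> b\<close>, of z] by auto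
  then show False using tf[of z c c'] shared_pair_adj[OF T T' \<open>c \<noteq> c'\<close>] z triD[OF T] triD[OF T'] by blast
qed

text \<open>Besides the two given triples there is at most one more: two more through the same one
  of \<open>c\<close>, \<open>c'\<close> coincide, and through different ones they exclude each
  other. In contrapositive form, a vertex in four triples has a matching as its link.\<close>

lemma shared_pair_t:
  assumes T: "tri a b c" and T': "tri a b c'" and "c \<noteq> c'"
  shows "t a \<le> 3"
proof -
  let ?U = "{R \<in> triples. a \<in> R} - {{a,b,c},{a,b,c'}}"
  have *: "(\<exists>y. y \<noteq> b \<and> tri a y c \<and> R = {a, y, c}) \<or> (\<exists>y. y \<noteq> b \<and> tri a y c' \<and> R = {a, y, c'})" if RU: "R \<in> ?U" for R
  proof -
    have "R \<in> triples" "a \<in> R" using RU by auto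
    then obtain p q where R: "R = {a,p,q}" and P: "tri a p q" by (rule triples_E)
    then have "{p,q} \<noteq> {b,c}" "{p,q} \<noteq> {b,c'}" using RU by auto
    then show ?thesis
      by (rule shared_pair_third[OF T T' \<open>c \<noteq> c'\<close> P]) (use R in auto)
  qed
  have "R = R'" if "R \<in> ?U" "R' \<in> ?U" for R R'
    using *[OF that(1)] *[OF that(2)]
    by (elim disjE exE conjE) (use shared_pair_unique[OF T T' \<open>c \<noteq> c'\<close>]
      shared_pair_unique[OF T' T \<open>c \<noteq> c'\<close>[symmetric]] shared_pair_one_side[OF T T' \<open>c \<noteq> c'\<close>] in blast)+
  then have "\<forall>R\<in>?U. \<forall>R'\<in>?U. R = R'" by blast
  moreover have "finite ?U" using finite_triples by simp
  ultimately have "card ?U \<le> 1" unfolding One_nat_def by (subst card_le_Suc0_iff_eq)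
  moreover have "card {{a,b,c},{a,b,c'}} \<le> 2" by (simp add: card_insert_if)
  moreover have "t a \<le> card ?U + card {{a,b,c},{a,b,c'}}"
    using diff_card_le_card_Diff[of "{{a,b,c},{a,b,c'}}" "{R \<in> triples. a \<in> R}"] by simp
  ultimately show ?thesis by linarith
qed

section \<open>Links that are matchings\<close>

text \<open>Each of the four vertices has a neighbour in the other pair, so the bipartite graph
  between the two pairs has a perfect matching; the labels are chosen so that unlike letters are
  matched.\<close>

lemma disjoint_pairs_matching:
  assumes T: "tri a c d" and T': "tri a p q" and "{c, d} \<inter> {p, q} = {}"
  obtains c' d' where "{p, q} = {c', d'}" "tri a c' d'" "c' \<sim> d" "d' \<sim> c"
proof -
  note D = triD[OF T] triD[OF T']
  have "c \<sim> p \<or> c \<sim> q" "d \<sim> p \<or> d \<sim> q" "p \<sim> c \<or> p \<sim> d" "q \<sim> c \<or> q \<sim> d"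
    using tri_dom[OF T', of c] tri_dom[OF T', of d] tri_dom[OF T, of p] tri_dom[OF T, of q] D assms(3) sym by blast+
  then have "(p \<sim> d \<and> q \<sim> c) \<or> (p \<sim> c \<and> q \<sim> d)" using sym by blast
  then show ?thesis using that[of p q] that[of q p] T' tri_swap23 by (auto simp: insert_commute)
qed

text \<open>The pairs completing a fixed vertex to a triple span a complete bipartite graph minus a
  perfect matching.\<close>
lemma matching_cross:
  assumes T: "tri a c d" and T1: "tri a c1 d1" and T2: "tri a c2 d2"
    and "{c1, d1} \<inter> {c2, d2} = {}"
    and "c1 \<sim> d" "d1 \<sim> c" "c2 \<sim> d" "d2 \<sim> c"
  shows "c1 \<sim> d2" "c2 \<sim> d1" "\<not> c1 \<sim> c" "\<not> d1 \<sim> d"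
proof -
  note D = triD[OF T] triD[OF T1] triD[OF T2]
  have n: "\<not> c1 \<sim> c2" "\<not> d1 \<sim> d2" using tf[of c1 c2 d] tf[of d1 d2 c] D assms by blast+
  then show 1: "c1 \<sim> d2" "c2 \<sim> d1"
    using tri_dom[OF T2, of c1] tri_dom[OF T1, of c2] D assms(4) sym by blast+
  show "\<not> c1 \<sim> c" "\<not> d1 \<sim> d"
    using tf[of c1 c d2] tf[of d1 d c2] 1 D assms sym by blast+
qed

text \<open>\<open>t\<^sub>1 \<ge> 4\<close>, \<open>t\<^sub>2 \<ge> 3\<close>, \<open>t\<^sub>3 \<ge> 2\<close> for a triple \<open>{1, 2, 3}\<close>, with the links of its vertices
  matchings, produce the triangle \<open>r\<^sub>2, q\<^sub>1, d\<close>.\<close>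
lemma core_contradiction:
  assumes T: "tri v1 v2 v3"
    and C2: "tri v1 c2 d2" "c2 \<sim> v3" "d2 \<sim> v2"
    and C3: "tri v1 c3 d3" "c3 \<sim> v3" "d3 \<sim> v2"
    and C4: "tri v1 c4 d4" "c4 \<sim> v3" "d4 \<sim> v2"
    and dis: "{c2, d2} \<inter> {c3, d3} = {}" "{c2, d2} \<inter> {c4, d4} = {}" "{c3, d3} \<inter> {c4, d4} = {}"
    and P: "tri v2 p1 p3" "p1 \<sim> v3" "p3 \<sim> v1"
    and Q: "tri v2 q1 q3" "q1 \<sim> v3" "q3 \<sim> v1"
    and dis': "{p1, p3} \<inter> {q1, q3} = {}"
    and R: "tri v3 r1 r2" "r1 \<sim> v2" "r2 \<sim> v1"
  shows False
proof -
  have main: False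
    if C: "tri v1 c d" "c \<sim> v3" "d \<sim> v2" "\<not> d \<sim> v3" and U: "tri v2 u1 u3" "u1 \<sim> v3" "u3 \<sim> v1" "\<not> u1 \<sim> v1"
      and ne: "u3 \<noteq> r2" "c \<noteq> u1" "d \<noteq> r1" for c d u1 u3
  proof -
    note D = triD[OF T] triD[OF C(1)] triD[OF U(1)] triD[OF R(1)]
    have "\<not> u1 \<sim> c" using tf[of u1 c v3] C U D by blast
    then have 1: "u1 \<sim> d" using tri_dom[OF C(1), of u1] C U D ne sym by blast
    have "\<not> d \<sim> r1" using tf[of d r1 v2] C R D by blast
    then have 2: "d \<sim> r2" using tri_dom[OF R(1), of d] C R D ne sym by blast
    have "\<not> r2 \<sim> v2" using tf[of d r2 v2] 2 C D by blast
    moreover have "\<not> r2 \<sim> u3" using tf[of r2 u3 v1] R U D by blast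
    ultimately have "r2 \<sim> u1" using tri_dom[OF U(1), of r2] R U D ne sym by blast
    then show False using tf[of r2 u1 d] 1 2 D sym by blast
  qed
  have nd: "\<not> d2 \<sim> v3" "\<not> d3 \<sim> v3" "\<not> d4 \<sim> v3"
    using matching_cross(4)[OF T C2(1) C3(1) dis(1) C2(2,3) C3(2,3)]
      matching_cross(4)[OF T C3(1) C4(1) dis(3) C3(2,3) C4(2,3)]
      matching_cross(4)[OF T C4(1) C2(1) _ C4(2,3) C2(2,3)] dis by auto
  have nu: "\<not> p1 \<sim> v1" "\<not> q1 \<sim> v1"
    using matching_cross(3)[OF tri_swap12[OF T] P(1) Q(1) dis' P(2,3) Q(2,3)]
      matching_cross(3)[OF tri_swap12[OF T] Q(1) P(1) _ Q(2,3) P(2,3)] dis' by auto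
  \<comment> \<open>Two candidates for \<open>u\<close>, since \<open>r2\<close> can spoil one;
    three for \<open>(c, d)\<close>, since \<open>u1\<close> and \<open>r1\<close> can spoil one
    each. Together with the given triple this explains the multiplicities 4, 3, 2.\<close>
  obtain u1 u3 where U: "tri v2 u1 u3" "u1 \<sim> v3" "u3 \<sim> v1" "\<not> u1 \<sim> v1" "u3 \<noteq> r2"
    using P Q nu dis' by auto
  have "\<exists>c d. tri v1 c d \<and> c \<sim> v3 \<and> d \<sim> v2 \<and> \<not> d \<sim> v3 \<and> c \<noteq> u1 \<and> d \<noteq> r1"
  proof -
    have "c2 \<noteq> c3" "c2 \<noteq> c4" "c3 \<noteq> c4" "d2 \<noteq> d3" "d2 \<noteq> d4" "d3 \<noteq> d4" using dis by auto
    then have "c2 \<noteq> u1 \<and> d2 \<noteq> r1 \<or> c3 \<noteq> u1 \<and> d3 \<noteq> r1 \<or> c4 \<noteq> u1 \<and> d4 \<noteq> r1" by blast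
    then show ?thesis using C2 C3 C4 nd by blast
  qed
  then show False using main U by blast
qed

lemma big_matching:
  assumes "4 \<le> t a" "tri a b c" "tri a b' c'" "{b, c} \<noteq> {b', c'}"
  shows "{b, c} \<inter> {b', c'} = {}"
proof (rule ccontr)
  have *: False if "tri a x y" "tri a x z" "y \<noteq> z" for x y z
    using shared_pair_t[OF that] assms(1) by simp
  assume "\<not> ?thesis"
  then consider "b = b'" | "b = c'" | "c = b'" | "c = c'" by auto
  then show False
    using *[of b c c'] *[of b c b'] *[of c b c'] *[of c b b'] assms(2-4) tri_swap23
    by cases (auto simp: insert_commute)
qed

lemma tri_mem: "tri a b c \<Longrightarrow> {a, b, c} \<in> {R \<in> triples. a \<in> R}"
  by (simp add: tri_def)

lemma labelled_link:
  assumes T: "tri a c d" and R: "R \<in> {R \<in> triples. a \<in> R}" "R \<noteq> {a, c, d}"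
    and dis: "\<And>p q. tri a p q \<Longrightarrow> R = {a, p, q} \<Longrightarrow> {c, d} \<inter> {p, q} = {}"
  obtains c' d' where "R = {a, c', d'}" "tri a c' d'" "c' \<sim> d" "d' \<sim> c"
proof -
  have "R \<in> triples" "a \<in> R" using R by auto
  then obtain p q where pq: "R = {a, p, q}" "tri a p q" by (rule triples_E)
  obtain c' d' where "{p, q} = {c', d'}" "tri a c' d'" "c' \<sim> d" "d' \<sim> c"
    by (rule disjoint_pairs_matching[OF T pq(2) dis[OF pq(2,1)]])
  then show ?thesis using that pq by auto
qed

lemma big_link:
  assumes T: "tri a c d" and big: "4 \<le> t a"
  obtains c2 d2 c3 d3 c4 d4 where
    "tri a c2 d2" "c2 \<sim> d" "d2 \<sim> c" "tri a c3 d3" "c3 \<sim> d" "d3 \<sim> c" "tri a c4 d4" "c4 \<sim> d" "d4 \<sim> c"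
    "{c2, d2} \<inter> {c3, d3} = {}" "{c2, d2} \<inter> {c4, d4} = {}" "{c3, d3} \<inter> {c4, d4} = {}"
proof -
  let ?S = "{R \<in> triples. a \<in> R}"
  obtain R2 R3 R4 where R: "R2 \<in> ?S" "R3 \<in> ?S" "R4 \<in> ?S" "R2 \<noteq> {a,c,d}" "R3 \<noteq> {a,c,d}" "R4 \<noteq> {a,c,d}"
    and ne: "R2 \<noteq> R3" "R2 \<noteq> R4" "R3 \<noteq> R4"
    by (rule three_other_elements[OF tri_mem[OF T] big])
  have *: "\<exists>c' d'. R = {a, c', d'} \<and> tri a c' d' \<and> c' \<sim> d \<and> d' \<sim> c" if R: "R \<in> ?S" "R \<noteq> {a,c,d}" for R
  proof -
    have "{c, d} \<inter> {p, q} = {}" if "tri a p q" "R = {a, p, q}" for p q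
      by (rule big_matching[OF big T that(1)]) (use that R in auto)
    then obtain c' d' where "R = {a, c', d'}" "tri a c' d'" "c' \<sim> d" "d' \<sim> c"
      by (rule labelled_link[OF T R])
    then show ?thesis by blast
  qed
  obtain c2 d2 where 2: "R2 = {a, c2, d2}" "tri a c2 d2" "c2 \<sim> d" "d2 \<sim> c" using *[OF R(1,4)] by blast
  obtain c3 d3 where 3: "R3 = {a, c3, d3}" "tri a c3 d3" "c3 \<sim> d" "d3 \<sim> c" using *[OF R(2,5)] by blast
  obtain c4 d4 where 4: "R4 = {a, c4, d4}" "tri a c4 d4" "c4 \<sim> d" "d4 \<sim> c" using *[OF R(3,6)] by blast
  have "{c2, d2} \<noteq> {c3, d3}" "{c2, d2} \<noteq> {c4, d4}" "{c3, d3} \<noteq> {c4, d4}" using 2 3 4 ne by auto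
  then show ?thesis
    by (intro that[OF 2(2-4) 3(2-4) 4(2-4)] big_matching[OF big 2(2) 3(2)]
        big_matching[OF big 2(2) 4(2)] big_matching[OF big 3(2) 4(2)])
qed

text \<open>By \<open>t v1 \<ge> 4\<close> the pairs of \<open>v1\<close> with \<open>v2\<close> and
  with \<open>v3\<close> lie in no other triple, and by \<open>uniq\<close> neither does the pair of
  \<open>v2\<close> and \<open>v3\<close>. So every further pair in a link is disjoint from the
  given one and can be labelled as \<open>core_contradiction\<close> requires.\<close>

lemma unshared_pair_contradiction:
  assumes T: "tri v1 v2 v3" and t1: "4 \<le> t v1" and t2: "3 \<le> t v2" and t3: "2 \<le> t v3"
    and uniq: "\<And>w. tri v2 v3 w \<Longrightarrow> w = v1"
  shows False
proof -
  have T21: "tri v2 v1 v3" and T31: "tri v3 v1 v2" using T tri_swap12 tri_swap23 by blast+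
  have u12: "w = v3" if "tri v1 v2 w" for w
    using shared_pair_t[OF T that] t1 by auto
  have u13: "w = v2" if "tri v1 v3 w" for w
    using shared_pair_t[OF tri_swap23[OF T] that] t1 by auto
  obtain c2 d2 c3 d3 c4 d4 where C: "tri v1 c2 d2" "c2 \<sim> v3" "d2 \<sim> v2" "tri v1 c3 d3" "c3 \<sim> v3" "d3 \<sim> v2"
    "tri v1 c4 d4" "c4 \<sim> v3" "d4 \<sim> v2"
    "{c2, d2} \<inter> {c3, d3} = {}" "{c2, d2} \<inter> {c4, d4} = {}" "{c3, d3} \<inter> {c4, d4} = {}"
    by (rule big_link[OF T t1])
  have dis2: "{v1, v3} \<inter> {p, q} = {}" if P: "tri v2 p q" "{v2, p, q} \<noteq> {v2, v1, v3}" for p q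
  proof -
    have n: False if P: "tri v2 p q" "{v2, p, q} \<noteq> {v2, v1, v3}" "p \<in> {v1, v3}" for p q
      using P u12[of q] uniq[of q] tri_swap12[of v2 p q] by auto
    have "{v2, q, p} \<noteq> {v2, v1, v3}" using P(2) by (simp add: insert_commute)
    then show ?thesis using n[OF P] n[OF tri_swap23[OF P(1)]] by auto
  qed
  have dis3: "{v1, v2} \<inter> {p, q} = {}" if P: "tri v3 p q" "{v3, p, q} \<noteq> {v3, v1, v2}" for p q
  proof -
    have n: False if P: "tri v3 p q" "{v3, p, q} \<noteq> {v3, v1, v2}" "p \<in> {v1, v2}" for p q
      using P u13[of q] uniq[of q] tri_swap12[of v3 p q] by auto
    have "{v3, q, p} \<noteq> {v3, v1, v2}" using P(2) by (simp add: insert_commute)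
    then show ?thesis using n[OF P] n[OF tri_swap23[OF P(1)]] by auto
  qed
  obtain P Q where PQ: "P \<in> {R \<in> triples. v2 \<in> R}" "Q \<in> {R \<in> triples. v2 \<in> R}"
    "P \<noteq> {v2, v1, v3}" "Q \<noteq> {v2, v1, v3}" "P \<noteq> Q"
    by (rule two_other_elements[OF tri_mem[OF T21] t2])
  obtain p1 p3 where P: "P = {v2, p1, p3}" "tri v2 p1 p3" "p1 \<sim> v3" "p3 \<sim> v1"
    by (rule labelled_link[OF T21 PQ(1,3)]) (use dis2 PQ(3) in auto)
  obtain q1 q3 where Q: "Q = {v2, q1, q3}" "tri v2 q1 q3" "q1 \<sim> v3" "q3 \<sim> v1"
    by (rule labelled_link[OF T21 PQ(2,4)]) (use dis2 PQ(4) in auto)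
  have dis': "{p1, p3} \<inter> {q1, q3} = {}"
  proof (rule ccontr)
    \<comment> \<open>If two further pairs at \<open>v2\<close> met, then \<open>{v1, v3}\<close>
      would be a third pair in the sense of \<open>shared_pair_third\<close> and would contain a
      vertex of one of them.\<close>
    have n: False if "tri v2 x y" "tri v2 x z" "y \<noteq> z"
      "{v2, x, y} \<noteq> {v2, v1, v3}" "{v2, x, z} \<noteq> {v2, v1, v3}" for x y z
    proof -
      have d: "{v1, v3} \<inter> {x, y} = {}" "{v1, v3} \<inter> {x, z} = {}" using dis2 that by blast+
      then have "v1 \<notin> {x, y, z}" "v3 \<notin> {x, y, z}" by auto
      note v = this
      show False
        by (rule shared_pair_third[OF that(1,2,3) T21]) (use v in \<open>auto simp: doubleton_eq_iff\<close>)
    qed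
    assume "\<not> ?thesis"
    then consider "p1 = q1" | "p1 = q3" | "p3 = q1" | "p3 = q3" by auto
    then show False
      using n[of p1 p3 q3] n[of p1 p3 q1] n[of p3 p1 q3] n[of p3 p1 q1] P(1,2) Q(1,2) PQ(3-5) tri_swap23
      by cases (auto simp: insert_commute)
  qed
  obtain R where R0: "R \<in> {R \<in> triples. v3 \<in> R}" "R \<noteq> {v3, v1, v2}"
    by (rule other_element[OF tri_mem[OF T31] t3])
  obtain r1 r2 where R: "R = {v3, r1, r2}" "tri v3 r1 r2" "r1 \<sim> v2" "r2 \<sim> v1"
    by (rule labelled_link[OF T31 R0]) (use dis3 R0(2) in auto)
  show False by (rule core_contradiction[OF T C P(2-4) Q(2-4) dis' R(2-4)])
qed

text \<open>The link of \<open>v2\<close> contains \<open>{v3, v1}\<close> and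
  \<open>{v3, w}\<close>, so a third pair consists of \<open>v1\<close> or \<open>w\<close> and a
  new vertex. It cannot use \<open>v1\<close>: two triples through \<open>v1\<close> and
  \<open>v2\<close> would force \<open>t v1 \<le> 3\<close>.\<close>

lemma shared_pair_big:
  assumes T: "tri v1 v2 v3" and T': "tri w v2 v3" and "v1 \<noteq> w" and t1: "4 \<le> t v1" and t2: "3 \<le> t v2"
  obtains y where "tri v2 y w" "y \<noteq> v3"
proof -
  have S: "tri v2 v3 v1" "tri v2 v3 w" using T T' tri_swap12 tri_swap23 by blast+
  obtain P Q where PQ: "P \<in> {R \<in> triples. v2 \<in> R}" "Q \<in> {R \<in> triples. v2 \<in> R}"
    "P \<noteq> {v2, v3, v1}" "Q \<noteq> {v2, v3, v1}" "P \<noteq> Q"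
    by (rule two_other_elements[OF tri_mem[OF S(1)] t2])
  then obtain R where R: "R \<in> triples" "v2 \<in> R" "R \<noteq> {v2, v3, v1}" "R \<noteq> {v2, v3, w}" by blast
  obtain p q where pq: "R = {v2, p, q}" "tri v2 p q" by (rule triples_E[OF R(1,2)])
  then have "{p, q} \<noteq> {v3, v1}" "{p, q} \<noteq> {v3, w}" using R by auto
  then show ?thesis
  proof (rule shared_pair_third[OF S \<open>v1 \<noteq> w\<close> pq(2)])
    fix y assume y: "y \<notin> {v3, v1, w}" "tri v2 y v1"
    have "tri v1 v2 y" using y tri_swap12 tri_swap23 by blast
    then have False using shared_pair_t[OF T, of y] y t1 by auto
    then show ?thesis ..
  next
    fix y assume "y \<notin> {v3, v1, w}" "tri v2 y w"
    then show ?thesis using that by auto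
  qed
qed

text \<open>The third triple at \<open>v2\<close> makes all but at most one of \<open>c2\<close>,
  \<open>c3\<close>, \<open>c4\<close> adjacent to \<open>w\<close>, the third triple at
  \<open>v3\<close> all but at most one of \<open>d2\<close>, \<open>d3\<close>, \<open>d4\<close>.
  So some \<open>c\<close> and some \<open>d\<close> with different indices are both adjacent to
  \<open>w\<close>, and they are adjacent to each other by \<open>matching_cross\<close>.\<close>

lemma shared_pair_big_contradiction:
  assumes T: "tri v1 v2 v3" and T': "tri w v2 v3" and "v1 \<noteq> w"
    and t1: "4 \<le> t v1" and t2: "3 \<le> t v2" and t3: "3 \<le> t v3"
  shows False
proof -
  obtain y where y: "tri v2 y w" "y \<noteq> v3" by (rule shared_pair_big[OF T T' \<open>v1 \<noteq> w\<close> t1 t2])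
  obtain y' where y': "tri v3 y' w" "y' \<noteq> v2"
    by (rule shared_pair_big[OF tri_swap23[OF T] tri_swap23[OF T'] \<open>v1 \<noteq> w\<close> t1 t3])
  have S: "tri v2 v3 w" "tri v2 v3 v1" "tri v3 v2 w" "tri v3 v2 v1" using T T' tri_swap12 tri_swap23 by blast+
  have "v1 \<sim> w" using shared_pair_adj[OF S(2,1) \<open>v1 \<noteq> w\<close>] .
  obtain c2 d2 c3 d3 c4 d4 where C: "tri v1 c2 d2" "c2 \<sim> v3" "d2 \<sim> v2" "tri v1 c3 d3" "c3 \<sim> v3" "d3 \<sim> v2"
    "tri v1 c4 d4" "c4 \<sim> v3" "d4 \<sim> v2"
    "{c2, d2} \<inter> {c3, d3} = {}" "{c2, d2} \<inter> {c4, d4} = {}" "{c3, d3} \<inter> {c4, d4} = {}"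
    by (rule big_link[OF T t1])
  note x23 = matching_cross[OF T C(1,4,10,2,3,5,6)]
  note x34 = matching_cross[OF T C(4,7,12,5,6,8,9)]
  note x24 = matching_cross[OF T C(1,7,11,2,3,8,9)]
  have "{c4, d4} \<inter> {c2, d2} = {}" using C(11) by auto
  note x42 = matching_cross[OF T C(7,1) this C(8,9,2,3)]
  have c: "c \<sim> w" if "tri v1 c d" "c \<sim> v3" "\<not> c \<sim> v2" "c \<noteq> y" for c d
    by (rule shared_pair_nbr_third[OF S(1,2) \<open>v1 \<noteq> w\<close>[symmetric] y])
      (use that triD[OF that(1)] triD[OF T] \<open>v1 \<sim> w\<close> irrefl sym in auto)
  have d: "d \<sim> w" if "tri v1 c d" "d \<sim> v2" "\<not> d \<sim> v3" "d \<noteq> y'" for c d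
    by (rule shared_pair_nbr_third[OF S(3,4) \<open>v1 \<noteq> w\<close>[symmetric] y'])
      (use that triD[OF that(1)] triD[OF T] \<open>v1 \<sim> w\<close> irrefl sym in auto)
  have tr: False if "c \<sim> w" "d \<sim> w" "c \<sim> d" "c \<in> X" "d \<in> X" for c d
    using tf[of c d w] that triD[OF T'] by blast
  have cc: "c2 \<sim> w \<or> c2 = y" "c3 \<sim> w \<or> c3 = y" "c4 \<sim> w \<or> c4 = y"
    using c[OF C(1,2)] c[OF C(4,5)] c[OF C(7,8)] x23 x34 x42 by blast+
  have dd: "d2 \<sim> w \<or> d2 = y'" "d3 \<sim> w \<or> d3 = y'" "d4 \<sim> w \<or> d4 = y'"
    using d[OF C(1,3)] d[OF C(4,6)] d[OF C(7,9)] x23 x34 x42 by blast+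
  have ne: "c2 \<noteq> c3" "c2 \<noteq> c4" "c3 \<noteq> c4" "d2 \<noteq> d3" "d2 \<noteq> d4" "d3 \<noteq> d4" using C(10-12) by auto
  have "\<not> (c2 \<sim> w \<and> d3 \<sim> w)" "\<not> (c3 \<sim> w \<and> d2 \<sim> w)" "\<not> (c2 \<sim> w \<and> d4 \<sim> w)" "\<not> (c4 \<sim> w \<and> d2 \<sim> w)"
    "\<not> (c3 \<sim> w \<and> d4 \<sim> w)" "\<not> (c4 \<sim> w \<and> d3 \<sim> w)"
    using tr x23(1,2) x34(1,2) x24(1,2) triD[OF C(1)] triD[OF C(4)] triD[OF C(7)] by blast+
  then show False using cc dd ne by blast
qed

text \<open>Both \<open>v3\<close> and the vertex \<open>y\<close> from
  \<open>shared_pair_big\<close> complete \<open>w\<close> and \<open>v2\<close> to a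
  triple.\<close>

lemma shared_pair_big_small:
  assumes T: "tri v1 v2 v3" and T': "tri w v2 v3" and "v1 \<noteq> w"
    and t1: "4 \<le> t v1" and t2: "3 \<le> t v2"
  shows "t w \<le> 3"
proof -
  obtain y where y: "tri v2 y w" "y \<noteq> v3" by (rule shared_pair_big[OF T T' \<open>v1 \<noteq> w\<close> t1 t2])
  have "tri w v2 y" using y tri_swap12 tri_swap23 by blast
  then show ?thesis using shared_pair_t[OF T'] y by auto
qed

section \<open>Discharging: every triple collects 1, every vertex pays at most 1\<close>

text \<open>These triples take 1/3 from each vertex. What a vertex in at most three triples does not
  spend on them is split evenly among its \<open>k1\<close> other triples.\<close>

definition N0 :: "'a set set" where "N0 = {R \<in> triples. \<forall>v\<in>R. t v \<le> 3}"

definition k0 :: "'a \<Rightarrow> nat" where "k0 v = card {R \<in> N0. v \<in> R}"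

definition k1 :: "'a \<Rightarrow> nat" where "k1 v = card {R \<in> triples - N0. v \<in> R}"

text \<open>A triple with a vertex of large \<open>t\<close> is paid for by its other vertices only; hence the uneven split.\<close>
definition wt :: "'a set \<Rightarrow> 'a \<Rightarrow> real" where
  "wt R v = (if 3 < t v then 0 else if R \<in> N0 then 1 / 3 else (1 - real (k0 v) / 3) / real (k1 v))"

lemma k0_k1: "k0 v + k1 v = t v"
proof -
  have "{R \<in> triples. v \<in> R} = {R \<in> N0. v \<in> R} \<union> {R \<in> triples - N0. v \<in> R}" by (auto simp: N0_def)
  then show ?thesis unfolding k0_def k1_def using finite_triples
    by (subst card_Un_disjoint[symmetric]) (auto simp: N0_def)
qed

lemma wt_nonneg: "0 \<le> wt R v"
  using k0_k1[of v] by (auto simp: wt_def)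

lemma sum_wt_le: "(\<Sum>R\<in>{R \<in> triples. v \<in> R}. wt R v) \<le> 1"
proof (cases "3 < t v")
  case True then show ?thesis by (simp add: wt_def)
next
  case False
  have "{R \<in> triples. v \<in> R} = {R \<in> N0. v \<in> R} \<union> {R \<in> triples - N0. v \<in> R}" by (auto simp: N0_def)
  then have "(\<Sum>R\<in>{R \<in> triples. v \<in> R}. wt R v)
      = (\<Sum>R\<in>{R \<in> N0. v \<in> R}. wt R v) + (\<Sum>R\<in>{R \<in> triples - N0. v \<in> R}. wt R v)"
    using finite_triples by (subst sum.union_disjoint[symmetric]) (auto simp: N0_def)
  also have "(\<Sum>R\<in>{R \<in> N0. v \<in> R}. wt R v) = k0 v / 3"
    using False by (simp add: wt_def k0_def)
  also have "(\<Sum>R\<in>{R \<in> triples - N0. v \<in> R}. wt R v) = k1 v * ((1 - real (k0 v) / 3) / real (k1 v))"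
    using False by (simp add: wt_def k1_def)
  also have "k0 v / 3 + k1 v * ((1 - real (k0 v) / 3) / real (k1 v)) \<le> 1"
    using False k0_k1[of v] by (cases "k1 v = 0") auto
  finally show ?thesis .
qed

text \<open>For \<open>t v = 3\<close> the even split yields 1/3 whatever \<open>k0 v\<close> is:
  1/3, half of 2/3, or all of 1/3. For \<open>t v = 2\<close> it yields 1/2, and 2/3 if the other
  triple is in \<open>N0\<close>.\<close>

lemma wt_mixed:
  assumes "R \<in> triples" "R \<notin> N0" "v \<in> R" "t v \<le> 3"
  shows "t v = 1 \<Longrightarrow> wt R v = 1" "t v = 2 \<Longrightarrow> 1 / 2 \<le> wt R v"
    "t v = 2 \<Longrightarrow> 1 \<le> k0 v \<Longrightarrow> 2 / 3 \<le> wt R v" "t v = 3 \<Longrightarrow> 1 / 3 \<le> wt R v" "1 \<le> t v"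
proof -
  have "R \<in> {R \<in> triples - N0. v \<in> R}" "finite {R \<in> triples - N0. v \<in> R}"
    using assms finite_triples by auto
  then have "k1 v \<noteq> 0" unfolding k1_def by (metis card_0_eq empty_iff)
  then have k: "k1 v \<ge> 1" "k0 v + k1 v = t v" using k0_k1 by auto
  have w: "wt R v = (1 - real (k0 v) / 3) / real (k1 v)" using assms by (simp add: wt_def)
  show "t v = 1 \<Longrightarrow> wt R v = 1" "1 \<le> t v" using k w by auto
  show "t v = 2 \<Longrightarrow> 1 / 2 \<le> wt R v"
  proof -
    assume "t v = 2"
    then have "k0 v = 0 \<and> k1 v = 2 \<or> k0 v = 1 \<and> k1 v = 1" using k by linarith
    then show ?thesis using w by auto
  qed
  show "2 / 3 \<le> wt R v" if "t v = 2" "1 \<le> k0 v"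
  proof -
    have "k0 v = 1 \<and> k1 v = 1" using k that by linarith
    then show ?thesis using w by auto
  qed
  show "t v = 3 \<Longrightarrow> 1 / 3 \<le> wt R v"
  proof -
    assume "t v = 3"
    then have "k0 v = 0 \<and> k1 v = 3 \<or> k0 v = 1 \<and> k1 v = 2 \<or> k0 v = 2 \<and> k1 v = 1" using k by linarith
    then show ?thesis using w by auto
  qed
qed

text \<open>The tight case: \<open>v2\<close> is only good for 1/3, so \<open>v3\<close> must supply
  2/3. If \<open>t v3 \<ge> 2\<close>, then \<open>v2\<close> and \<open>v3\<close> lie in a second
  triple, with a vertex \<open>w\<close>. Now \<open>t v3 = 3\<close> is impossible, and
  \<open>t w \<le> 3\<close> puts the second triple into \<open>N0\<close>, which leaves 2/3 of
  \<open>v3\<close> for the given one.\<close>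

lemma wt_pair:
  assumes T: "tri v1 v2 v3" and t1: "3 < t v1" and t2: "t v2 = 3" and t3: "t v3 \<le> 3"
  shows "1 \<le> wt {v1, v2, v3} v2 + wt {v1, v2, v3} v3"
proof -
  let ?R = "{v1, v2, v3}"
  have R: "?R \<in> triples" "?R \<notin> N0" using T t1 by (auto simp: tri_def N0_def)
  note w2 = wt_mixed[OF R, of v2] and w3 = wt_mixed[OF R, of v3]
  have "1 \<le> t v3" using w3(5) t3 by simp
  then consider "t v3 = 1" | "2 \<le> t v3" by linarith
  then show ?thesis
  proof cases
    case 1 then show ?thesis using w3(1) wt_nonneg[of ?R v2] by auto
  next
    case 2
    obtain w where w: "tri v2 v3 w" "w \<noteq> v1"
      using unshared_pair_contradiction[OF T] t1 t2 2 by force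
    have T': "tri w v2 v3" using w tri_swap12 tri_swap23 by blast
    have "t v3 = 2"
      using shared_pair_big_contradiction[OF T T'] w t1 t2 t3 2 by force
    moreover have "t w \<le> 3" using shared_pair_big_small[OF T T'] w t1 t2 by force
    then have "{w, v2, v3} \<in> {R \<in> N0. v3 \<in> R}" using T' t2 t3 by (auto simp: N0_def tri_def)
    then have "1 \<le> k0 v3" unfolding k0_def using finite_triples
      by (metis (no_types, lifting) N0_def One_nat_def Suc_leI card_gt_0_iff empty_iff finite_subset mem_Collect_eq subsetI)
    ultimately show ?thesis using w3(3) w2(4) t2 by auto
  qed
qed

lemma sum_wt_ge:
  assumes "R \<in> triples" shows "1 \<le> (\<Sum>v\<in>R. wt R v)"
proof (cases "R \<in> N0")
  case True
  then have "(\<Sum>v\<in>R. wt R v) = (\<Sum>v\<in>R. 1 / 3)" by (intro sum.cong) (auto simp: wt_def N0_def)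
  also have "\<dots> = 1" using assms by (simp add: triples_def)
  finally show ?thesis by simp
next
  case False
  then obtain v1 where v1: "v1 \<in> R" "3 < t v1" using assms by (force simp: N0_def)
  obtain v2 v3 where R: "R = {v1, v2, v3}" and T: "tri v1 v2 v3" by (rule triples_E[OF assms v1(1)])
  have *: "1 \<le> wt R v2 + wt R v3" if T: "tri v1 v2 v3" and R: "R = {v1, v2, v3}" and le: "t v3 \<le> t v2" for v2 v3
  proof -
    note w2 = wt_mixed[OF assms False, of v2] and w3 = wt_mixed[OF assms False, of v3]
    show ?thesis
    proof (cases "3 < t v2")
      case True
      \<comment> \<open>The link of \<open>v2\<close> is a matching too, so no other triple contains
        \<open>v2\<close> and \<open>v3\<close>; this forces \<open>t v3 = 1\<close>, and
        \<open>v3\<close> pays alone.\<close>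
      have "w = v1" if "tri v2 v3 w" for w
      proof (rule ccontr)
        assume "w \<noteq> v1"
        moreover have "tri v2 v3 v1" using T tri_swap12 tri_swap23 by blast
        ultimately show False using shared_pair_t[OF that, of v1] True by auto
      qed
      then have "t v3 < 2" using unshared_pair_contradiction[OF T] v1(2) True by force
      then have "t v3 = 1" using w3(5) R by simp
      then show ?thesis using w3(1) R wt_nonneg[of R v2] by auto
    next
      case small: False
      then have "1 \<le> t v2" "1 \<le> t v3" "t v3 \<le> 3" using w2(5) w3(5) R le by auto
      then consider "t v3 = 1" | "t v2 = 2" "t v3 = 2" | "t v2 = 3" using le small by linarith
      then show ?thesis
      proof cases
        case 1 then show ?thesis using w3(1) R wt_nonneg[of R v2] by auto
      next
        case 2 then show ?thesis using w3(2) w2(2) R by auto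
      next
        case 3 then show ?thesis using wt_pair[OF T v1(2)] \<open>t v3 \<le> 3\<close> R by auto
      qed
    qed
  qed
  have "R = {v1, v3, v2}" using R by auto
  then have "1 \<le> wt R v2 + wt R v3"
    using *[OF T R] *[OF tri_swap23[OF T]] by (cases "t v3 \<le> t v2") auto
  moreover have "(\<Sum>v\<in>R. wt R v) = wt R v1 + (wt R v2 + wt R v3)"
    using triD(4-6)[OF T] unfolding R by simp
  ultimately show ?thesis using wt_nonneg[of R v1] by simp
qed

lemma card_triples_le: "card triples \<le> card X"
proof -
  have sub: "R \<subseteq> X" if "R \<in> triples" for R using that by (auto simp: triples_def mis_def)
  have "real (card triples) = (\<Sum>R\<in>triples. 1)" by simp
  also have "\<dots> \<le> (\<Sum>R\<in>triples. \<Sum>v\<in>R. wt R v)" by (intro sum_mono sum_wt_ge)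
  also have "\<dots> = (\<Sum>R\<in>triples. \<Sum>v\<in>{v \<in> X. v \<in> R}. wt R v)"
    using sub by (intro sum.cong refl) auto
  also have "\<dots> = (\<Sum>v\<in>X. \<Sum>R\<in>{R \<in> triples. v \<in> R}. wt R v)"
    by (rule sum.swap_restrict[OF finite_triples fin])
  also have "\<dots> \<le> (\<Sum>v\<in>X. 1)" by (intro sum_mono sum_wt_le)
  finally show ?thesis by simp
qed

text \<open>Adjacent vertices have disjoint neighbourhoods, so among more than 12 vertices no two
  with at most 5 non-neighbours are adjacent. Hence all of these are found in one of them together
  with its non-neighbours, at most 6 in number, and each lies in at most \<open>2 ^ 5\<close> of the
  sets: \<open>6 * 32 = 192\<close>.\<close>

lemma card_near_universal_triples:
  assumes "12 < card X"
  shows "card {R. mis X R \<and> (\<exists>v\<in>R. card (non_nbrs X v) \<le> 5)} \<le> 192"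
proof -
  define B where "B = {v \<in> X. card (non_nbrs X v) \<le> 5}"
  have finN: "finite (non_nbrs X v)" for v using fin by (simp add: non_nbrs_def)
  have "card B \<le> 6"
  proof (cases "B = {}")
    case False
    then obtain v0 where v0: "v0 \<in> B" by auto
    have "B \<subseteq> insert v0 (non_nbrs X v0)"
    proof
      fix v assume v: "v \<in> B"
      show "v \<in> insert v0 (non_nbrs X v0)"
      proof (rule ccontr)
        assume "\<not> ?thesis"
        then have a: "v0 \<sim> v" using v by (auto simp: B_def non_nbrs_def)
        have "deg X v0 + deg X v = card ({u\<in>X. v0 \<sim> u} \<union> {u\<in>X. v \<sim> u})"
          unfolding deg_def using fin tf[of v0 v] a v v0 sym
          by (subst card_Un_disjoint) (auto simp: B_def)
        also have "\<dots> \<le> card X" by (intro card_mono) (use fin in auto)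
        finally show False
          using card_non_nbrs[OF fin, of v] card_non_nbrs[OF fin, of v0] v v0 assms by (auto simp: B_def)
      qed
    qed
    then have "card B \<le> card (insert v0 (non_nbrs X v0))" using finN by (intro card_mono) auto
    also have "\<dots> \<le> Suc (card (non_nbrs X v0))" using finN by (simp add: card_insert_if)
    finally show ?thesis using v0 by (auto simp: B_def)
  qed auto
  have "{R. mis X R \<and> (\<exists>v\<in>R. card (non_nbrs X v) \<le> 5)} \<subseteq> (\<Union>v\<in>B. insert v ` Pow (non_nbrs X v))"
  proof
    fix R assume "R \<in> {R. mis X R \<and> (\<exists>v\<in>R. card (non_nbrs X v) \<le> 5)}"
    then obtain v where v: "mis X R" "v \<in> R" "card (non_nbrs X v) \<le> 5" by auto
    then have "R = insert v (R - {v})" "R - {v} \<subseteq> non_nbrs X v" "v \<in> B"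
      by (auto simp: mis_def non_nbrs_def B_def)
    then show "R \<in> (\<Union>v\<in>B. insert v ` Pow (non_nbrs X v))" by blast
  qed
  then have "card {R. mis X R \<and> (\<exists>v\<in>R. card (non_nbrs X v) \<le> 5)} \<le> card (\<Union>v\<in>B. insert v ` Pow (non_nbrs X v))"
    using fin finN by (intro card_mono) (auto simp: B_def)
  also have "\<dots> \<le> (\<Sum>v\<in>B. card (insert v ` Pow (non_nbrs X v)))"
    by (rule card_UN_le) (use fin in \<open>auto simp: B_def\<close>)
  also have "\<dots> \<le> (\<Sum>v\<in>B. 2 ^ 5)"
  proof (intro sum_mono)
    fix v assume "v \<in> B"
    then have "card (non_nbrs X v) \<le> 5" by (simp add: B_def)
    then have "card (Pow (non_nbrs X v)) \<le> 2 ^ 5" using finN by (simp only: card_Pow power_increasing one_le_numeral)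
    then show "card (insert v ` Pow (non_nbrs X v)) \<le> 2 ^ 5"
      using card_image_le[of "Pow (non_nbrs X v)" "insert v"] finN by (meson finite_Pow_iff order_trans)
  qed
  finally show ?thesis using \<open>card B \<le> 6\<close> by simp
qed

text \<open>The constant \<open>4096 = 2 ^ 12\<close> covers all subsets of at most 12 vertices; for
  larger graphs the error is 192.\<close>

theorem card_mis3_le: "card {R. mis X R \<and> card R = 3} \<le> card X + 4096"
proof (cases "12 < card X")
  case True
  let ?B = "{R. mis X R \<and> (\<exists>v\<in>R. card (non_nbrs X v) \<le> 5)}"
  have finB: "finite ?B" by (rule finite_subset[of _ "Pow X"]) (auto simp: mis_def fin)
  have "{R. mis X R \<and> card R = 3} \<subseteq> triples \<union> ?B" by (force simp: triples_def)
  then have "card {R. mis X R \<and> card R = 3} \<le> card (triples \<union> ?B)"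
    using finite_triples finB by (intro card_mono) auto
  also have "\<dots> \<le> card triples + card ?B" by (rule card_Un_le)
  finally show ?thesis using card_triples_le card_near_universal_triples[OF True] by linarith
next
  case False
  have "card {R. mis X R \<and> card R = 3} \<le> card (Pow X)"
    by (intro card_mono) (auto simp: mis_def fin)
  also have "\<dots> \<le> 2 ^ 12" unfolding card_Pow[OF fin] using False by (intro power_increasing) auto
  finally show ?thesis by simp
qed

end

subsection \<open>Maximal independent quadruples in triangle-free graphs\<close>

context triangle_free begin

lemma triangle_free_subset: "Y \<subseteq> X \<Longrightarrow> triangle_free adj Y"
  by unfold_locales (use fin tf finite_subset in \<open>blast+\<close>)

lemma card_mis4_at_le:
  "card {R. mis X R \<and> card R = 4 \<and> v \<in> R} \<le> card (non_nbrs X v) + 4096"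
proof -
  interpret L: triangle_free adj "non_nbrs X v" by (rule triangle_free_subset[OF non_nbrs_subset])
  have "inj_on (\<lambda>R. R - {v}) {R. mis X R \<and> card R = 4 \<and> v \<in> R}" by (auto simp: inj_on_def)
  moreover have "(\<lambda>R. R - {v}) ` {R. mis X R \<and> card R = 4 \<and> v \<in> R} \<subseteq> {R. mis (non_nbrs X v) R \<and> card R = 3}"
    using mis_link by auto
  moreover have "finite {R. mis (non_nbrs X v) R \<and> card R = 3}"
    by (rule finite_subset[of _ "Pow X"]) (auto simp: mis_def non_nbrs_def fin)
  ultimately have "card {R. mis X R \<and> card R = 4 \<and> v \<in> R} \<le> card {R. mis (non_nbrs X v) R \<and> card R = 3}"
    by (rule card_inj_on_le)
  then show ?thesis using L.card_mis3_le by linarith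
qed

lemma mis_degree_sum:
  assumes "mis X R" shows "card X \<le> card R + (\<Sum>v\<in>R. deg X v)"
proof -
  have "finite R" using assms fin by (auto simp: mis_def intro: finite_subset)
  have "X \<subseteq> R \<union> (\<Union>v\<in>R. {u\<in>X. v \<sim> u})"
  proof
    fix z assume z: "z \<in> X"
    show "z \<in> R \<union> (\<Union>v\<in>R. {u\<in>X. v \<sim> u})"
    proof (cases "z \<in> R")
      case False
      then obtain u where "u \<in> R" "z \<sim> u" using z assms unfolding mis_def by blast
      then show ?thesis using z sym by blast
    qed simp
  qed
  then have "card X \<le> card (R \<union> (\<Union>v\<in>R. {u\<in>X. v \<sim> u}))"
    using fin \<open>finite R\<close> by (intro card_mono) auto
  also have "\<dots> \<le> card R + card (\<Union>v\<in>R. {u\<in>X. v \<sim> u})" by (rule card_Un_le)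
  also have "card (\<Union>v\<in>R. {u\<in>X. v \<sim> u}) \<le> (\<Sum>v\<in>R. deg X v)"
    unfolding deg_def by (rule card_UN_le[OF \<open>finite R\<close>])
  finally show ?thesis by simp
qed

end

text \<open>The convex function through \<open>(1/4, 1/4)\<close> for which \<open>(1 - \<delta>) charge \<delta> = 3/4 \<delta>\<close>, cut off at \<open>1\<close>.\<close>
definition charge :: "real \<Rightarrow> real" where
  "charge \<delta> = (if 4 / 7 \<le> \<delta> then 1 else 3 / 4 * \<delta> / (1 - \<delta>))"

lemma charge_bounds:
  assumes "0 \<le> \<delta>" shows "0 \<le> charge \<delta>" "charge \<delta> \<le> 1" "(1 - \<delta>) * charge \<delta> \<le> 3 / 4 * \<delta>"
  using assms by (auto simp: charge_def field_simps)

text \<open>The line is the tangent of \<open>charge\<close> at 1/4; multiplied by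
  \<open>1 - \<delta>\<close>, the difference becomes a multiple of a square.\<close>

lemma charge_tangent:
  assumes "\<delta> < 4 / 7" shows "4 / 3 * \<delta> - 1 / 12 \<le> charge \<delta>"
proof -
  have "0 \<le> 4 / 3 * (\<delta> - 1 / 4)\<^sup>2" by simp
  also have "\<dots> = 3 / 4 * \<delta> - (4 / 3 * \<delta> - 1 / 12) * (1 - \<delta>)"
    by (simp add: power2_eq_square field_simps)
  finally have "(4 / 3 * \<delta> - 1 / 12) * (1 - \<delta>) \<le> 3 / 4 * \<delta>" by simp
  then have "4 / 3 * \<delta> - 1 / 12 \<le> 3 / 4 * \<delta> / (1 - \<delta>)" using assms by (intro iffD2[OF pos_le_divide_eq]) auto
  then show ?thesis using assms by (simp add: charge_def)
qed

text \<open>One value of at least 4/7 already pays 1. Otherwise the four tangent bounds add up to at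
  least \<open>4/3 - 4/12 = 1\<close>, which is tight when all values are 1/4.\<close>

lemma sum_charge_ge:
  assumes "card R = 4" "\<And>v. v \<in> R \<Longrightarrow> 0 \<le> \<delta> v" "1 \<le> (\<Sum>v\<in>R. \<delta> v)"
  shows "1 \<le> (\<Sum>v\<in>R. charge (\<delta> v))"
proof (cases "\<exists>v\<in>R. 4 / 7 \<le> \<delta> v")
  case True
  then obtain v where v: "v \<in> R" "4 / 7 \<le> \<delta> v" by auto
  have "finite R" using assms(1) by (simp add: card_ge_0_finite)
  have "1 = charge (\<delta> v)" using v by (simp add: charge_def)
  also have "\<dots> \<le> (\<Sum>v\<in>R. charge (\<delta> v))"
    using charge_bounds(1) assms(2) by (intro member_le_sum \<open>v \<in> R\<close> \<open>finite R\<close>) auto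
  finally show ?thesis .
next
  case False
  have "1 \<le> 4 / 3 * (\<Sum>v\<in>R. \<delta> v) - 1 / 3" using assms(3) by simp
  also have "\<dots> = (\<Sum>v\<in>R. 4 / 3 * \<delta> v - 1 / 12)"
    by (simp add: sum_subtractf sum_distrib_left assms(1))
  also have "\<dots> \<le> (\<Sum>v\<in>R. charge (\<delta> v))" using False by (intro sum_mono charge_tangent) force
  finally show ?thesis .
qed

context triangle_free begin

theorem card_mis4_le:
  "real (card {R. mis X R \<and> card R = 4}) \<le> 3 / 4 * (\<Sum>v\<in>X. real (deg X v)) + 4099 * (real (card X) + 1)"
proof (cases "card X \<le> 4")
  case True
  have "card {R. mis X R \<and> card R = 4} \<le> card (Pow X)"
    by (intro card_mono) (auto simp: mis_def fin)
  also have "\<dots> \<le> 2 ^ 4" unfolding card_Pow[OF fin] using True by (intro power_increasing) auto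
  finally have "real (card {R. mis X R \<and> card R = 4}) \<le> 16" by simp
  moreover have "0 \<le> 3 / 4 * (\<Sum>v\<in>X. real (deg X v))" by (simp add: sum_nonneg)
  moreover have "16 \<le> 4099 * (real (card X) + 1)" by simp
  ultimately show ?thesis by linarith
next
  case False
  \<comment> \<open>The degrees in a quadruple sum to at least \<open>card X - 4\<close>; dividing
    by this number gives every quadruple a \<delta>-sum of at least 1.\<close>
  define M where "M = real (card X) - 4"
  have M: "M > 0" using False by (simp add: M_def)
  define \<delta> where "\<delta> v = real (deg X v) / M" for v
  let ?F = "{R. mis X R \<and> card R = 4}"
  have \<delta>: "0 \<le> \<delta> v" for v using M by (simp add: \<delta>_def)
  have finF: "finite ?F" by (rule finite_subset[of _ "Pow X"]) (auto simp: mis_def fin)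
  have "real (card ?F) = (\<Sum>R\<in>?F. 1)" by simp
  also have "\<dots> \<le> (\<Sum>R\<in>?F. \<Sum>v\<in>R. charge (\<delta> v))"
  proof (rule sum_mono)
    fix R assume R: "R \<in> ?F"
    then have "card X \<le> 4 + (\<Sum>v\<in>R. deg X v)" using mis_degree_sum[of R] by auto
    then have "M \<le> (\<Sum>v\<in>R. real (deg X v))" unfolding M_def of_nat_sum[symmetric] by linarith
    then have "1 \<le> (\<Sum>v\<in>R. \<delta> v)" using M by (simp add: \<delta>_def sum_divide_distrib[symmetric])
    then show "1 \<le> (\<Sum>v\<in>R. charge (\<delta> v))" using R \<delta> by (intro sum_charge_ge) auto
  qed
  also have "\<dots> = (\<Sum>R\<in>?F. \<Sum>v\<in>{v \<in> X. v \<in> R}. charge (\<delta> v))"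
    by (intro sum.cong refl) (auto simp: mis_def)
  also have "\<dots> = (\<Sum>v\<in>X. \<Sum>R\<in>{R \<in> ?F. v \<in> R}. charge (\<delta> v))"
    by (rule sum.swap_restrict[OF finF fin])
  also have "\<dots> \<le> (\<Sum>v\<in>X. 3 / 4 * real (deg X v) + 4099)"
  proof (rule sum_mono)
    fix v assume v: "v \<in> X"
    have "{R \<in> ?F. v \<in> R} = {R. mis X R \<and> card R = 4 \<and> v \<in> R}" by auto
    then have "card {R \<in> ?F. v \<in> R} \<le> card (non_nbrs X v) + 4096" using card_mis4_at_le by simp
    moreover have "M * (1 - \<delta> v) = M - real (deg X v)" using M by (simp add: \<delta>_def right_diff_distrib)
    moreover have "real (card (non_nbrs X v)) = M + 3 - real (deg X v)"
      using card_non_nbrs[OF fin v] by (simp add: M_def)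
    \<comment> \<open>Of 4099, 4096 is the error in the count of triples and 3 stems from
      \<open>card (non_nbrs X v) = M + 3 - deg X v\<close>. The factor \<open>1 - \<delta> v\<close>
      is the one that \<open>charge\<close> cancels.\<close>
    ultimately have "real (card {R \<in> ?F. v \<in> R}) \<le> M * (1 - \<delta> v) + 4099" by linarith
    then have "real (card {R \<in> ?F. v \<in> R}) * charge (\<delta> v) \<le> (M * (1 - \<delta> v) + 4099) * charge (\<delta> v)"
      using charge_bounds(1)[OF \<delta>] by (rule mult_right_mono)
    also have "\<dots> = M * ((1 - \<delta> v) * charge (\<delta> v)) + 4099 * charge (\<delta> v)" by (simp add: algebra_simps)
    also have "\<dots> \<le> M * (3 / 4 * \<delta> v) + 4099 * 1"
      using charge_bounds[OF \<delta>] M by (intro add_mono mult_left_mono) auto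
    also have "\<dots> = 3 / 4 * real (deg X v) + 4099" using M by (simp add: \<delta>_def)
    finally show "(\<Sum>R\<in>{R \<in> ?F. v \<in> R}. charge (\<delta> v)) \<le> 3 / 4 * real (deg X v) + 4099" by simp
  qed
  also have "\<dots> = 3 / 4 * (\<Sum>v\<in>X. real (deg X v)) + 4099 * real (card X)"
    by (simp add: sum.distrib sum_distrib_left)
  finally show ?thesis by simp
qed

end

subsection \<open>Small maximal clique-free sets\<close>

context sym_graph begin

definition clq :: "'a set \<Rightarrow> bool" where
  "clq K \<longleftrightarrow> (\<forall>u\<in>K. \<forall>v\<in>K. u \<noteq> v \<longrightarrow> u \<sim> v)"

lemma clq_insert: "clq (insert u K) \<longleftrightarrow> clq K \<and> (\<forall>v\<in>K - {u}. u \<sim> v)"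
  unfolding clq_def using sym by blast

lemma clq_subset: "clq K \<Longrightarrow> L \<subseteq> K \<Longrightarrow> clq L"
  unfolding clq_def by blast

end

text \<open>Here \<open>s = r - 2\<close>, so that a set \<open>F\<close> is good iff it is a maximal \<open>K\<^sub>r\<^sub>-\<^sub>1\<close>-free subset of \<open>Q\<close>.\<close>
locale Kfree_graph = sym_graph +
  fixes Q :: "'a set" and s :: nat
  assumes finQ: "finite Q" and s_pos: "1 \<le> s"
    and clq_card: "K \<subseteq> Q \<Longrightarrow> clq K \<Longrightarrow> card K \<le> s + 1"
begin

definition good :: "'a set \<Rightarrow> bool" where
  "good F \<longleftrightarrow> F \<subseteq> Q \<and> (\<forall>K\<subseteq>F. clq K \<longrightarrow> card K \<noteq> s + 1) \<and>
     (\<forall>z\<in>Q - F. \<exists>K\<subseteq>F. clq K \<and> card K = s \<and> (\<forall>u\<in>K. z \<sim> u))"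

lemma goodD1: "good F \<Longrightarrow> F \<subseteq> Q" and
  goodD2: "good F \<Longrightarrow> K \<subseteq> F \<Longrightarrow> clq K \<Longrightarrow> card K \<noteq> s + 1"
  by (simp_all add: good_def)

lemma goodE:
  assumes "good F" "z \<in> Q" "z \<notin> F"
  obtains K where "K \<subseteq> F" "clq K" "card K = s" "\<And>u. u \<in> K \<Longrightarrow> z \<sim> u"
proof -
  have "\<exists>K\<subseteq>F. clq K \<and> card K = s \<and> (\<forall>u\<in>K. z \<sim> u)" using assms by (simp add: good_def)
  then show ?thesis using that by auto
qed

lemma good_finite: "good F \<Longrightarrow> finite F"
  by (rule finite_subset[OF goodD1 finQ])

lemma good_new_clq:
  assumes "good F" "K \<subseteq> F" "z \<in> F" "z \<notin> K" "clq K" "card K = s" "\<And>u. u \<in> K \<Longrightarrow> z \<sim> u"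
  shows False
proof -
  have "finite K" using assms(1,2) good_finite finite_subset by blast
  then have "card (insert z K) = s + 1" using assms by simp
  moreover have "clq (insert z K)" using assms by (auto simp: clq_insert)
  ultimately show False using goodD2[OF assms(1), of "insert z K"] assms by auto
qed

section \<open>Good sets with few elements outside a given set\<close>

definition completions :: "'a set \<Rightarrow> 'a set" where
  "completions S = {q \<in> Q - S. good (insert q S)}"

text \<open>The \<open>s\<close>-clique of \<open>insert q S\<close> joined to another completion
  \<open>q'\<close> must use \<open>q\<close>, as otherwise it would extend to an
  \<open>(s + 1)\<close>-clique inside \<open>insert q' S\<close>. So completions are pairwise
  adjacent.\<close>

lemma card_completions: "card (completions S) \<le> s + 1"
proof (rule clq_card)
  show "completions S \<subseteq> Q" by (auto simp: completions_def)
  show "clq (completions S)"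
    unfolding clq_def
  proof (intro ballI impI)
    fix q q' assume q: "q \<in> completions S" "q' \<in> completions S" "q \<noteq> q'"
    then have g: "good (insert q S)" "good (insert q' S)" "q \<in> Q" "q' \<in> Q" "q \<notin> S" "q' \<notin> S"
      by (auto simp: completions_def)
    obtain K where K: "K \<subseteq> insert q S" "clq K" "card K = s" "\<And>u. u \<in> K \<Longrightarrow> q' \<sim> u"
      by (rule goodE[OF g(1), of q']) (use g q in auto)
    have "q \<in> K"
    proof (rule ccontr)
      assume "q \<notin> K"
      then show False using good_new_clq[OF g(2), of K q'] K g by auto
    qed
    then show "q \<sim> q'" using K sym by blast
  qed
qed

lemma finite_good: "finite {F. good F \<and> P F}"
  by (rule finite_subset[of _ "Pow Q"]) (auto simp: good_def finQ)

lemma finite_completions: "finite (completions S)"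
  using finQ by (auto simp: completions_def)

lemma card_good_plus1: "card {F. good F \<and> S \<subseteq> F \<and> card F = card S + 1} \<le> s + 1"
proof -
  have "{F. good F \<and> S \<subseteq> F \<and> card F = card S + 1} \<subseteq> (\<lambda>q. insert q S) ` completions S"
  proof
    fix F assume "F \<in> {F. good F \<and> S \<subseteq> F \<and> card F = card S + 1}"
    then have F: "good F" "S \<subseteq> F" "card F = card S + 1" by auto
    then have "card (F - S) = 1" using good_finite by (simp add: card_Diff_subset finite_subset)
    then obtain q where "F - S = {q}" by (auto simp: card_1_singleton_iff)
    then have FS: "F = insert q S" "q \<notin> S" using F(2) by blast+
    then have "q \<in> completions S" using F(1) goodD1[OF F(1)] by (simp add: completions_def)
    then show "F \<in> (\<lambda>q. insert q S) ` completions S" using FS(1) by blast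
  qed
  then have "card {F. good F \<and> S \<subseteq> F \<and> card F = card S + 1} \<le> card (completions S)"
    using finite_completions by (meson card_image_le card_mono finite_imageI order_trans)
  then show ?thesis using card_completions[of S] by linarith
qed

lemma card_good_plus2: "card {F. good F \<and> S \<subseteq> F \<and> card F = card S + 2} \<le> card Q * (s + 1)"
proof -
  let ?G = "\<lambda>p. {F. good F \<and> insert p S \<subseteq> F \<and> card F = card (insert p S) + 1}"
  have "{F. good F \<and> S \<subseteq> F \<and> card F = card S + 2} \<subseteq> (\<Union>p\<in>Q. ?G p)"
  proof
    fix F assume "F \<in> {F. good F \<and> S \<subseteq> F \<and> card F = card S + 2}"
    then have F: "good F" "S \<subseteq> F" "card F = card S + 2" by auto
    have finS: "finite S" using F good_finite finite_subset by blast
    have "F \<noteq> S" using F by auto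
    then obtain p where p: "p \<in> F" "p \<notin> S" using F by auto
    then have "F \<in> ?G p" using F finS by auto
    then show "F \<in> (\<Union>p\<in>Q. ?G p)" using p goodD1[OF F(1)] by blast
  qed
  then have "card {F. good F \<and> S \<subseteq> F \<and> card F = card S + 2} \<le> card (\<Union>p\<in>Q. ?G p)"
    using finQ finite_good by (intro card_mono) auto
  also have "\<dots> \<le> (\<Sum>p\<in>Q. card (?G p))" by (rule card_UN_le[OF finQ])
  also have "\<dots> \<le> (\<Sum>p\<in>Q. s + 1)" by (intro sum_mono card_good_plus1)
  finally show ?thesis by simp
qed

definition adj_pairs :: "'a set \<Rightarrow> ('a \<times> 'a) set" where
  "adj_pairs S = {(c, d). c \<in> Q - S \<and> d \<in> Q - S \<and> c \<sim> d \<and> good (insert c (insert d S))}"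

definition nb :: "'a set \<Rightarrow> 'a \<Rightarrow> 'a set" where
  "nb S u = {v \<in> S. u \<sim> v}"

text \<open>Fix the traces of \<open>c\<close> and \<open>d\<close> on \<open>S\<close>. Then the
  possible \<open>c\<close> form a clique: an \<open>s\<close>-clique joined to \<open>c'\<close>
  that avoids \<open>c\<close> must use \<open>d\<close>, and then it is joined to \<open>c\<close>
  as well, because \<open>c\<close> and \<open>c'\<close> have the same trace; this contradicts
  goodness. So there are at most \<open>s + 1\<close> choices of \<open>c\<close>, each with at most
  \<open>s + 1\<close> completions, for each of the \<open>4 ^ card S\<close> pairs of
  traces.\<close>

lemma card_adj_pairs:
  assumes "finite S" shows "card (adj_pairs S) \<le> 4 ^ card S * (s + 1)\<^sup>2"
proof -
  define P where "P \<tau> = {(c, d) \<in> adj_pairs S. (nb S c, nb S d) = \<tau>}" for \<tau>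
  let ?T = "Pow S \<times> Pow S"
  have finP: "finite (adj_pairs S)"
    by (rule finite_subset[of _ "Q \<times> Q"]) (auto simp: adj_pairs_def finQ)
  have P: "card (P \<tau>) \<le> (s + 1)\<^sup>2" for \<tau>
  proof -
    have "clq (fst ` P \<tau>)"
      unfolding clq_def
    proof (intro ballI impI)
      fix c c' assume "c \<in> fst ` P \<tau>" "c' \<in> fst ` P \<tau>" and ne: "c \<noteq> c'"
      then obtain d d' where *: "(c, d) \<in> P \<tau>" "(c', d') \<in> P \<tau>" by auto
      then have c: "c \<in> Q" "c \<notin> S" "d \<in> Q" "d \<notin> S" "c \<sim> d" and g: "good (insert c (insert d S))"
        and c': "c' \<in> Q" "c' \<notin> S" and g': "good (insert c' (insert d' S))"
        and t: "nb S c = nb S c'"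
        by (auto simp: P_def adj_pairs_def)
      show "c \<sim> c'"
      proof (cases "c' = d")
        case True then show ?thesis using c by simp
      next
        case False
        obtain K where K: "K \<subseteq> insert c (insert d S)" "clq K" "card K = s" "\<And>u. u \<in> K \<Longrightarrow> c' \<sim> u"
          by (rule goodE[OF g c'(1)]) (use False c' ne in auto)
        have "c \<in> K"
        proof (rule ccontr)
          assume cK: "c \<notin> K"
          have dK: "d \<in> K"
          proof (rule ccontr)
            assume "d \<notin> K"
            then show False using good_new_clq[OF g', of K c'] K c' cK by auto
          qed
          have "c \<sim> u" if "u \<in> K" for u
          proof (cases "u = d")
            case True then show ?thesis using c by simp
          next
            case False
            then have "u \<in> nb S c'" using K that cK by (auto simp: nb_def)
            then show ?thesis using t by (auto simp: nb_def)
          qed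
          then show False using good_new_clq[OF g K(1), of c] K cK by auto
        qed
        then show ?thesis using K sym by blast
      qed
    qed
    moreover have "fst ` P \<tau> \<subseteq> Q" by (auto simp: P_def adj_pairs_def)
    ultimately have 1: "card (fst ` P \<tau>) \<le> s + 1" using clq_card by blast
    have finPt: "finite (P \<tau>)" by (rule finite_subset[OF _ finP]) (auto simp: P_def)
    have "P \<tau> \<subseteq> Sigma (fst ` P \<tau>) (\<lambda>c. completions (insert c S))"
      using irrefl by (force simp: P_def adj_pairs_def completions_def insert_commute)
    then have "card (P \<tau>) \<le> card (Sigma (fst ` P \<tau>) (\<lambda>c. completions (insert c S)))"
      using finite_completions finPt by (intro card_mono) auto
    also have "\<dots> = (\<Sum>c\<in>fst ` P \<tau>. card (completions (insert c S)))"
      using finite_completions finPt by (intro card_SigmaI) auto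
    also have "\<dots> \<le> (\<Sum>c\<in>fst ` P \<tau>. s + 1)" by (intro sum_mono card_completions)
    also have "\<dots> \<le> (s + 1)\<^sup>2" using mult_le_mono1[OF 1, of "s + 1"] by (simp only: sum_constant of_nat_id power2_eq_square)
    finally show ?thesis .
  qed
  have "adj_pairs S \<subseteq> (\<Union>\<tau>\<in>?T. P \<tau>)"
  proof
    fix x assume x: "x \<in> adj_pairs S"
    have "(nb S (fst x), nb S (snd x)) \<in> ?T" by (simp add: nb_def)
    moreover have "x \<in> P (nb S (fst x), nb S (snd x))" using x by (simp add: P_def split_beta)
    ultimately show "x \<in> (\<Union>\<tau>\<in>?T. P \<tau>)" by (rule UN_I)
  qed
  moreover have "(\<Union>\<tau>\<in>?T. P \<tau>) \<subseteq> adj_pairs S" unfolding P_def by blast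
  ultimately have "adj_pairs S = (\<Union>\<tau>\<in>?T. P \<tau>)" by (rule equalityI)
  then have "card (adj_pairs S) \<le> (\<Sum>\<tau>\<in>?T. card (P \<tau>))" using assms by (simp only: card_UN_le finite_Pow_iff finite_cartesian_product)
  also have "\<dots> \<le> (\<Sum>\<tau>\<in>?T. (s + 1)\<^sup>2)" by (intro sum_mono P)
  also have "\<dots> = 4 ^ card S * (s + 1)\<^sup>2"
    using assms by (simp add: card_Pow card_cartesian_product flip: power_mult_distrib)
  finally show ?thesis .
qed

definition indep :: "'a set \<Rightarrow> bool" where
  "indep R \<longleftrightarrow> (\<forall>u\<in>R. \<forall>v\<in>R. \<not> u \<sim> v)"

text \<open>The vertex of \<open>F - A\<close> outside an adjacent pair is moved to the base set;
  the pair itself is then one of boundedly many, so these sets are only linear in number.\<close>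

lemma card_good_dependent:
  assumes "card A = s"
  shows "card {F. good F \<and> A \<subseteq> F \<and> card F = s + 3 \<and> \<not> indep (F - A)} \<le> card Q * (4 ^ (s + 1) * (s + 1)\<^sup>2)"
proof -
  have finA: "finite A" using assms s_pos by (simp add: card_ge_0_finite)
  let ?h = "\<lambda>p (c, d). insert c (insert d (insert p A))"
  have "{F. good F \<and> A \<subseteq> F \<and> card F = s + 3 \<and> \<not> indep (F - A)} \<subseteq> (\<Union>p\<in>Q. ?h p ` adj_pairs (insert p A))"
  proof
    fix F assume "F \<in> {F. good F \<and> A \<subseteq> F \<and> card F = s + 3 \<and> \<not> indep (F - A)}"
    then have F: "good F" "A \<subseteq> F" "card F = s + 3" "\<not> indep (F - A)" by auto
    then obtain c d where cd: "c \<in> F - A" "d \<in> F - A" "c \<sim> d" by (auto simp: indep_def)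
    have "c \<noteq> d" using cd irrefl by auto
    have "card (F - A) = 3" using F assms finA by (simp add: card_Diff_subset)
    then have "card (F - A - {c, d}) = 1" using cd \<open>c \<noteq> d\<close> by (subst card_Diff_subset) auto
    then obtain p where p: "F - A - {c, d} = {p}" by (auto simp: card_1_singleton_iff)
    then have "F = insert c (insert d (insert p A))" using F cd by blast
    moreover have "p \<in> Q" "(c, d) \<in> adj_pairs (insert p A)"
      using p cd F goodD1[OF F(1)] calculation by (auto simp: adj_pairs_def)
    ultimately show "F \<in> (\<Union>p\<in>Q. ?h p ` adj_pairs (insert p A))" by force
  qed
  moreover have fin: "finite (adj_pairs S)" for S
    by (rule finite_subset[of _ "Q \<times> Q"]) (auto simp: adj_pairs_def finQ)
  ultimately have "card {F. good F \<and> A \<subseteq> F \<and> card F = s + 3 \<and> \<not> indep (F - A)} \<le> card (\<Union>p\<in>Q. ?h p ` adj_pairs (insert p A))"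
    using finQ by (intro card_mono) auto
  also have "\<dots> \<le> (\<Sum>p\<in>Q. card (?h p ` adj_pairs (insert p A)))" by (rule card_UN_le[OF finQ])
  also have "\<dots> \<le> (\<Sum>p\<in>Q. 4 ^ (s + 1) * (s + 1)\<^sup>2)"
  proof (rule sum_mono)
    fix p
    have "card (?h p ` adj_pairs (insert p A)) \<le> card (adj_pairs (insert p A))" by (rule card_image_le[OF fin])
    also have "\<dots> \<le> 4 ^ card (insert p A) * (s + 1)\<^sup>2" using card_adj_pairs finA by simp
    also have "\<dots> \<le> 4 ^ (s + 1) * (s + 1)\<^sup>2"
      using assms finA by (intro mult_right_mono power_increasing) (auto simp: card_insert_if)
    finally show "card (?h p ` adj_pairs (insert p A)) \<le> 4 ^ (s + 1) * (s + 1)\<^sup>2" .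
  qed
  finally show ?thesis by simp
qed

end

section \<open>Good sets containing a fixed clique\<close>

locale Kfree_clq = Kfree_graph +
  fixes A :: "'a set"
  assumes A_sub: "A \<subseteq> Q" and A_clq: "clq A" and A_card: "card A = s"
begin

lemma finA: "finite A" by (rule finite_subset[OF A_sub finQ])

text \<open>As \<open>A - {x}\<close> is joined to the whole class, a triangle in it would give an
  \<open>(s + 2)\<close>-clique. This is how triangle-free graphs enter for general
  \<open>r\<close>.\<close>

definition cls :: "'a \<Rightarrow> 'a set" where
  "cls x = {u \<in> Q - A. \<not> u \<sim> x \<and> (\<forall>y\<in>A - {x}. u \<sim> y)}"

definition indeps :: "'a set set" where
  "indeps = {F. good F \<and> A \<subseteq> F \<and> card F = s + 3 \<and> indep (F - A)}"

lemma cls_unique: "u \<in> cls x \<Longrightarrow> u \<in> cls y \<Longrightarrow> x \<in> A \<Longrightarrow> y \<in> A \<Longrightarrow> x = y"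
  by (auto simp: cls_def)

lemma indepsD:
  assumes "F \<in> indeps"
  shows "good F" "A \<subseteq> F" "card F = s + 3" "card (F - A) = 3"
    "\<And>u v. u \<in> F - A \<Longrightarrow> v \<in> F - A \<Longrightarrow> \<not> u \<sim> v"
  using assms A_card finA by (auto simp: indeps_def indep_def card_Diff_subset)

lemma not_complete:
  assumes "good F" "A \<subseteq> F" "z \<in> F - A" obtains x where "x \<in> A" "\<not> z \<sim> x"
  using good_new_clq[OF assms(1,2), of z] assms(3) A_clq A_card by blast

text \<open>Since \<open>F - A\<close> is independent, the \<open>s\<close>-clique of
  \<open>F\<close> joined to \<open>z\<close> has just one vertex \<open>\<rho>\<close> outside
  \<open>A\<close>, so it is \<open>A - {x}\<close> with \<open>\<rho>\<close> added. Neither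
  \<open>z\<close> nor \<open>\<rho>\<close> is joined to all of \<open>A\<close>, so both miss
  exactly \<open>x\<close>: domination takes place inside a class.\<close>

lemma indeps_class:
  assumes F: "F \<in> indeps" and z: "z \<in> Q" "z \<notin> F" "x0 \<in> A" "\<not> z \<sim> x0"
  obtains x \<rho> where "x \<in> A" "z \<in> cls x" "\<rho> \<in> F - A" "\<rho> \<in> cls x" "z \<sim> \<rho>"
proof -
  note FD = indepsD[OF F]
  obtain K where K: "K \<subseteq> F" "clq K" "card K = s" "\<And>u. u \<in> K \<Longrightarrow> z \<sim> u"
    by (rule goodE[OF FD(1) z(1,2)]) blast
  have finK: "finite K" using K(1) FD(1) good_finite finite_subset by blast
  have "\<not> K \<subseteq> A"
  proof
    assume "K \<subseteq> A"
    then have "K = A" using card_subset_eq[OF finA] K(3) A_card by simp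
    then show False using K(4)[of x0] z by simp
  qed
  then obtain \<rho> where \<rho>: "\<rho> \<in> K" "\<rho> \<notin> A" by blast
  have KA: "K - {\<rho>} \<subseteq> A"
  proof
    fix u assume u: "u \<in> K - {\<rho>}"
    then have "u \<sim> \<rho>" using K(2) \<rho> by (auto simp: clq_def)
    then show "u \<in> A" using FD(5)[of u \<rho>] u \<rho> K(1) by blast
  qed
  have "card (A - (K - {\<rho>})) = 1"
    using KA finK \<rho> K(3) A_card s_pos by (subst card_Diff_subset) (auto simp: card_Diff_singleton)
  then obtain x where x: "A - (K - {\<rho>}) = {x}" by (auto simp: card_1_singleton_iff)
  then have xA: "x \<in> A" and KAx: "K - {\<rho>} = A - {x}" using KA by blast+
  have zA: "z \<sim> y" if "y \<in> A - {x}" for y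
    by (rule K(4)) (use that KAx in blast)
  have "\<not> z \<sim> x" using zA[of x0] z(3,4) by (cases "x = x0") simp_all
  then have zc: "z \<in> cls x" using z(1,2) FD(2) zA unfolding cls_def by blast
  have \<rho>A: "\<rho> \<sim> y" if "y \<in> A - {x}" for y
  proof -
    have "y \<in> K" "y \<noteq> \<rho>" using that KAx by blast+
    then show ?thesis using K(2) \<rho>(1) by (simp add: clq_def)
  qed
  obtain x1 where x1: "x1 \<in> A" "\<not> \<rho> \<sim> x1"
    by (rule not_complete[OF FD(1,2), of \<rho>]) (use \<rho> K(1) in auto)
  then have "\<not> \<rho> \<sim> x" using \<rho>A[of x1] by (cases "x = x1") simp_all
  then have "\<rho> \<in> cls x" using \<rho>A \<rho> K(1) goodD1[OF FD(1)] unfolding cls_def by blast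
  then show ?thesis using that[OF xA zc, of \<rho>] \<rho> K(1) K(4)[of \<rho>] by blast
qed

text \<open>The obstruction to \<open>F - A\<close> lying in a single class. A vertex of
  \<open>F - A\<close> that belongs to no class counts as lonely, too.\<close>

definition lonely :: "'a set \<Rightarrow> 'a \<Rightarrow> bool" where
  "lonely F \<rho> \<longleftrightarrow> \<rho> \<in> F - A \<and> (\<forall>x\<in>A. \<rho> \<in> cls x \<longrightarrow> (F - A) \<inter> cls x = {\<rho>})"

definition Lon :: "'a set" where
  "Lon = {\<rho>. \<exists>F\<in>indeps. lonely F \<rho>}"

lemma Lon_sub: "Lon \<subseteq> Q"
  using indepsD(1) goodD1 by (fastforce simp: Lon_def lonely_def)

text \<open>If \<open>u\<close> is lonely in \<open>F\<close>, it is the only vertex of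
  \<open>F\<close> in its class, so every other vertex of the class lies outside \<open>F\<close>
  and can be dominated only by \<open>u\<close>. Hence the lonely vertices of a class form a
  clique.\<close>

lemma card_Lon_cls:
  assumes "x \<in> A" shows "card (Lon \<inter> cls x) \<le> s + 1"
proof (rule clq_card)
  show "Lon \<inter> cls x \<subseteq> Q" using Lon_sub by blast
  show "clq (Lon \<inter> cls x)"
    unfolding clq_def
  proof (intro ballI impI)
    fix u v assume uv: "u \<in> Lon \<inter> cls x" "v \<in> Lon \<inter> cls x" "u \<noteq> v"
    then obtain F where F: "F \<in> indeps" "lonely F u" by (auto simp: Lon_def)
    then have Fu: "(F - A) \<inter> cls x = {u}" using uv assms by (auto simp: lonely_def)
    have v: "v \<in> Q" "\<not> v \<sim> x" "v \<notin> A" using uv by (auto simp: cls_def)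
    have "v \<notin> F"
    proof
      assume "v \<in> F"
      then have "v \<in> (F - A) \<inter> cls x" using v uv by blast
      then show False using Fu uv by simp
    qed
    then obtain x' \<rho> where *: "x' \<in> A" "v \<in> cls x'" "\<rho> \<in> F - A" "\<rho> \<in> cls x'" "v \<sim> \<rho>"
      using indeps_class[OF F(1) v(1) _ assms v(2)] by blast
    have "x' = x" using cls_unique[OF *(2) _ *(1) assms] uv by blast
    then have "\<rho> = u" using * Fu by blast
    then show "u \<sim> v" using * sym by blast
  qed
qed

text \<open>The summand 3 stands for lonely vertices in no class: each of them lies in every set of
  \<open>indeps\<close>, hence among the three vertices of \<open>F1 - A\<close>.\<close>

lemma card_Lon: "card Lon \<le> s * (s + 1) + 3"
proof (cases "indeps = {}")
  case True then show ?thesis by (simp add: Lon_def)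
next
  case False
  then obtain F1 where F1: "F1 \<in> indeps" by blast
  have "Lon \<subseteq> (\<Union>x\<in>A. Lon \<inter> cls x) \<union> (F1 - A)"
  proof
    fix \<rho> assume \<rho>: "\<rho> \<in> Lon"
    then obtain F where F: "F \<in> indeps" "\<rho> \<in> F - A" by (auto simp: Lon_def lonely_def)
    obtain x where x: "x \<in> A" "\<not> \<rho> \<sim> x" by (rule not_complete[OF indepsD(1,2)[OF F(1)] F(2)])
    show "\<rho> \<in> (\<Union>x\<in>A. Lon \<inter> cls x) \<union> (F1 - A)"
    proof (cases "\<rho> \<in> F1")
      case True then show ?thesis using F by blast
    next
      case False
      have "\<rho> \<in> Q" using \<rho> Lon_sub by blast
      then obtain x' where "x' \<in> A" "\<rho> \<in> cls x'" using indeps_class[OF F1 _ False x] by blast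
      then show ?thesis using \<rho> by blast
    qed
  qed
  then have "card Lon \<le> card ((\<Union>x\<in>A. Lon \<inter> cls x) \<union> (F1 - A))"
    using finA finite_subset[OF Lon_sub finQ] good_finite[OF indepsD(1)[OF F1]] by (intro card_mono) auto
  also have "\<dots> \<le> card (\<Union>x\<in>A. Lon \<inter> cls x) + card (F1 - A)" by (rule card_Un_le)
  also have "card (\<Union>x\<in>A. Lon \<inter> cls x) \<le> (\<Sum>x\<in>A. card (Lon \<inter> cls x))" by (rule card_UN_le[OF finA])
  also have "\<dots> \<le> (\<Sum>x\<in>A. s + 1)" by (intro sum_mono card_Lon_cls)
  finally show ?thesis using indepsD(4)[OF F1] A_card by simp
qed

lemma card_lonely: "card {F \<in> indeps. \<exists>\<rho>. lonely F \<rho>} \<le> (s * (s + 1) + 3) * (card Q * (s + 1))"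
proof -
  let ?G = "\<lambda>\<rho>. {F. good F \<and> insert \<rho> A \<subseteq> F \<and> card F = card (insert \<rho> A) + 2}"
  have "{F \<in> indeps. \<exists>\<rho>. lonely F \<rho>} \<subseteq> (\<Union>\<rho>\<in>Lon. ?G \<rho>)"
  proof
    fix F assume "F \<in> {F \<in> indeps. \<exists>\<rho>. lonely F \<rho>}"
    then obtain \<rho> where F: "F \<in> indeps" and \<rho>: "lonely F \<rho>" by blast
    then have "\<rho> \<in> Lon" "\<rho> \<in> F" "\<rho> \<notin> A" by (auto simp: Lon_def lonely_def)
    then show "F \<in> (\<Union>\<rho>\<in>Lon. ?G \<rho>)" using indepsD[OF F] finA A_card by auto
  qed
  then have "card {F \<in> indeps. \<exists>\<rho>. lonely F \<rho>} \<le> card (\<Union>\<rho>\<in>Lon. ?G \<rho>)"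
    using finite_good finite_subset[OF Lon_sub finQ] by (intro card_mono) auto
  also have "\<dots> \<le> (\<Sum>\<rho>\<in>Lon. card (?G \<rho>))" by (rule card_UN_le[OF finite_subset[OF Lon_sub finQ]])
  also have "\<dots> \<le> (\<Sum>\<rho>\<in>Lon. card Q * (s + 1))" by (intro sum_mono card_good_plus2)
  also have "\<dots> \<le> (s * (s + 1) + 3) * (card Q * (s + 1))"
    using mult_le_mono1[OF card_Lon, of "card Q * (s + 1)"] by (simp only: sum_constant of_nat_id)
  finally show ?thesis .
qed

text \<open>Each of the three vertices shares its class with another one, and classes are disjoint,
  so there is only one class.\<close>

lemma not_lonely:
  assumes F: "F \<in> indeps" and nl: "\<not> (\<exists>\<rho>. lonely F \<rho>)"
  shows "\<exists>x\<in>A. F - A \<subseteq> cls x"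
proof -
  have *: "\<exists>x\<in>A. \<rho> \<in> cls x \<and> (\<exists>\<rho>'\<in>F - A. \<rho>' \<noteq> \<rho> \<and> \<rho>' \<in> cls x)" if \<rho>: "\<rho> \<in> F - A" for \<rho>
  proof -
    obtain x where "x \<in> A" "\<rho> \<in> cls x" "(F - A) \<inter> cls x \<noteq> {\<rho>}"
      using nl \<rho> unfolding lonely_def by blast
    then show ?thesis using \<rho> by blast
  qed
  obtain a b c where abc: "F - A = {a, b, c}" "a \<noteq> b" "a \<noteq> c" "b \<noteq> c"
    using indepsD(4)[OF F] by (auto simp: card_3_iff)
  have m: "a \<in> F - A" "b \<in> F - A" "c \<in> F - A" using abc(1) by simp_all
  obtain x where x: "x \<in> A" "a \<in> cls x" "b \<in> cls x \<or> c \<in> cls x"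
    using *[OF m(1)] unfolding abc(1) by (elim bexE conjE) auto
  obtain y where y: "y \<in> A" "b \<in> cls y" "a \<in> cls y \<or> c \<in> cls y"
    using *[OF m(2)] unfolding abc(1) by (elim bexE conjE) auto
  obtain z where z: "z \<in> A" "c \<in> cls z" "a \<in> cls z \<or> b \<in> cls z"
    using *[OF m(3)] unfolding abc(1) by (elim bexE conjE) auto
  have "x = y \<and> y = z"
    using x(3) y(3) z(3) cls_unique[OF x(2) _ x(1) y(1)] cls_unique[OF x(2) _ x(1) z(1)]
      cls_unique[OF y(2) _ y(1) x(1)] cls_unique[OF y(2) _ y(1) z(1)]
      cls_unique[OF z(2) _ z(1) x(1)] cls_unique[OF z(2) _ z(1) y(1)] by argo
  then have "F - A \<subseteq> cls x" unfolding abc(1) using x(2) y(2) z(2) by simp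
  then show ?thesis using x(1) by blast
qed

lemma triangle_free_cls: assumes "x \<in> A" shows "triangle_free adj (cls x)"
proof unfold_locales
  show "finite (cls x)" using finQ by (simp add: cls_def)
  fix u v w assume uvw: "u \<in> cls x" "v \<in> cls x" "w \<in> cls x" "u \<sim> v" "v \<sim> w" "u \<sim> w"
  let ?K = "insert u (insert v (insert w (A - {x})))"
  have ne: "u \<noteq> v" "v \<noteq> w" "u \<noteq> w" using uvw irrefl by auto
  have nA: "u \<notin> A" "v \<notin> A" "w \<notin> A" using uvw by (auto simp: cls_def)
  have "clq ?K"
    using uvw clq_subset[OF A_clq, of "A - {x}"] by (auto simp: clq_insert cls_def)
  moreover have "?K \<subseteq> Q" using uvw A_sub by (auto simp: cls_def)
  ultimately have "card ?K \<le> s + 1" by (intro clq_card)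
  moreover have "card ?K = s + 2" using ne nA finA assms A_card s_pos by simp
  ultimately show False by simp
qed

text \<open>Inside a single class \<open>F - A\<close> is a maximal independent triple of a
  triangle-free graph, so \<open>card_mis3_le\<close> applies.\<close>

lemma card_one_class:
  assumes x: "x \<in> A" shows "card {F \<in> indeps. F - A \<subseteq> cls x} \<le> card Q + 4096"
proof -
  interpret C: triangle_free adj "cls x" by (rule triangle_free_cls[OF x])
  have "inj_on (\<lambda>F. F - A) {F \<in> indeps. F - A \<subseteq> cls x}"
  proof (rule inj_onI)
    fix F F' assume "F \<in> {F \<in> indeps. F - A \<subseteq> cls x}" "F' \<in> {F \<in> indeps. F - A \<subseteq> cls x}" "F - A = F' - A"
    then show "F = F'" using indepsD(2)[of F] indepsD(2)[of F'] by blast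
  qed
  moreover have "(\<lambda>F. F - A) ` {F \<in> indeps. F - A \<subseteq> cls x} \<subseteq> {R. mis (cls x) R \<and> card R = 3}"
  proof clarify
    fix F assume F: "F \<in> indeps" "F - A \<subseteq> cls x"
    note FD = indepsD[OF F(1)]
    have "\<exists>u\<in>F - A. z \<sim> u" if z: "z \<in> cls x - (F - A)" for z
    proof -
      have "z \<in> Q" "z \<notin> F" "\<not> z \<sim> x" using z by (auto simp: cls_def)
      then show ?thesis using indeps_class[OF F(1) _ _ x, of z] by blast
    qed
    then have "mis (cls x) (F - A)" using F(2) FD(5) by (simp add: mis_def)
    then show "mis (cls x) (F - A) \<and> card (F - A) = 3" using FD(4) by simp
  qed
  moreover have "finite {R. mis (cls x) R \<and> card R = 3}"
    by (rule finite_subset[of _ "Pow (cls x)"]) (auto simp: mis_def C.fin)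
  ultimately have "card {F \<in> indeps. F - A \<subseteq> cls x} \<le> card {R. mis (cls x) R \<and> card R = 3}"
    by (rule card_inj_on_le)
  also have "\<dots> \<le> card (cls x) + 4096" by (rule C.card_mis3_le)
  also have "card (cls x) \<le> card Q" using finQ by (intro card_mono) (auto simp: cls_def)
  finally show ?thesis by simp
qed

lemma card_indeps: "card indeps \<le> (s * (s + 1) + 3) * (card Q * (s + 1)) + s * (card Q + 4096)"
proof -
  have fin: "finite indeps" unfolding indeps_def by (rule finite_good)
  have "indeps \<subseteq> {F \<in> indeps. \<exists>\<rho>. lonely F \<rho>} \<union> (\<Union>x\<in>A. {F \<in> indeps. F - A \<subseteq> cls x})"
    using not_lonely by blast
  then have "card indeps \<le> card ({F \<in> indeps. \<exists>\<rho>. lonely F \<rho>} \<union> (\<Union>x\<in>A. {F \<in> indeps. F - A \<subseteq> cls x}))"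
    using fin finA by (intro card_mono) auto
  also have "\<dots> \<le> card {F \<in> indeps. \<exists>\<rho>. lonely F \<rho>} + card (\<Union>x\<in>A. {F \<in> indeps. F - A \<subseteq> cls x})"
    by (rule card_Un_le)
  also have "card (\<Union>x\<in>A. {F \<in> indeps. F - A \<subseteq> cls x}) \<le> (\<Sum>x\<in>A. card {F \<in> indeps. F - A \<subseteq> cls x})"
    by (rule card_UN_le[OF finA])
  also have "\<dots> \<le> (\<Sum>x\<in>A. card Q + 4096)" by (intro sum_mono card_one_class)
  finally show ?thesis using card_lonely A_card by simp
qed

end

text \<open>One summand for each kind of set: \<open>A\<close> itself, one further vertex, two
  further vertices, a dependent triple, a triple with a lonely vertex, a triple inside one
  class.\<close>

definition small_const :: "nat \<Rightarrow> nat" where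
  "small_const s = 1 + (s + 1) + (s + 1) + 4 ^ (s + 1) * (s + 1)\<^sup>2 + (s * (s + 1) + 3) * (s + 1) + 4096 * s"

lemma (in Kfree_clq) card_small_good:
  "card {F. good F \<and> A \<subseteq> F \<and> card F \<le> s + 3} \<le> small_const s * (card Q + 1)"
proof -
  let ?G = "\<lambda>i. {F. good F \<and> A \<subseteq> F \<and> card F = card A + i}"
  let ?D = "{F. good F \<and> A \<subseteq> F \<and> card F = s + 3 \<and> \<not> indep (F - A)}"
  have "{F. good F \<and> A \<subseteq> F \<and> card F \<le> s + 3} \<subseteq> {A} \<union> ?G 1 \<union> ?G 2 \<union> ?D \<union> indeps"
  proof
    fix F assume "F \<in> {F. good F \<and> A \<subseteq> F \<and> card F \<le> s + 3}"
    then have F: "good F" "A \<subseteq> F" "card F \<le> s + 3" by auto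
    have "s \<le> card F" using card_mono[OF good_finite[OF F(1)] F(2)] A_card by simp
    then consider "card F = s" | "card F = s + 1" | "card F = s + 2" | "card F = s + 3" using F(3) by linarith
    then show "F \<in> {A} \<union> ?G 1 \<union> ?G 2 \<union> ?D \<union> indeps"
    proof cases
      case 1
      then have "A = F" using card_subset_eq[OF good_finite[OF F(1)] F(2)] A_card by simp
      then show ?thesis by simp
    qed (use F A_card in \<open>simp_all add: indeps_def\<close>)
  qed
  then have "card {F. good F \<and> A \<subseteq> F \<and> card F \<le> s + 3} \<le> card ({A} \<union> ?G 1 \<union> ?G 2 \<union> ?D \<union> indeps)"
    by (intro card_mono) (simp_all add: finite_good indeps_def)
  also have "\<dots> \<le> card {A} + card (?G 1) + card (?G 2) + card ?D + card indeps"
    by (intro order.trans[OF card_Un_le] add_mono order_refl)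
  also have "\<dots> \<le> 1 + (s + 1) + card Q * (s + 1) + card Q * (4 ^ (s + 1) * (s + 1)\<^sup>2)
      + ((s * (s + 1) + 3) * (card Q * (s + 1)) + s * (card Q + 4096))"
    by (intro add_mono card_good_plus1 card_good_plus2 card_good_dependent[OF A_card] card_indeps) simp
  also have "\<dots> \<le> small_const s * (card Q + 1)"
    unfolding small_const_def by (simp add: algebra_simps)
  finally show ?thesis .
qed

text \<open>Every member other than \<open>F0\<close> contains an \<open>s\<close>-clique of
  \<open>F0\<close>, which has at most \<open>2 ^ (s + 3)\<close> subsets; for each such clique
  \<open>card_small_good\<close> applies.\<close>

lemma (in Kfree_graph) card_small_family:
  assumes good: "\<And>F. F \<in> \<F> \<Longrightarrow> good F \<and> card F \<le> s + 3"
    and meet: "\<And>F F'. F \<in> \<F> \<Longrightarrow> F' \<in> \<F> \<Longrightarrow> F \<noteq> F' \<Longrightarrow> \<exists>K\<subseteq>F \<inter> F'. clq K \<and> card K = s"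
  shows "card \<F> \<le> 1 + 2 ^ (s + 3) * (small_const s * (card Q + 1))"
proof (cases "\<F> = {}")
  case False
  then obtain F0 where F0: "F0 \<in> \<F>" by blast
  have finF0: "finite F0" using good[OF F0] good_finite by blast
  let ?K = "{K \<in> Pow F0. clq K \<and> card K = s}"
  let ?G = "\<lambda>K. {F. good F \<and> K \<subseteq> F \<and> card F \<le> s + 3}"
  have "\<F> \<subseteq> {F0} \<union> (\<Union>K\<in>?K. ?G K)"
  proof
    fix F assume F: "F \<in> \<F>"
    show "F \<in> {F0} \<union> (\<Union>K\<in>?K. ?G K)"
    proof (cases "F = F0")
      case False
      then obtain K where "K \<subseteq> F0 \<inter> F" "clq K" "card K = s" using meet[OF F0 F] by blast
      then show ?thesis using good[OF F] by blast
    qed simp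
  qed
  then have "card \<F> \<le> card ({F0} \<union> (\<Union>K\<in>?K. ?G K))"
    using finF0 by (intro card_mono) (simp_all add: finite_good)
  also have "\<dots> \<le> card {F0} + card (\<Union>K\<in>?K. ?G K)" by (rule card_Un_le)
  also have "card (\<Union>K\<in>?K. ?G K) \<le> (\<Sum>K\<in>?K. card (?G K))" by (rule card_UN_le) (simp add: finF0)
  also have "\<dots> \<le> (\<Sum>K\<in>?K. small_const s * (card Q + 1))"
  proof (rule sum_mono)
    fix K assume K: "K \<in> ?K"
    have "K \<subseteq> Q" using K good[OF F0] goodD1 by blast
    then interpret A: Kfree_clq adj Q s K by unfold_locales (use K in auto)
    show "card (?G K) \<le> small_const s * (card Q + 1)" by (rule A.card_small_good)
  qed
  also have "\<dots> = card ?K * (small_const s * (card Q + 1))" by simp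
  also have "\<dots> \<le> 2 ^ (s + 3) * (small_const s * (card Q + 1))"
  proof (rule mult_le_mono1)
    have "card ?K \<le> card (Pow F0)" using finF0 by (intro card_mono) auto
    also have "\<dots> \<le> 2 ^ (s + 3)" unfolding card_Pow[OF finF0] using good[OF F0] by (intro power_increasing) auto
    finally show "card ?K \<le> 2 ^ (s + 3)" .
  qed
  finally show ?thesis by simp
qed simp

subsection \<open>The core of a saturated graph\<close>

text \<open>Branching on a fixed \<open>j\<close>: if \<open>P\<close> holds for
  \<open>A i \<inter> B j\<close>, this set is not contained in \<open>S\<close>, since it would be
  contained in \<open>A j \<inter> B j\<close> and \<open>P\<close> is upward closed. So for all but
  \<open>D\<close> indices, \<open>A i\<close> contains one of at most \<open>b\<close> elements of
  \<open>B j - S\<close>, which then joins \<open>S\<close>. After \<open>k\<close> rounds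
  \<open>S\<close> is larger than any \<open>A i\<close> may be.\<close>

lemma set_pair_bound:
  fixes A B :: "'i \<Rightarrow> 'a set"
  assumes up: "\<And>X Y. P X \<Longrightarrow> X \<subseteq> Y \<Longrightarrow> P Y"
    and "a < card S + k" "finite I" "finite S"
    and "\<And>i. i \<in> I \<Longrightarrow> S \<subseteq> A i" "\<And>i. i \<in> I \<Longrightarrow> finite (A i)" "\<And>i. i \<in> I \<Longrightarrow> card (A i) \<le> a"
    and "\<And>i. i \<in> I \<Longrightarrow> finite (B i)" "\<And>i. i \<in> I \<Longrightarrow> card (B i) \<le> b"
    and "\<And>i. i \<in> I \<Longrightarrow> \<not> P (A i \<inter> B i)"
    and "\<And>j. j \<in> I \<Longrightarrow> card {i \<in> I. \<not> P (A i \<inter> B j)} \<le> D"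
  shows "card I \<le> D * (b + 1) ^ k"
  using assms(2-)
proof (induction k arbitrary: S I)
  case 0
  have "I = {}"
  proof (rule ccontr)
    assume "I \<noteq> {}"
    then obtain i where i: "i \<in> I" by blast
    then have "card S \<le> card (A i)" using 0 by (intro card_mono) auto
    then show False using 0(1) 0(6)[OF i] by simp
  qed
  then show ?case by simp
next
  case (Suc k)
  show ?case
  proof (cases "I = {}")
    case False
    then obtain j where j: "j \<in> I" by blast
    let ?bad = "{i \<in> I. \<not> P (A i \<inter> B j)}" and ?J = "\<lambda>x. {i \<in> I. x \<in> A i}"
    have "I \<subseteq> ?bad \<union> (\<Union>x\<in>B j - S. ?J x)"
    proof
      fix i assume i: "i \<in> I"
      show "i \<in> ?bad \<union> (\<Union>x\<in>B j - S. ?J x)"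
      proof (cases "P (A i \<inter> B j)")
        case True
        have "\<not> A i \<inter> B j \<subseteq> S"
        proof
          assume "A i \<inter> B j \<subseteq> S"
          then have "A i \<inter> B j \<subseteq> A j \<inter> B j" using Suc.prems(4)[OF j] by blast
          then show False using up[OF True] Suc.prems(9)[OF j] by blast
        qed
        then show ?thesis using i by blast
      qed (use i in blast)
    qed
    then have "card I \<le> card (?bad \<union> (\<Union>x\<in>B j - S. ?J x))"
      using Suc.prems(2) Suc.prems(7)[OF j] by (intro card_mono) auto
    also have "\<dots> \<le> card ?bad + card (\<Union>x\<in>B j - S. ?J x)" by (rule card_Un_le)
    also have "card (\<Union>x\<in>B j - S. ?J x) \<le> (\<Sum>x\<in>B j - S. card (?J x))"
      by (rule card_UN_le) (use Suc.prems(7)[OF j] in simp)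
    also have "\<dots> \<le> (\<Sum>x\<in>B j - S. D * (b + 1) ^ k)"
    proof (rule sum_mono)
      fix x assume x: "x \<in> B j - S"
      show "card (?J x) \<le> D * (b + 1) ^ k"
      proof (rule Suc.IH[of "insert x S"])
        show "a < card (insert x S) + k" using x Suc.prems(1,3) by simp
        fix j' assume j': "j' \<in> ?J x"
        have "card {i \<in> ?J x. \<not> P (A i \<inter> B j')} \<le> card {i \<in> I. \<not> P (A i \<inter> B j')}"
          using Suc.prems(2) by (intro card_mono) auto
        then show "card {i \<in> ?J x. \<not> P (A i \<inter> B j')} \<le> D"
          using Suc.prems(10)[of j'] j' by auto
      qed (use Suc.prems in auto)
    qed
    also have "\<dots> = card (B j - S) * (D * (b + 1) ^ k)" by simp
    also have "\<dots> \<le> b * (D * (b + 1) ^ k)"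
    proof (rule mult_le_mono1)
      have "card (B j - S) \<le> card (B j)" using Suc.prems(7)[OF j] by (intro card_mono) auto
      then show "card (B j - S) \<le> b" using Suc.prems(8)[OF j] by simp
    qed
    finally have "card I \<le> card ?bad + b * (D * (b + 1) ^ k)" by simp
    moreover have "card ?bad \<le> D" by (rule Suc.prems(10)[OF j])
    moreover have "D \<le> D * (b + 1) ^ k" by simp
    ultimately have "card I \<le> D * (b + 1) ^ k + b * (D * (b + 1) ^ k)" by linarith
    then show ?thesis by (simp add: algebra_simps)
  qed simp
qed

section \<open>Intersecting families of maximal independent 5-sets\<close>

context triangle_free begin

text \<open>Removing \<open>x\<close> and \<open>y\<close> leaves a maximal independent triple in
  the set of their common non-neighbours.\<close>

lemma card_mis_at_pair:
  assumes "x \<noteq> y"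
  shows "card {F. mis X F \<and> card F = 5 \<and> x \<in> F \<and> y \<in> F} \<le> card X + 4096"
proof -
  let ?Y = "non_nbrs (non_nbrs X x) y"
  have sub: "?Y \<subseteq> X" by (auto simp: non_nbrs_def)
  interpret L: triangle_free adj ?Y by (rule triangle_free_subset[OF sub])
  have "inj_on (\<lambda>F. F - {x} - {y}) {F. mis X F \<and> card F = 5 \<and> x \<in> F \<and> y \<in> F}"
    by (auto simp: inj_on_def)
  moreover have "(\<lambda>F. F - {x} - {y}) ` {F. mis X F \<and> card F = 5 \<and> x \<in> F \<and> y \<in> F} \<subseteq> {R. mis ?Y R \<and> card R = 3}"
  proof clarify
    fix F assume F: "mis X F" "card F = 5" "x \<in> F" "y \<in> F"
    have "mis ?Y (F - {x} - {y})" using mis_link[OF mis_link[OF F(1,3)], of y] F assms by simp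
    then show "mis ?Y (F - {x} - {y}) \<and> card (F - {x} - {y}) = 3" using F assms by simp
  qed
  moreover have "finite {R. mis ?Y R \<and> card R = 3}"
    by (rule finite_subset[of _ "Pow ?Y"]) (auto simp: mis_def L.fin)
  ultimately have "card {F. mis X F \<and> card F = 5 \<and> x \<in> F \<and> y \<in> F} \<le> card {R. mis ?Y R \<and> card R = 3}"
    by (rule card_inj_on_le)
  also have "\<dots> \<le> card ?Y + 4096" by (rule L.card_mis3_le)
  also have "card ?Y \<le> card X" by (rule card_mono[OF fin sub])
  finally show ?thesis by simp
qed

lemma card_mis5_at:
  "real (card {F. mis X F \<and> card F = 5 \<and> x \<in> F}) \<le> 3 / 4 * (\<Sum>v\<in>X. real (deg X v)) + 4099 * (real (card X) + 1)"
proof -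
  let ?Y = "non_nbrs X x"
  interpret L: triangle_free adj ?Y by (rule triangle_free_subset[OF non_nbrs_subset])
  have "inj_on (\<lambda>F. F - {x}) {F. mis X F \<and> card F = 5 \<and> x \<in> F}" by (auto simp: inj_on_def)
  moreover have "(\<lambda>F. F - {x}) ` {F. mis X F \<and> card F = 5 \<and> x \<in> F} \<subseteq> {R. mis ?Y R \<and> card R = 4}"
    using mis_link by auto
  moreover have "finite {R. mis ?Y R \<and> card R = 4}"
    by (rule finite_subset[of _ "Pow ?Y"]) (auto simp: mis_def L.fin)
  ultimately have "card {F. mis X F \<and> card F = 5 \<and> x \<in> F} \<le> card {R. mis ?Y R \<and> card R = 4}"
    by (rule card_inj_on_le)
  then have "real (card {F. mis X F \<and> card F = 5 \<and> x \<in> F}) \<le> real (card {R. mis ?Y R \<and> card R = 4})" by simp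
  also have "\<dots> \<le> 3 / 4 * (\<Sum>v\<in>?Y. real (deg ?Y v)) + 4099 * (real (card ?Y) + 1)" by (rule L.card_mis4_le)
  also have "\<dots> \<le> 3 / 4 * (\<Sum>v\<in>X. real (deg X v)) + 4099 * (real (card X) + 1)"
  proof (intro add_mono mult_left_mono)
    have "(\<Sum>v\<in>?Y. real (deg ?Y v)) \<le> (\<Sum>v\<in>?Y. real (deg X v))"
      unfolding deg_def by (intro sum_mono of_nat_mono card_mono) (use fin non_nbrs_subset in auto)
    also have "\<dots> \<le> (\<Sum>v\<in>X. real (deg X v))" by (rule sum_mono2[OF fin non_nbrs_subset]) simp
    finally show "(\<Sum>v\<in>?Y. real (deg ?Y v)) \<le> (\<Sum>v\<in>X. real (deg X v))" .
    show "real (card ?Y) \<le> real (card X)" by (simp add: card_mono[OF fin non_nbrs_subset])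
  qed simp_all
  finally show ?thesis .
qed

text \<open>With a common vertex, the links are quadruples. Without one the family is only linear:
  every member meets \<open>F0\<close> in some \<open>x\<close>, and it meets a member
  \<open>G x\<close> that avoids \<open>x\<close> in some \<open>y \<noteq> x\<close>. So 25 pairs
  suffice, whence \<open>102400 = 25 * 4096\<close>.\<close>

lemma card_mis5_intersecting:
  assumes F: "\<And>F. F \<in> \<F> \<Longrightarrow> mis X F \<and> card F = 5"
    and meet: "\<And>F F'. F \<in> \<F> \<Longrightarrow> F' \<in> \<F> \<Longrightarrow> F \<inter> F' \<noteq> {}"
  shows "real (card \<F>) \<le> 3 / 4 * (\<Sum>v\<in>X. real (deg X v)) + 102400 * (real (card X) + 1)"
proof (cases "\<exists>x. \<forall>F\<in>\<F>. x \<in> F")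
  case True
  then obtain x where "\<forall>F\<in>\<F>. x \<in> F" by blast
  then have "\<F> \<subseteq> {F. mis X F \<and> card F = 5 \<and> x \<in> F}" using F by blast
  moreover have "finite {F. mis X F \<and> card F = 5 \<and> x \<in> F}"
    by (rule finite_subset[of _ "Pow X"]) (auto simp: mis_def fin)
  ultimately have "card \<F> \<le> card {F. mis X F \<and> card F = 5 \<and> x \<in> F}" by (rule card_mono[rotated])
  then show ?thesis using card_mis5_at[of x] by simp
next
  case False
  then obtain F0 where F0: "F0 \<in> \<F>" by blast
  obtain G where G: "\<And>x. G x \<in> \<F>" "\<And>x. x \<notin> G x" using False by metis
  let ?H = "\<lambda>(x, y). {F. mis X F \<and> card F = 5 \<and> x \<in> F \<and> y \<in> F}"
  have fin5: "finite F" "card F = 5" if "F \<in> \<F>" for F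
    using F[OF that] by (simp_all add: card_ge_0_finite)
  have "\<F> \<subseteq> (\<Union>p\<in>(SIGMA x:F0. G x). ?H p)"
  proof
    fix F1 assume F1: "F1 \<in> \<F>"
    obtain x where x: "x \<in> F0" "x \<in> F1" using meet[OF F0 F1] by blast
    obtain y where y: "y \<in> G x" "y \<in> F1" using meet[OF G(1) F1] by blast
    then have "F1 \<in> ?H (x, y)" using F[OF F1] x by simp
    then show "F1 \<in> (\<Union>p\<in>(SIGMA x:F0. G x). ?H p)" using x y by blast
  qed
  moreover have finS: "finite (SIGMA x:F0. G x)" using fin5 F0 G by (intro finite_SigmaI) auto
  moreover have "finite {F. mis X F \<and> P F}" for P
    by (rule finite_subset[of _ "Pow X"]) (auto simp: mis_def fin)
  ultimately have "card \<F> \<le> card (\<Union>p\<in>(SIGMA x:F0. G x). ?H p)" by (intro card_mono) auto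
  also have "\<dots> \<le> (\<Sum>p\<in>(SIGMA x:F0. G x). card (?H p))" by (rule card_UN_le[OF finS])
  also have "\<dots> \<le> (\<Sum>p\<in>(SIGMA x:F0. G x). card X + 4096)"
  proof (rule sum_mono)
    fix p assume "p \<in> (SIGMA x:F0. G x)"
    then obtain x y where p: "p = (x, y)" "y \<in> G x" by blast
    then have "x \<noteq> y" using G(2) by blast
    then show "card (?H p) \<le> card X + 4096" using card_mis_at_pair p by simp
  qed
  also have "\<dots> = 25 * (card X + 4096)" using fin5 F0 G by (simp add: card_SigmaI)
  finally have "real (card \<F>) \<le> real (25 * (card X + 4096))" by (rule of_nat_mono)
  then have "real (card \<F>) \<le> 25 * (real (card X) + 4096)" by simp
  moreover have "0 \<le> 3 / 4 * (\<Sum>v\<in>X. real (deg X v))" by (simp add: sum_nonneg)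
  moreover have "25 * (real (card X) + 4096) \<le> 102400 * (real (card X) + 1)" by simp
  ultimately show ?thesis by linarith
qed

end

definition low_const :: "nat \<Rightarrow> nat" where
  "low_const L = (1 + L + L * L) * (L + 1) ^ (L + 1)"

section \<open>Low vertices, the core and the neighbourhoods of outer vertices\<close>

locale sat_graph = sym_graph +
  fixes V :: "'a set" and s :: nat
  assumes finV: "finite V" and s1: "1 \<le> s"
    and noK: "K \<subseteq> V \<Longrightarrow> clq K \<Longrightarrow> card K \<le> s + 1"
    and sat: "\<lbrakk>u \<in> V; v \<in> V; u \<noteq> v; \<not> u \<sim> v\<rbrakk> \<Longrightarrow>
      \<exists>K\<subseteq>V. clq K \<and> card K = s \<and> (\<forall>w\<in>K. u \<sim> w \<and> v \<sim> w)"
    and twinfree: "\<lbrakk>u \<in> V; v \<in> V; u \<noteq> v\<rbrakk> \<Longrightarrow> {w \<in> V. u \<sim> w} \<noteq> {w \<in> V. v \<sim> w}"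
begin

abbreviation N :: "'a \<Rightarrow> 'a set" where "N v \<equiv> {w \<in> V. v \<sim> w}"

lemma card_N: "card (N v) = deg V v" by (simp add: deg_def)

definition low :: "nat \<Rightarrow> 'a set" where "low L = {v \<in> V. deg V v < L}"

definition low_adj :: "nat \<Rightarrow> 'a set" where "low_adj L = {v \<in> low L. \<exists>w\<in>low L. v \<sim> w}"

lemma card_near_low:
  assumes w: "w \<in> low L"
  shows "card ({w} \<union> N w \<union> (\<Union>u\<in>N w \<inter> low L. N u)) \<le> 1 + L + L * L"
proof -
  have "card ({w} \<union> N w \<union> (\<Union>u\<in>N w \<inter> low L. N u)) \<le> card {w} + card (N w) + card (\<Union>u\<in>N w \<inter> low L. N u)"
    by (intro order.trans[OF card_Un_le] add_mono order_refl)
  also have "card (\<Union>u\<in>N w \<inter> low L. N u) \<le> (\<Sum>u\<in>N w \<inter> low L. card (N u))"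
    by (rule card_UN_le) (simp add: finV)
  also have "\<dots> \<le> (\<Sum>u\<in>N w \<inter> low L. L)" by (intro sum_mono) (simp add: card_N low_def)
  also have "\<dots> = card (N w \<inter> low L) * L" by simp
  also have "\<dots> \<le> L * L"
  proof (rule mult_le_mono1)
    have "card (N w \<inter> low L) \<le> card (N w)" by (intro card_mono) (simp_all add: finV)
    then show "card (N w \<inter> low L) \<le> L" using w by (simp add: card_N low_def)
  qed
  finally show ?thesis using w by (simp add: card_N low_def)
qed

text \<open>Choose a low neighbour \<open>w v\<close> of each \<open>v\<close>. The sets
  \<open>?A v\<close> and \<open>?B v\<close> share no \<open>s\<close>-clique, which with
  \<open>v\<close> and \<open>w v\<close> would be too large. If \<open>u\<close> is not among the
  vertices counted by \<open>card_near_low\<close> for \<open>w v\<close>, saturation gives an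
  \<open>s\<close>-clique in the neighbourhoods of \<open>u\<close> and \<open>w v\<close>, and it
  has no low vertex because \<open>u\<close> is not adjacent to a low neighbour of
  \<open>w v\<close>.\<close>

lemma card_low_adj: "card (low_adj L) \<le> (1 + L + L * L) * (L + 1) ^ (L + 1)"
proof -
  have "\<forall>v\<in>low_adj L. \<exists>w. w \<in> low L \<and> v \<sim> w" by (auto simp: low_adj_def)
  then obtain w where w: "\<And>v. v \<in> low_adj L \<Longrightarrow> w v \<in> low L" "\<And>v. v \<in> low_adj L \<Longrightarrow> v \<sim> w v"
    by metis
  let ?P = "\<lambda>X. \<exists>K\<subseteq>X. clq K \<and> card K = s"
  let ?A = "\<lambda>v. N v - low L" and ?B = "\<lambda>v. N (w v) - low L"
  have lo: "v \<in> low L" if "v \<in> low_adj L" for v using that by (simp add: low_adj_def)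
  have cardA: "card (N v - low L) \<le> L" if "v \<in> low L" for v
  proof -
    have "card (N v - low L) \<le> card (N v)" by (intro card_mono) (simp_all add: finV)
    then show ?thesis using that by (simp add: card_N low_def)
  qed
  show ?thesis
  proof (rule set_pair_bound[where P = ?P and A = ?A and B = ?B and S = "{}" and a = L])
    fix v assume v: "v \<in> low_adj L"
    show "card (?A v) \<le> L" "card (?B v) \<le> L" using cardA lo[OF v] w(1)[OF v] by blast+
    show "\<not> ?P (?A v \<inter> ?B v)"
    proof
      assume "?P (?A v \<inter> ?B v)"
      then obtain K where K: "K \<subseteq> N v \<inter> N (w v)" "clq K" "card K = s" by blast
      have finK: "finite K" using K(1) finV by (auto intro: finite_subset)
      have vw: "v \<in> V" "w v \<in> V" "v \<sim> w v" using lo[OF v] w[OF v] by (auto simp: low_def)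
      have nK: "v \<notin> K" "w v \<notin> K" "v \<noteq> w v" using K(1) irrefl vw(3) by auto
      have "clq (insert v (insert (w v) K))" using K vw sym by (auto simp: clq_insert)
      moreover have "card (insert v (insert (w v) K)) = s + 2" using nK finK K(3) by simp
      ultimately show False using noK[of "insert v (insert (w v) K)"] K(1) vw by auto
    qed
    have "{u \<in> low_adj L. \<not> ?P (?A u \<inter> ?B v)} \<subseteq> {w v} \<union> N (w v) \<union> (\<Union>x\<in>N (w v) \<inter> low L. N x)"
    proof
      fix u assume u: "u \<in> {u \<in> low_adj L. \<not> ?P (?A u \<inter> ?B v)}"
      show "u \<in> {w v} \<union> N (w v) \<union> (\<Union>x\<in>N (w v) \<inter> low L. N x)"
      proof (rule ccontr)
        assume n: "\<not> ?thesis"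
        have V: "u \<in> V" "w v \<in> V" using u w(1)[OF v] by (auto simp: low_adj_def low_def)
        have ne: "u \<noteq> w v" "\<not> u \<sim> w v" using n V sym by auto
        obtain K where K: "K \<subseteq> V" "clq K" "card K = s" "\<forall>x\<in>K. u \<sim> x \<and> w v \<sim> x"
          using sat[OF V ne] by blast
        have "x \<notin> low L" if "x \<in> K" for x
        proof
          assume "x \<in> low L"
          moreover have "x \<in> N (w v)" "x \<sim> u" using K(1,4) that sym by blast+
          ultimately have "u \<in> (\<Union>x\<in>N (w v) \<inter> low L. N x)" using V by blast
          then show False using n by blast
        qed
        then have "K \<subseteq> ?A u \<inter> ?B v" using K by blast
        then show False using u K by blast
      qed
    qed
    then have "card {u \<in> low_adj L. \<not> ?P (?A u \<inter> ?B v)} \<le> card ({w v} \<union> N (w v) \<union> (\<Union>x\<in>N (w v) \<inter> low L. N x))"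
      by (intro card_mono) (simp_all add: finV)
    then show "card {u \<in> low_adj L. \<not> ?P (?A u \<inter> ?B v)} \<le> 1 + L + L * L"
      using card_near_low[OF w(1)[OF v]] by linarith
  qed (use finV in \<open>auto simp: low_adj_def low_def\<close>)
qed

definition core :: "nat \<Rightarrow> 'a set" where "core L = (V - low L) \<union> low_adj L"

definition outer :: "nat \<Rightarrow> 'a set" where "outer L = low L - low_adj L"

lemma core_outer: "core L \<union> outer L = V" "core L \<inter> outer L = {}"
  by (auto simp: core_def outer_def low_adj_def low_def)

lemma core_sub: "core L \<subseteq> V" and outer_sub: "outer L \<subseteq> V"
  using core_outer by blast+

lemma N_outer: "v \<in> outer L \<Longrightarrow> N v \<subseteq> core L"
  by (auto simp: core_def outer_def low_adj_def)

lemma card_core: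
  assumes "L > 0" shows "real (card (core L)) \<le> (\<Sum>v\<in>V. real (deg V v)) / L + low_const L"
proof -
  have "card (V - low L) * L = (\<Sum>v\<in>V - low L. L)" by simp
  also have "\<dots> \<le> (\<Sum>v\<in>V - low L. deg V v)" by (intro sum_mono) (auto simp: low_def)
  also have "\<dots> \<le> (\<Sum>v\<in>V. deg V v)" by (intro sum_mono2) (auto simp: finV)
  finally have "real (card (V - low L) * L) \<le> real (\<Sum>v\<in>V. deg V v)" by (rule of_nat_mono)
  then have "real (card (V - low L)) \<le> (\<Sum>v\<in>V. real (deg V v)) / L"
    using assms by (simp add: pos_le_divide_eq)
  moreover have "card (core L) \<le> card (V - low L) + card (low_adj L)" unfolding core_def by (rule card_Un_le)
  then have "real (card (core L)) \<le> real (card (V - low L)) + real (card (low_adj L))"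
    by (simp flip: of_nat_add)
  moreover have "real (card (low_adj L)) \<le> real (low_const L)"
    unfolding low_const_def by (rule of_nat_mono[OF card_low_adj])
  ultimately show ?thesis by linarith
qed

text \<open>Outer vertices have all their neighbours in the core, so the edges between the two parts
  contribute the outer degree sum once from each side.\<close>

lemma degree_split:
  "(\<Sum>v\<in>V. real (deg V v)) = 2 * (\<Sum>v\<in>outer L. real (deg V v)) + (\<Sum>v\<in>core L. real (deg (core L) v))"
proof -
  let ?Q = "core L" and ?W = "outer L"
  have fin: "finite ?Q" "finite ?W" by (rule finite_subset[OF core_sub finV], rule finite_subset[OF outer_sub finV])
  have "(\<Sum>v\<in>V. real (deg V v)) = (\<Sum>v\<in>?Q. real (deg V v)) + (\<Sum>v\<in>?W. real (deg V v))"
    using sum.union_disjoint[OF fin core_outer(2), of "\<lambda>v. real (deg V v)"] core_outer(1) by simp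
  moreover have "(\<Sum>v\<in>?Q. real (deg V v)) = (\<Sum>v\<in>?Q. real (deg ?Q v)) + (\<Sum>v\<in>?Q. real (deg ?W v))"
  proof -
    have "deg V v = deg ?Q v + deg ?W v" for v
    proof -
      have "N v = {u\<in>?Q. v \<sim> u} \<union> {u\<in>?W. v \<sim> u}" using core_outer(1) by blast
      then show ?thesis unfolding deg_def
        using fin core_outer(2) by (subst card_Un_disjoint[symmetric]) auto
    qed
    then show ?thesis by (simp add: sum.distrib)
  qed
  moreover have "(\<Sum>v\<in>?Q. real (deg ?W v)) = (\<Sum>v\<in>?W. real (deg V v))"
  proof -
    have "(\<Sum>v\<in>?Q. deg ?W v) = (\<Sum>v\<in>?Q. \<Sum>u\<in>{u\<in>?W. v \<sim> u}. 1)" by (simp add: deg_def)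
    also have "\<dots> = (\<Sum>u\<in>?W. \<Sum>v\<in>{v\<in>?Q. v \<sim> u}. 1)" by (rule sum.swap_restrict[OF fin])
    also have "\<dots> = (\<Sum>u\<in>?W. deg V u)"
    proof (rule sum.cong[OF refl])
      fix u assume "u \<in> ?W"
      then have "{v\<in>?Q. v \<sim> u} = N u" using N_outer[of u L] core_sub sym by blast
      then show "(\<Sum>v\<in>{v\<in>?Q. v \<sim> u}. 1) = deg V u" by (simp add: deg_def)
    qed
    finally show ?thesis by (metis of_nat_sum)
  qed
  ultimately show ?thesis by simp
qed

lemma Kfree_core: "Kfree_graph adj (core L) s"
proof unfold_locales
  show "finite (core L)" by (rule finite_subset[OF core_sub finV])
  show "card K \<le> s + 1" if "K \<subseteq> core L" "clq K" for K
    using noK[of K] that core_sub[of L] by blast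
qed (rule s1)

text \<open>The \<open>s\<close>-clique that saturation provides for the non-adjacent vertices
  \<open>v\<close> and \<open>z\<close> lies in \<open>N v\<close>, hence in the core; so saturation
  at \<open>v\<close> turns into maximality inside the core.\<close>

lemma good_N:
  assumes v: "v \<in> outer L" shows "Kfree_graph.good adj (core L) s (N v)"
proof -
  interpret K: Kfree_graph adj "core L" s by (rule Kfree_core)
  have vV: "v \<in> V" "v \<notin> core L" using v core_outer by blast+
  show ?thesis
    unfolding K.good_def
  proof (intro conjI allI impI ballI N_outer[OF v])
    fix K assume K: "K \<subseteq> N v" "clq K"
    have "finite K" "v \<notin> K" using K(1) finV irrefl by (auto intro: finite_subset)
    moreover have "clq (insert v K)" using K by (auto simp: clq_insert)
    moreover have "insert v K \<subseteq> V" using K(1) vV by blast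
    ultimately show "card K \<noteq> s + 1" using noK[of "insert v K"] by auto
  next
    fix z assume z: "z \<in> core L - N v"
    then have "z \<in> V" "z \<noteq> v" "\<not> v \<sim> z" using core_sub vV by blast+
    then obtain K where K: "K \<subseteq> V" "clq K" "card K = s" "\<forall>w\<in>K. v \<sim> w \<and> z \<sim> w"
      using sat[OF vV(1) \<open>z \<in> V\<close>] by blast
    then show "\<exists>K\<subseteq>N v. clq K \<and> card K = s \<and> (\<forall>u\<in>K. z \<sim> u)" by (intro exI[of _ K]) auto
  qed
qed

lemma meet_N:
  assumes "u \<in> outer L" "v \<in> outer L" "u \<noteq> v" shows "\<exists>K\<subseteq>N u \<inter> N v. clq K \<and> card K = s"
proof -
  have "u \<in> V" "v \<in> V" "v \<notin> core L" using assms core_outer by blast+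
  then have "\<not> u \<sim> v" using N_outer[OF assms(1)] by blast
  then obtain K where K: "K \<subseteq> V" "clq K" "card K = s" "\<forall>w\<in>K. u \<sim> w \<and> v \<sim> w"
    using sat[OF \<open>u \<in> V\<close> \<open>v \<in> V\<close> assms(3)] by blast
  then show ?thesis by (intro exI[of _ K]) auto
qed

lemma inj_N: "inj_on N (outer L)"
proof (rule inj_onI, rule ccontr)
  fix u v assume "u \<in> outer L" "v \<in> outer L" "N u = N v" "u \<noteq> v"
  then show False using twinfree[of u v] outer_sub by blast
qed

lemma card_small_degree:
  "card {v \<in> outer L. deg V v \<le> s + 3} \<le> 1 + 2 ^ (s + 3) * (small_const s * (card (core L) + 1))"
proof -
  interpret K: Kfree_graph adj "core L" s by (rule Kfree_core)
  let ?S = "{v \<in> outer L. deg V v \<le> s + 3}"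
  have "card (N ` ?S) \<le> 1 + 2 ^ (s + 3) * (small_const s * (card (core L) + 1))"
  proof (rule K.card_small_family)
    fix F assume "F \<in> N ` ?S"
    then show "K.good F \<and> card F \<le> s + 3" using good_N by (auto simp: card_N)
  next
    fix F F' assume "F \<in> N ` ?S" "F' \<in> N ` ?S" "F \<noteq> F'"
    then obtain u v where "u \<in> outer L" "v \<in> outer L" "F = N u" "F' = N v" "u \<noteq> v" by blast
    then show "\<exists>K\<subseteq>F \<inter> F'. clq K \<and> card K = s" using meet_N by simp
  qed
  moreover have "card (N ` ?S) = card ?S"
    by (rule card_image[OF inj_on_subset[OF inj_N]]) auto
  ultimately show ?thesis by simp
qed

text \<open>For \<open>s = 1\<close> good sets are maximal independent sets and 1-cliques are single
  vertices, so the neighbourhoods form an intersecting family.\<close>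

lemma card_degree_5:
  assumes s: "s = 1"
  shows "real (card {v \<in> outer L. deg V v = 5})
    \<le> 3 / 4 * (\<Sum>v\<in>core L. real (deg (core L) v)) + 102400 * (real (card (core L)) + 1)"
proof -
  interpret K: Kfree_graph adj "core L" s by (rule Kfree_core)
  interpret T: triangle_free adj "core L"
  proof unfold_locales
    show "finite (core L)" by (rule K.finQ)
    fix u v w assume *: "u \<in> core L" "v \<in> core L" "w \<in> core L" "u \<sim> v" "v \<sim> w" "u \<sim> w"
    have "u \<noteq> v" "v \<noteq> w" "u \<noteq> w" using * irrefl by auto
    moreover have "clq {u, v, w}" using * sym by (auto simp: clq_def)
    ultimately show False using K.clq_card[of "{u, v, w}"] * s by auto
  qed
  let ?S = "{v \<in> outer L. deg V v = 5}"
  have mis: "mis (core L) (N v)" if v: "v \<in> outer L" for v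
    unfolding mis_def
  proof (intro conjI ballI N_outer[OF v])
    fix u w assume "u \<in> N v" "w \<in> N v"
    show "\<not> u \<sim> w"
    proof
      assume uw: "u \<sim> w"
      then have "u \<noteq> w" using irrefl by blast
      then have "clq {u, w}" "card {u, w} = s + 1" using uw sym[OF uw] s by (simp_all add: clq_def)
      moreover have "{u, w} \<subseteq> N v" using \<open>u \<in> N v\<close> \<open>w \<in> N v\<close> by blast
      ultimately show False using K.goodD2[OF good_N[OF v], of "{u, w}"] by blast
    qed
  next
    fix z assume z: "z \<in> core L - N v"
    obtain K where K: "K \<subseteq> N v" "clq K" "card K = s" "\<And>u. u \<in> K \<Longrightarrow> z \<sim> u"
      by (rule K.goodE[OF good_N[OF v], of z]) (use z in blast)+
    obtain u where "K = {u}" using K(3) s by (auto simp: card_1_singleton_iff)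
    then show "\<exists>u\<in>N v. z \<sim> u" using K by blast
  qed
  have "real (card (N ` ?S)) \<le> 3 / 4 * (\<Sum>v\<in>core L. real (deg (core L) v)) + 102400 * (real (card (core L)) + 1)"
  proof (rule T.card_mis5_intersecting)
    fix F assume "F \<in> N ` ?S"
    then show "mis (core L) F \<and> card F = 5" using mis by (auto simp: card_N)
  next
    fix F F' assume "F \<in> N ` ?S" "F' \<in> N ` ?S"
    then obtain u v where uv: "u \<in> outer L" "v \<in> outer L" "F = N u" "F' = N v" "card (N u) = 5"
      by (auto simp: card_N)
    show "F \<inter> F' \<noteq> {}"
    proof (cases "u = v")
      case True then show ?thesis using uv by (metis Int_absorb card.empty zero_neq_numeral)
    next
      case False
      then obtain K where "K \<subseteq> F \<inter> F'" "card K = 1" using meet_N uv s by blast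
      then show ?thesis by (metis card.empty subset_empty zero_neq_one)
    qed
  qed
  moreover have "card (N ` ?S) = card ?S"
    by (rule card_image[OF inj_on_subset[OF inj_N]]) auto
  ultimately show ?thesis by simp
qed

end

subsection \<open>Lower bounds\<close>

lemma sum_indicator_card:
  assumes "finite W" shows "(\<Sum>v\<in>W. if P v then (c::real) else 0) = c * real (card {v\<in>W. P v})"
  using assms by (simp add: sum.If_cases Int_def)

context sat_graph begin

lemma card_outer: "real (card (outer L)) = real (card V) - real (card (core L))"
proof -
  have "finite (core L)" "finite (outer L)"
    by (rule finite_subset[OF core_sub finV], rule finite_subset[OF outer_sub finV])
  then have "card V = card (core L) + card (outer L)"
    using card_Un_disjoint core_outer[of L] by metis
  then show ?thesis by simp
qed

lemma card_small_degree_real: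
  "real (card {v \<in> outer L. deg V v \<le> s + 3}) \<le> (1 + 2 ^ (s + 3) * real (small_const s)) * (real (card (core L)) + 1)"
proof -
  have "real (card {v \<in> outer L. deg V v \<le> s + 3}) \<le> real (1 + 2 ^ (s + 3) * (small_const s * (card (core L) + 1)))"
    by (rule of_nat_mono[OF card_small_degree])
  also have "\<dots> = 1 + 2 ^ (s + 3) * real (small_const s) * (real (card (core L)) + 1)"
    by (simp add: algebra_simps)
  also have "\<dots> \<le> (1 + 2 ^ (s + 3) * real (small_const s)) * (real (card (core L)) + 1)"
    by (simp only: distrib_right) simp
  finally show ?thesis .
qed

lemma degree_sum_lower:
  "2 * ((real s + 4) * real (card V) - (real s + 4) * (2 + 2 ^ (s + 3) * real (small_const s)) * (real (card (core L)) + 1))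
    \<le> (\<Sum>v\<in>V. real (deg V v))"
proof -
  let ?W = "outer L" and ?B = "{v \<in> outer L. deg V v \<le> s + 3}" and ?q = "real (card (core L))"
  let ?c = "1 + 2 ^ (s + 3) * real (small_const s)"
  have finW: "finite ?W" by (rule finite_subset[OF outer_sub finV])
  have "(real s + 4) * (real (card V) - (1 + ?c) * (?q + 1)) \<le> (real s + 4) * (real (card ?W) - real (card ?B))"
    using card_small_degree_real[of L] card_outer[of L] by (intro mult_left_mono) (simp_all add: distrib_right)
  also have "\<dots> = (\<Sum>v\<in>?W. real s + 4) - (\<Sum>v\<in>?W. if deg V v \<le> s + 3 then real s + 4 else 0)"
    unfolding sum_indicator_card[OF finW] by (simp add: algebra_simps)
  also have "\<dots> = (\<Sum>v\<in>?W. (real s + 4) - (if deg V v \<le> s + 3 then real s + 4 else 0))"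
    by (simp add: sum_subtractf)
  also have "\<dots> \<le> (\<Sum>v\<in>?W. real (deg V v))" by (intro sum_mono) auto
  finally have "(real s + 4) * (real (card V) - (1 + ?c) * (?q + 1)) \<le> (\<Sum>v\<in>?W. real (deg V v))" .
  moreover have "0 \<le> (\<Sum>v\<in>core L. real (deg (core L) v))" by (simp add: sum_nonneg)
  ultimately have "2 * ((real s + 4) * (real (card V) - (1 + ?c) * (?q + 1))) \<le> (\<Sum>v\<in>V. real (deg V v))"
    using degree_split[of L] by linarith
  then show ?thesis by (simp add: right_diff_distrib mult.assoc)
qed

lemma degree_sum_lower_3:
  assumes s: "s = 1"
  shows "2 * ((5 + 2 / 3) * real (card V) - (70000 + 6 * (1 + 2 ^ (s + 3) * real (small_const s))) * (real (card (core L)) + 1))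
    \<le> (\<Sum>v\<in>V. real (deg V v))"
proof -
  let ?W = "outer L" and ?B = "{v \<in> outer L. deg V v \<le> s + 3}" and ?B5 = "{v \<in> outer L. deg V v = 5}"
  let ?q = "real (card (core L))" and ?SQ = "\<Sum>v\<in>core L. real (deg (core L) v)"
  let ?SW = "\<Sum>v\<in>outer L. real (deg V v)"
  have finW: "finite ?W" by (rule finite_subset[OF outer_sub finV])
  have "6 * real (card ?W) - real (card ?B5) - 6 * real (card ?B)
      = (\<Sum>v\<in>?W. 6) - (\<Sum>v\<in>?W. if deg V v = 5 then 1 else 0) - (\<Sum>v\<in>?W. if deg V v \<le> s + 3 then 6 else 0)"
    unfolding sum_indicator_card[OF finW] by simp
  also have "\<dots> = (\<Sum>v\<in>?W. 6 - (if deg V v = 5 then 1 else 0) - (if deg V v \<le> s + 3 then 6 else 0))"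
    by (simp add: sum_subtractf)
  also have "\<dots> \<le> ?SW" by (intro sum_mono) (auto simp: s)
  finally have 1: "6 * real (card ?W) - real (card ?B5) - 6 * real (card ?B) \<le> ?SW" .
  have 2: "real (card ?B5) \<le> 3 / 4 * ?SQ + 102400 * (?q + 1)" by (rule card_degree_5[OF s])
  have 3: "real (card ?B) \<le> (1 + 2 ^ (s + 3) * real (small_const s)) * (?q + 1)" by (rule card_small_degree_real)
  have 4: "real (card ?B5) \<le> real (card ?W)" using finW by (simp add: card_mono)
  have 5: "real (card ?W) = real (card V) - ?q" by (rule card_outer)
  have 6: "(\<Sum>v\<in>V. real (deg V v)) = 2 * ?SW + ?SQ" by (rule degree_split)
  define X where "X = (1 + 2 ^ (s + 3) * real (small_const s)) * (?q + 1)"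
  have "(70000 + 6 * (1 + 2 ^ (s + 3) * real (small_const s))) * (?q + 1) = 70000 * (?q + 1) + 6 * X"
    unfolding X_def by (simp add: algebra_simps)
  moreover have "0 \<le> ?q" by simp
  \<comment> \<open>Twice the first bound plus 4/3 of the second leaves
    \<open>12 * card ?W - 2/3 * card ?B5\<close>, which is at least \<open>34/3 * card ?W\<close>.
    The constant 70000 exceeds \<open>2/3 * 102400 + 17/3\<close>.\<close>
  ultimately show ?thesis using 1 2 3 4 5 6 unfolding X_def[symmetric] by argo
qed

end

section \<open>From edge sets to the locale, and from degree sums to edges\<close>

lemma clique_iff_clq:
  assumes "sym_graph (\<lambda>u v. {u, v} \<in> E)"
  shows "sym_graph.clq (\<lambda>u v. {u, v} \<in> E) K \<longleftrightarrow> clique K E"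
  unfolding sym_graph.clq_def[OF assms] clique_def by blast

lemma sym_graph_of_edges:
  assumes "simple_graph V E" shows "sym_graph (\<lambda>u v. {u, v} \<in> E)"
proof
  show "{v, u} \<in> E" if "{u, v} \<in> E" for u v using that by (simp add: insert_commute)
  show "{u, u} \<notin> E" for u
  proof
    assume "{u, u} \<in> E"
    then have "card {u, u} = 2" using assms unfolding simple_graph_def nsets_def by blast
    then show False by simp
  qed
qed

text \<open>A clique on \<open>r\<close> vertices created by a new edge contains both ends of it;
  the other \<open>r - 2\<close> vertices are the common clique that the locale asks for.\<close>

lemma sat_graph_of_K_saturated:
  assumes G: "simple_graph V E" and tw: "twin_free V E" and sat: "K_saturated r V E" and r: "3 \<le> r"
  shows "sat_graph (\<lambda>u v. {u, v} \<in> E) V (r - 2)"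
proof -
  interpret sym_graph "\<lambda>u v. {u, v} \<in> E" by (rule sym_graph_of_edges[OF G])
  note cl = clique_iff_clq[OF sym_graph_axioms]
  have noK: "\<not> contains_K r V E" using sat by (simp add: K_saturated_def)
  have finV: "finite V" using G by (simp add: simple_graph_def)
  show ?thesis
  proof
    show "finite V" by (rule finV)
    show "1 \<le> r - 2" using r by simp
    fix K assume K: "K \<subseteq> V" "clq K"
    show "card K \<le> r - 2 + 1"
    proof (rule ccontr)
      assume "\<not> ?thesis"
      then have "r \<le> card K" by simp
      then obtain S where S: "S \<subseteq> K" "card S = r" by (meson obtain_subset_with_card_n)
      then have "S \<in> nsets V r" using K finV by (auto simp: nsets_def intro: finite_subset)
      moreover have "clique S E" using clq_subset[OF K(2) S(1)] cl by simp
      ultimately show False using noK by (auto simp: contains_K_def)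
    qed
  next
    fix u v assume uv: "u \<in> V" "v \<in> V" "u \<noteq> v" "{u, v} \<notin> E"
    have "{u, v} \<in> nsets V 2 - E" using uv by (simp add: nsets_def)
    then have "contains_K r V (insert {u, v} E)" using sat unfolding K_saturated_def by blast
    then obtain S where S: "S \<subseteq> V" "finite S" "card S = r" "clique S (insert {u, v} E)"
      by (auto simp: contains_K_def nsets_def)
    have e: "{x, y} \<in> E" if "x \<in> S" "y \<in> S" "x \<noteq> y" "{x, y} \<noteq> {u, v}" for x y
      using S(4) that unfolding clique_def by blast
    have uvS: "u \<in> S" "v \<in> S"
    proof -
      have "clique S E" if "u \<notin> S \<or> v \<notin> S"
        unfolding clique_def
      proof (intro ballI impI)
        fix x y assume xy: "x \<in> S" "y \<in> S" "x \<noteq> y"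
        then have "{x, y} \<noteq> {u, v}" using that by (auto simp: doubleton_eq_iff)
        then show "{x, y} \<in> E" using e xy by blast
      qed
      then show "u \<in> S" "v \<in> S" using noK S(1-3) unfolding contains_K_def nsets_def by blast+
    qed
    let ?K = "S - {u, v}"
    have "card ?K = r - 2" using uvS S(2,3) uv(3) by (simp add: card_Diff_subset)
    moreover have "clq ?K" unfolding clq_def using e by (auto simp: doubleton_eq_iff)
    moreover have "{u, w} \<in> E \<and> {v, w} \<in> E" if "w \<in> ?K" for w
      using e[of u w] e[of v w] uvS that by (auto simp: doubleton_eq_iff)
    ultimately show "\<exists>K\<subseteq>V. clq K \<and> card K = r - 2 \<and> (\<forall>w\<in>K. {u, w} \<in> E \<and> {v, w} \<in> E)"
      using S(1) by (intro exI[of _ ?K]) auto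
  next
    fix u v assume "u \<in> V" "v \<in> V" "u \<noteq> v"
    then show "{w \<in> V. {u, w} \<in> E} \<noteq> {w \<in> V. {v, w} \<in> E}"
      using tw unfolding twin_free_def twins_def neighbourhood_def by blast
  qed
qed

lemma handshake:
  assumes G: "simple_graph V E"
  shows "(\<Sum>v\<in>V. real (sym_graph.deg (\<lambda>u v. {u, v} \<in> E) V v)) = 2 * real (card E)"
proof -
  interpret sym_graph "\<lambda>u v. {u, v} \<in> E" by (rule sym_graph_of_edges[OF G])
  have finV: "finite V" and E: "E \<subseteq> nsets V 2" using G by (auto simp: simple_graph_def)
  have finE: "finite E" using E finV finite_imp_finite_nsets finite_subset by blast
  have d: "deg V v = card {e \<in> E. v \<in> e}" if "v \<in> V" for v
    unfolding deg_def
  proof (rule bij_betw_same_card[of "\<lambda>w. {v, w}"], rule bij_betw_imageI)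
    show "inj_on (\<lambda>w. {v, w}) {u \<in> V. {v, u} \<in> E}" by (auto simp: inj_on_def doubleton_eq_iff)
    show "(\<lambda>w. {v, w}) ` {u \<in> V. {v, u} \<in> E} = {e \<in> E. v \<in> e}"
    proof (intro equalityI subsetI)
      fix e assume e: "e \<in> {e \<in> E. v \<in> e}"
      then obtain x y where xy: "e = {x, y}" "x \<in> V" "y \<in> V" "x \<noteq> y" using E by (blast elim: nsets2_E)
      then have "e = {v, x} \<or> e = {v, y}" using e by auto
      then show "e \<in> (\<lambda>w. {v, w}) ` {u \<in> V. {v, u} \<in> E}" using e xy by blast
    qed blast
  qed
  have "(\<Sum>v\<in>V. deg V v) = (\<Sum>v\<in>V. \<Sum>e\<in>{e \<in> E. v \<in> e}. 1::nat)" using d by simp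
  also have "\<dots> = (\<Sum>e\<in>E. \<Sum>v\<in>{v \<in> V. v \<in> e}. 1)" by (rule sum.swap_restrict[OF finV finE])
  also have "\<dots> = (\<Sum>e\<in>E. 2::nat)"
  proof (rule sum.cong[OF refl])
    fix e assume "e \<in> E"
    then have e: "e \<subseteq> V" "card e = 2" using E by (auto simp: nsets_def)
    then have "{v \<in> V. v \<in> e} = e" by blast
    then show "(\<Sum>v\<in>{v \<in> V. v \<in> e}. 1::nat) = 2" using e by simp
  qed
  also have "\<dots> = 2 * card E" by simp
  finally have "real (\<Sum>v\<in>V. deg V v) = real (2 * card E)" by (rule arg_cong)
  then show ?thesis by simp
qed

text \<open>If the degree sum \<open>D\<close> is at least \<open>2 * \<alpha> * real n\<close>, the
  claim is immediate. Otherwise \<open>q\<close> is at most \<open>2 * \<alpha> * real n / L\<close>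
  plus a constant, and a large \<open>L\<close> makes the loss \<open>C * (real q + 1)\<close>
  small. So graphs with many edges are dealt with here.\<close>

lemma core_negligible:
  fixes \<alpha> C \<epsilon> :: real
  assumes "0 < \<alpha>" "0 < C" "0 < \<epsilon>"
  obtains L n0 :: nat where "0 < L"
    "\<And>n D q. \<lbrakk>n0 \<le> n; real q \<le> D / L + low_const L; 2 * (\<alpha> * real n - C * (real q + 1)) \<le> D\<rbrakk>
      \<Longrightarrow> 2 * (\<alpha> - \<epsilon>) * real n \<le> D"
proof -
  \<comment> \<open>The choice of \<open>L\<close> spends half of \<open>\<epsilon> * real n\<close>
    on the linear part of the loss, that of \<open>n0\<close> the other half on the constant
    part.\<close>
  define L where "L = nat \<lceil>4 * C * \<alpha> / \<epsilon>\<rceil> + 1"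
  define Z where "Z = real (low_const L)"
  define n0 where "n0 = nat \<lceil>2 * C * (Z + 1) / \<epsilon>\<rceil>"
  have L: "4 * C * \<alpha> / \<epsilon> \<le> real L" "0 < L" unfolding L_def by linarith+
  then have L': "4 * C * \<alpha> \<le> \<epsilon> * real L" using assms by (simp add: pos_divide_le_eq mult.commute)
  show ?thesis
  proof (rule that[OF L(2)])
    fix n D q assume n: "n0 \<le> n" and q: "real q \<le> D / L + low_const L"
      and D: "2 * (\<alpha> * real n - C * (real q + 1)) \<le> D"
    have "2 * C * (Z + 1) / \<epsilon> \<le> real n" using n unfolding n0_def by linarith
    then have n1: "2 * C * (Z + 1) \<le> \<epsilon> * real n" using assms by (simp add: pos_divide_le_eq mult.commute)
    show "2 * (\<alpha> - \<epsilon>) * real n \<le> D"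
    proof (cases "2 * \<alpha> * real n \<le> D")
      case True
      have "2 * (\<alpha> - \<epsilon>) * real n \<le> 2 * \<alpha> * real n" using assms by (intro mult_right_mono) auto
      then show ?thesis using True by linarith
    next
      case False
      have "D / L \<le> 2 * \<alpha> * real n / L" using False L by (intro divide_right_mono) auto
      then have "real q + 1 \<le> 2 * \<alpha> * real n / L + (Z + 1)" using q by (simp add: Z_def)
      then have "C * (real q + 1) \<le> C * (2 * \<alpha> * real n / L + (Z + 1))" using assms by (intro mult_left_mono) auto
      also have "\<dots> = (4 * C * \<alpha>) * real n / (2 * L) + C * (Z + 1)" by (simp add: field_simps)
      also have "\<dots> \<le> (\<epsilon> * real L) * real n / (2 * L) + C * (Z + 1)"
        using L' L by (intro add_right_mono divide_right_mono mult_right_mono) auto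
      also have "(\<epsilon> * real L) * real n / (2 * L) = \<epsilon> * real n / 2" using L by (simp add: field_simps)
      finally have "2 * (C * (real q + 1)) \<le> 2 * (\<epsilon> * real n)" using n1 by linarith
      then show ?thesis using D by (simp add: algebra_simps)
    qed
  qed
qed

theorem K_saturated_lower:
  fixes \<epsilon> :: real
  assumes r: "3 \<le> r" and "0 < \<epsilon>"
  obtains n0 where "\<And>(V :: 'a set) E. \<lbrakk>simple_graph V E; twin_free V E; K_saturated r V E; n0 \<le> card V\<rbrakk>
    \<Longrightarrow> (real r + 2 - \<epsilon>) * real (card V) \<le> real (card E)"
proof -
  define s where "s = r - 2"
  define C where "C = (real s + 4) * (2 + 2 ^ (s + 3) * real (small_const s))"
  have C: "0 < C" unfolding C_def by (intro mult_pos_pos add_nonneg_pos add_pos_nonneg[of 2]) auto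
  obtain L n0 where L: "0 < L" and *: "\<And>n D q. \<lbrakk>n0 \<le> n; real q \<le> D / L + low_const L;
      2 * ((real s + 4) * real n - C * (real q + 1)) \<le> D\<rbrakk> \<Longrightarrow> 2 * (real s + 4 - \<epsilon>) * real n \<le> D"
    by (rule core_negligible[of "real s + 4" C \<epsilon>]) (use C assms in auto)
  show ?thesis
  proof (rule that)
    fix V :: "'a set" and E
    assume G: "simple_graph V E" "twin_free V E" "K_saturated r V E" and n: "n0 \<le> card V"
    interpret sat_graph "\<lambda>u v. {u, v} \<in> E" V s
      unfolding s_def by (rule sat_graph_of_K_saturated[OF G r])
    have "2 * (real s + 4 - \<epsilon>) * real (card V) \<le> (\<Sum>v\<in>V. real (deg V v))"
      by (rule *[OF n card_core[OF L]]) (use degree_sum_lower[of L] in \<open>simp add: C_def\<close>)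
    then have "2 * ((real s + 4 - \<epsilon>) * real (card V)) \<le> 2 * real (card E)"
      unfolding handshake[OF G(1)] mult.assoc .
    moreover have "real s + 4 = real r + 2" using r by (simp add: s_def)
    ultimately show "(real r + 2 - \<epsilon>) * real (card V) \<le> real (card E)" by simp
  qed
qed

theorem K3_saturated_lower:
  fixes \<epsilon> :: real
  assumes "0 < \<epsilon>"
  obtains n0 where "\<And>(V :: 'a set) E. \<lbrakk>simple_graph V E; twin_free V E; K_saturated 3 V E; n0 \<le> card V\<rbrakk>
    \<Longrightarrow> (5 + 2 / 3 - \<epsilon>) * real (card V) \<le> real (card E)"
proof -
  define C where "C = 70000 + 6 * (1 + 2 ^ (1 + 3) * real (small_const 1))"
  have C: "0 < C" unfolding C_def by (intro add_pos_nonneg) auto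
  obtain L n0 where L: "0 < L" and *: "\<And>n D q. \<lbrakk>n0 \<le> n; real q \<le> D / L + low_const L;
      2 * ((5 + 2 / 3) * real n - C * (real q + 1)) \<le> D\<rbrakk> \<Longrightarrow> 2 * (5 + 2 / 3 - \<epsilon>) * real n \<le> D"
    by (rule core_negligible[of "5 + 2 / 3" C \<epsilon>]) (use C assms in auto)
  show ?thesis
  proof (rule that)
    fix V :: "'a set" and E
    assume G: "simple_graph V E" "twin_free V E" "K_saturated 3 V E" and n: "n0 \<le> card V"
    have "sat_graph (\<lambda>u v. {u, v} \<in> E) V (3 - 2)" by (rule sat_graph_of_K_saturated[OF G]) simp
    then interpret sat_graph "\<lambda>u v. {u, v} \<in> E" V 1 by simp
    have "2 * (5 + 2 / 3 - \<epsilon>) * real (card V) \<le> (\<Sum>v\<in>V. real (deg V v))"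
      by (rule *[OF n card_core[OF L]]) (use degree_sum_lower_3[OF refl, of L] in \<open>simp only: C_def\<close>)
    then have "2 * ((5 + 2 / 3 - \<epsilon>) * real (card V)) \<le> 2 * real (card E)"
      unfolding handshake[OF G(1)] mult.assoc .
    then show "(5 + 2 / 3 - \<epsilon>) * real (card V) \<le> real (card E)"
      by (rule mult_left_le_imp_le) simp
  qed
qed

subsection \<open>Upper bounds\<close>

lemma edge_image_iff:
  assumes "inj_on f V" "E \<subseteq> Pow V" "A \<subseteq> V"
  shows "f ` A \<in> (`) f ` E \<longleftrightarrow> A \<in> E"
proof
  assume "f ` A \<in> (`) f ` E"
  then obtain B where "B \<in> E" "f ` A = f ` B" by blast
  then show "A \<in> E" using inj_on_image_eq_iff[OF assms(1), of A B] assms(2,3) by blast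
qed blast

lemma contains_K_image:
  assumes inj: "inj_on f V" and E: "E \<subseteq> Pow V"
  shows "contains_K r (f ` V) ((`) f ` E) \<longleftrightarrow> contains_K r V E"
proof
  have cl: "clique (f ` S) ((`) f ` E) \<longleftrightarrow> clique S E" if S: "S \<subseteq> V" for S
  proof -
    have "f u = f v \<longleftrightarrow> u = v" "{f u, f v} \<in> (`) f ` E \<longleftrightarrow> {u, v} \<in> E" if "u \<in> S" "v \<in> S" for u v
      using inj_on_eq_iff[OF inj, of u v] edge_image_iff[OF inj E, of "{u, v}"] that S by auto
    then show ?thesis by (simp add: clique_def)
  qed
  {
    assume "contains_K r (f ` V) ((`) f ` E)"
    then obtain T where T: "T \<subseteq> f ` V" "finite T" "card T = r" "clique T ((`) f ` E)"
      by (auto simp: contains_K_def nsets_def)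
    then obtain S where S: "S \<subseteq> V" "T = f ` S" by (auto simp: subset_image_iff)
    have injS: "inj_on f S" by (rule inj_on_subset[OF inj S(1)])
    have "S \<in> nsets V r" using S T injS by (simp add: nsets_def card_image finite_image_iff)
    then show "contains_K r V E" using cl[OF S(1)] S T by (auto simp: contains_K_def)
  next
    assume "contains_K r V E"
    then obtain S where S: "S \<subseteq> V" "finite S" "card S = r" "clique S E"
      by (auto simp: contains_K_def nsets_def)
    have "f ` S \<in> nsets (f ` V) r"
      using S card_image[OF inj_on_subset[OF inj S(1)]] by (auto simp: nsets_def)
    then show "contains_K r (f ` V) ((`) f ` E)" using cl[OF S(1)] S(4) unfolding contains_K_def by blast
  }
qed

definition tsat_graph :: "'a set \<Rightarrow> 'a set set \<Rightarrow> nat \<Rightarrow> bool" where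
  "tsat_graph V E r \<longleftrightarrow> simple_graph V E \<and> twin_free V E \<and> K_saturated r V E"

lemma tsat_graph_image:
  assumes G: "tsat_graph V E r" and inj: "inj_on f V"
  shows "tsat_graph (f ` V) ((`) f ` E) r" "card (f ` V) = card V" "card ((`) f ` E) = card E"
proof -
  have finV: "finite V" and E2: "E \<subseteq> nsets V 2" and tw: "twin_free V E" and sat: "K_saturated r V E"
    using G by (auto simp: tsat_graph_def simple_graph_def)
  have E: "E \<subseteq> Pow V" using E2 by (auto simp: nsets_def)
  show "card (f ` V) = card V" by (rule card_image[OF inj])
  have "inj_on ((`) f) E" using inj_on_image_eq_iff[OF inj] E by (intro inj_onI) blast
  then show "card ((`) f ` E) = card E" by (rule card_image)
  have im: "f ` A \<in> nsets (f ` V) 2" if "A \<in> nsets V 2" for A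
    using that card_image[OF inj_on_subset[OF inj]] by (auto simp: nsets_def)
  have "simple_graph (f ` V) ((`) f ` E)"
    using finV im E2 by (auto simp: simple_graph_def)
  moreover have "twin_free (f ` V) ((`) f ` E)"
    unfolding twin_free_def
  proof (intro ballI)
    fix x y assume "x \<in> f ` V" "y \<in> f ` V"
    then obtain u v where uv: "u \<in> V" "v \<in> V" "x = f u" "y = f v" by blast
    have nb: "neighbourhood (f ` V) ((`) f ` E) (f u) = f ` neighbourhood V E u" if "u \<in> V" for u
    proof -
      have "{f u, f w} \<in> (`) f ` E \<longleftrightarrow> {u, w} \<in> E" if "w \<in> V" for w
        using edge_image_iff[OF inj E, of "{u, w}"] that \<open>u \<in> V\<close> by simp
      then show ?thesis by (auto simp: neighbourhood_def)
    qed
    have sub: "neighbourhood V E w \<subseteq> V" for w by (auto simp: neighbourhood_def)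
    show "\<not> twins (f ` V) ((`) f ` E) x y"
    proof
      assume "twins (f ` V) ((`) f ` E) x y"
      then have "u \<noteq> v" "f ` neighbourhood V E u = f ` neighbourhood V E v"
        using uv nb by (auto simp: twins_def)
      then have "twins V E u v" using inj_on_image_eq_iff[OF inj sub sub] by (simp add: twins_def)
      then show False using tw uv by (auto simp: twin_free_def)
    qed
  qed
  moreover have "K_saturated r (f ` V) ((`) f ` E)"
    unfolding K_saturated_def
  proof (intro conjI ballI)
    show "\<not> contains_K r (f ` V) ((`) f ` E)"
      using sat contains_K_image[OF inj E] by (simp add: K_saturated_def)
    fix e assume e: "e \<in> nsets (f ` V) 2 - (`) f ` E"
    then obtain A where A: "A \<subseteq> V" "e = f ` A" by (auto simp: nsets_def subset_image_iff)
    have injA: "inj_on f A" by (rule inj_on_subset[OF inj A(1)])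
    have "A \<in> nsets V 2 - E" using e A injA by (auto simp: nsets_def card_image finite_image_iff)
    then have "contains_K r V (insert A E)" using sat by (simp add: K_saturated_def)
    then show "contains_K r (f ` V) (insert e ((`) f ` E))"
      using contains_K_image[OF inj, of "insert A E" r] E A by simp
  qed
  ultimately show "tsat_graph (f ` V) ((`) f ` E) r" by (simp add: tsat_graph_def)
qed

lemma tsat_graph_nat:
  assumes G: "tsat_graph V E r"
  obtains V' :: "nat set" and E' where "tsat_graph V' E' r" "card V' = card V" "card E' = card E"
proof -
  have "finite V" using G by (simp add: tsat_graph_def simple_graph_def)
  then obtain f :: "'a \<Rightarrow> nat" where "inj_on f V" using finite_imp_inj_to_nat_seg by metis
  then show ?thesis using that tsat_graph_image[OF G] by blast
qed

section \<open>Adding universal vertices\<close>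

text \<open>Cliques lose at most one vertex when \<open>v\<close> is removed and gain one when it is
  added, and missing edges lie inside \<open>V\<close>. The vertex \<open>v\<close> has no twin,
  being adjacent to all vertices but itself.\<close>

lemma tsat_graph_join_vertex:
  assumes G: "tsat_graph V E r" and v: "v \<notin> V"
  defines "E' \<equiv> E \<union> (\<lambda>u. {v, u}) ` V"
  shows "tsat_graph (insert v V) E' (Suc r)" "card E' = card E + card V"
proof -
  have finV: "finite V" and E2: "E \<subseteq> nsets V 2" and tw: "twin_free V E" and sat: "K_saturated r V E"
    using G by (auto simp: tsat_graph_def simple_graph_def)
  have E: "e \<subseteq> V" if "e \<in> E" for e using that E2 by (auto simp: nsets_def)
  have finE: "finite E" using E2 finite_imp_finite_nsets[OF finV] finite_subset by blast
  have "inj_on (\<lambda>u. {v, u}) V" by (auto simp: inj_on_def doubleton_eq_iff)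
  then have "card ((\<lambda>u. {v, u}) ` V) = card V" by (rule card_image)
  moreover have "E \<inter> (\<lambda>u. {v, u}) ` V = {}" using E v by blast
  ultimately show "card E' = card E + card V"
    unfolding E'_def using finE finV by (simp add: card_Un_disjoint)
  have old: "A \<in> E' \<longleftrightarrow> A \<in> E" if "A \<subseteq> V" for A using that v unfolding E'_def by blast
  have new: "{v, u} \<in> E'" "{u, v} \<in> E'" if "u \<in> V" for u
    using that unfolding E'_def by (auto simp: insert_commute)
  have vv: "{v, v} \<notin> E'" using v E[of "{v, v}"] unfolding E'_def by (auto simp: doubleton_eq_iff)
  have "(\<lambda>u. {v, u}) ` V \<subseteq> nsets (insert v V) 2" using v by (auto simp: nsets_def card_insert_if)
  then have "E' \<subseteq> nsets (insert v V) 2"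
    using E2 nsets_mono[of V "insert v V" 2] unfolding E'_def by blast
  then have "simple_graph (insert v V) E'" using finV by (simp add: simple_graph_def)
  moreover have "twin_free (insert v V) E'"
    unfolding twin_free_def twins_def
  proof (intro ballI notI, elim conjE)
    fix x y assume xy: "x \<in> insert v V" "y \<in> insert v V" "x \<noteq> y"
      and nb: "neighbourhood (insert v V) E' x = neighbourhood (insert v V) E' y"
    show False
    proof (cases "x = v \<or> y = v")
      case True
      then have "v \<in> neighbourhood (insert v V) E' x \<longleftrightarrow> v \<notin> neighbourhood (insert v V) E' y"
        using xy new vv by (auto simp: neighbourhood_def)
      then show False using nb by simp
    next
      case False
      then have xyV: "x \<in> V" "y \<in> V" using xy by auto
      have "neighbourhood V E z = neighbourhood (insert v V) E' z - {v}" if "z \<in> V" for z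
        using old that v by (auto simp: neighbourhood_def)
      then have "neighbourhood V E x = neighbourhood V E y" using nb xyV by simp
      then show False using tw xyV xy(3) by (auto simp: twin_free_def twins_def)
    qed
  qed
  moreover have "K_saturated (Suc r) (insert v V) E'"
    unfolding K_saturated_def
  proof (intro conjI ballI notI)
    assume "contains_K (Suc r) (insert v V) E'"
    then obtain S where S: "S \<subseteq> insert v V" "finite S" "card S = Suc r" "clique S E'"
      by (auto simp: contains_K_def nsets_def)
    have "r \<le> card (S - {v})" using S by (simp add: card_Diff_singleton_if)
    then obtain T where T: "T \<subseteq> S - {v}" "card T = r" by (meson obtain_subset_with_card_n)
    have TV: "T \<subseteq> V" using T S by blast
    have "{x, y} \<in> E" if "x \<in> T" "y \<in> T" "x \<noteq> y" for x y
      using S(4) old[of "{x, y}"] that T TV unfolding clique_def by blast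
    then have "clique T E" by (simp add: clique_def)
    moreover have "T \<in> nsets V r" using TV T finV by (auto simp: nsets_def intro: finite_subset)
    ultimately show False using sat unfolding K_saturated_def contains_K_def by blast
  next
    fix e assume e: "e \<in> nsets (insert v V) 2 - E'"
    then obtain x y where xy: "e = {x, y}" "x \<in> insert v V" "y \<in> insert v V" "x \<noteq> y"
      by (blast elim: nsets2_E)
    have "x \<noteq> v" "y \<noteq> v" using e xy new by auto
    then have "e \<in> nsets V 2 - E" using e xy old[of e] by (auto simp: nsets_def)
    then have "contains_K r V (insert e E)" using sat by (simp add: K_saturated_def)
    then obtain S where S: "S \<subseteq> V" "finite S" "card S = r" "clique S (insert e E)"
      by (auto simp: contains_K_def nsets_def)
    have "clique (insert v S) (insert e E')"
      unfolding clique_def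
    proof (intro ballI impI)
      fix a b assume ab: "a \<in> insert v S" "b \<in> insert v S" "a \<noteq> b"
      show "{a, b} \<in> insert e E'"
      proof (cases "a = v \<or> b = v")
        case True then show ?thesis using ab new S(1) by blast
      next
        case False
        then have "{a, b} \<in> insert e E" using S(4) ab unfolding clique_def by blast
        then show ?thesis unfolding E'_def by blast
      qed
    qed
    moreover have "v \<notin> S" using S(1) v by blast
    then have "insert v S \<in> nsets (insert v V) (Suc r)" using S by (auto simp: nsets_def)
    ultimately show "contains_K (Suc r) (insert v V) (insert e E')" unfolding contains_K_def by blast
  qed
  ultimately show "tsat_graph (insert v V) E' (Suc r)" by (simp add: tsat_graph_def)
qed

lemma tsat_graph_add_universal:
  assumes "tsat_graph (V :: nat set) E 3"
  shows "\<exists>(V' :: nat set) E'. tsat_graph V' E' (3 + m) \<and> card V' = card V + m \<and> card E' \<le> card E + m * (card V + m)"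
proof (induction m)
  case 0 then show ?case using assms by auto
next
  case (Suc m)
  then obtain V' :: "nat set" and E' where G: "tsat_graph V' E' (3 + m)" "card V' = card V + m"
    "card E' \<le> card E + m * (card V + m)" by blast
  have fin: "finite V'" using G by (simp add: tsat_graph_def simple_graph_def)
  then obtain v where v: "v \<notin> V'" using ex_new_if_finite infinite_UNIV_nat by blast
  note J = tsat_graph_join_vertex[OF G(1) v]
  let ?E = "E' \<union> (\<lambda>u. {v, u}) ` V'"
  have "tsat_graph (insert v V') ?E (3 + Suc m)" using J(1) by simp
  moreover have "card (insert v V') = card V + Suc m" using G(2) v fin by simp
  moreover have "card ?E \<le> card E + Suc m * (card V + Suc m)" using J(2) G(2,3) by simp
  ultimately show ?case by blast
qed

lemma tsat_graph_tsat:
  assumes "tsat_graph (V :: nat set) E r"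
  shows "tsat (card V) r \<le> card E"
    and "\<exists>(V' :: nat set) E'. tsat_graph V' E' r \<and> card V' = card V \<and> card E' = tsat (card V) r"
proof -
  let ?S = "{card E | (V' :: nat set) E. simple_graph V' E \<and> card V' = card V \<and> twin_free V' E \<and> K_saturated r V' E}"
  have mem: "card E \<in> ?S" using assms unfolding tsat_graph_def by blast
  then show "tsat (card V) r \<le> card E" unfolding tsat_def by (rule wellorder_Inf_le1)
  have "Inf ?S \<in> ?S" by (rule Inf_nat_def1) (use mem in blast)
  then show "\<exists>(V' :: nat set) E'. tsat_graph V' E' r \<and> card V' = card V \<and> card E' = tsat (card V) r"
    unfolding tsat_def tsat_graph_def by force
qed

section \<open>The construction for r = 3\<close>

datatype vx = X | C nat | D nat | A nat nat | B nat | B' nat | Y nat nat nat | Z nat nat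

text \<open>The orientation lets every edge be counted at its source; only \<open>Y\<close>,
  \<open>Z\<close>, \<open>C\<close> and \<open>A\<close> have outgoing arcs. Each pair
  \<open>C s\<close>, \<open>D s\<close> is maximal independent among the \<open>C\<close> and
  \<open>D\<close>, and each triple \<open>A i j\<close>, \<open>B i\<close>, \<open>B' j\<close>
  among the \<open>A\<close>, \<open>B\<close> and \<open>B'\<close>. The 5-sets are products of
  these: \<open>l\<close> pairs on \<open>2 * l\<close> vertices and \<open>k * k\<close> triples on
  only \<open>k * k + 2 * k\<close> vertices.\<close>

fun arc :: "vx \<Rightarrow> vx \<Rightarrow> bool" where
  "arc (Y s i j) v = (v \<in> {X, C s, D s, A i j, B i, B' j})"
| "arc (Z s i) v = (v \<in> {X, C s, D s, B i} \<or> (\<exists>j. v = A i j))"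
| "arc (C s) v = (\<exists>t. t \<noteq> s \<and> v = D t)"
| "arc (A i j) v = ((\<exists>u. u \<noteq> i \<and> v = B u) \<or> (\<exists>u. u \<noteq> j \<and> v = B' u))"
| "arc _ v = False"

definition vadj :: "vx \<Rightarrow> vx \<Rightarrow> bool" where
  "vadj u v \<longleftrightarrow> arc u v \<or> arc v u"

text \<open>The neighbours of a vertex \<open>Y s i j\<close> or \<open>Z s i\<close> other than \<open>X\<close> form a maximal independent set of the
  graph on the vertices \<open>C\<close>, \<open>D\<close>, \<open>A\<close>, \<open>B\<close>, \<open>B'\<close>. There are \<open>l k\<^sup>2\<close> of the former, with only six neighbours,
  and few of the latter, whose number is arbitrary.\<close>
locale construction =
  fixes k l :: nat and S :: "(nat \<times> nat) set"
  assumes k: "3 \<le> k" and l: "3 \<le> l" and S: "S \<subseteq> {..<l} \<times> {..<k}"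
begin

definition VY :: "vx set" where "VY = (\<lambda>(s, i, j). Y s i j) ` ({..<l} \<times> {..<k} \<times> {..<k})"
definition VZ :: "vx set" where "VZ = (\<lambda>(s, i). Z s i) ` S"
definition VA :: "vx set" where "VA = (\<lambda>(i, j). A i j) ` ({..<k} \<times> {..<k})"
definition V :: "vx set" where
  "V = {X} \<union> C ` {..<l} \<union> D ` {..<l} \<union> VA \<union> B ` {..<k} \<union> B' ` {..<k} \<union> VY \<union> VZ"
definition E :: "vx set set" where "E = (\<Union>u\<in>V. (\<lambda>v. {u, v}) ` {v\<in>V. arc u v})"

lemma V_parts_mem:
  "Y s i j \<in> VY \<longleftrightarrow> s < l \<and> i < k \<and> j < k" "Z s i \<in> VZ \<longleftrightarrow> (s, i) \<in> S" "A i j \<in> VA \<longleftrightarrow> i < k \<and> j < k"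
proof -
  have "Y s i j \<in> VY" if "s < l \<and> i < k \<and> j < k"
    unfolding VY_def by (rule image_eqI[of _ _ "(s, i, j)"]) (use that in simp_all)
  then show "Y s i j \<in> VY \<longleftrightarrow> s < l \<and> i < k \<and> j < k" by (auto simp: VY_def)
  have "Z s i \<in> VZ" if "(s, i) \<in> S"
    unfolding VZ_def by (rule image_eqI[of _ _ "(s, i)"]) (use that in simp_all)
  then show "Z s i \<in> VZ \<longleftrightarrow> (s, i) \<in> S" by (auto simp: VZ_def)
  have "A i j \<in> VA" if "i < k \<and> j < k"
    unfolding VA_def by (rule image_eqI[of _ _ "(i, j)"]) (use that in simp_all)
  then show "A i j \<in> VA \<longleftrightarrow> i < k \<and> j < k" by (auto simp: VA_def)
qed

lemma V_parts_disjoint: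
  "v \<in> VY \<Longrightarrow> \<exists>s i j. v = Y s i j" "v \<in> VZ \<Longrightarrow> \<exists>s i. v = Z s i" "v \<in> VA \<Longrightarrow> \<exists>i j. v = A i j"
  by (auto simp: VY_def VZ_def VA_def)

lemma V_mem [simp]:
  "X \<in> V" "C s \<in> V \<longleftrightarrow> s < l" "D s \<in> V \<longleftrightarrow> s < l" "A i j \<in> V \<longleftrightarrow> i < k \<and> j < k"
  "B i \<in> V \<longleftrightarrow> i < k" "B' i \<in> V \<longleftrightarrow> i < k" "Y s i j \<in> V \<longleftrightarrow> s < l \<and> i < k \<and> j < k"
  "Z s i \<in> V \<longleftrightarrow> (s, i) \<in> S"
  by (auto simp: V_def V_parts_mem dest: V_parts_disjoint)

lemma S_mem: "(s, i) \<in> S \<Longrightarrow> s < l \<and> i < k" using S by auto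

lemma finS: "finite S" using S finite_subset by blast

lemma finV: "finite V" using finS by (simp add: V_def VA_def VY_def VZ_def)

text \<open>The reason for at least three indices: a common neighbour of \<open>C s\<close> and
  \<open>C t\<close> is a vertex \<open>D u\<close> with \<open>u\<close> different from both
  \<open>s\<close> and \<open>t\<close>, and similarly elsewhere.\<close>

lemma avoid: "\<exists>u<k. u \<noteq> i \<and> u \<noteq> j" "\<exists>u<l. u \<noteq> i \<and> u \<noteq> j" for i j :: nat
proof -
  have "\<exists>u<n. u \<noteq> i \<and> u \<noteq> j" if "3 \<le> n" for n
  proof -
    have "(0 \<noteq> i \<and> 0 \<noteq> j) \<or> (1 \<noteq> i \<and> 1 \<noteq> j) \<or> (2 \<noteq> i \<and> 2 \<noteq> j)" by linarith
    moreover have "0 < n" "1 < n" "2 < n" using that by simp_all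
    ultimately show ?thesis by blast
  qed
  then show "\<exists>u<k. u \<noteq> i \<and> u \<noteq> j" "\<exists>u<l. u \<noteq> i \<and> u \<noteq> j" using k l by auto
qed

lemma E_iff: "{u, v} \<in> E \<longleftrightarrow> u \<in> V \<and> v \<in> V \<and> vadj u v"
  by (auto simp: E_def vadj_def doubleton_eq_iff)

lemma vadj_irrefl: "\<not> vadj u u"
  by (cases u) (auto simp: vadj_def)

lemma vadj_sym: "vadj u v \<longleftrightarrow> vadj v u"
  by (auto simp: vadj_def)

text \<open>The neighbourhood of each \<open>Y\<close> or \<open>Z\<close> is independent, and the
  edges that avoid these vertices run between \<open>C\<close> and \<open>D\<close> or between
  \<open>A\<close> and the \<open>B\<close>, \<open>B'\<close>.\<close>

lemma no_triangle: "vadj u v \<Longrightarrow> vadj v w \<Longrightarrow> vadj u w \<Longrightarrow> False"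
  unfolding vadj_def by (cases u; cases v; cases w; force)

text \<open>Two vertices among the \<open>Y\<close>, \<open>Z\<close> meet in \<open>X\<close>. A
  \<open>Y\<close> or \<open>Z\<close> reaches a vertex outside its maximal independent set through
  a member dominating that vertex. Other pairs have a common \<open>Y\<close> or use a third index.
  Every case is recorded in both orders for the final split on \<open>u\<close> and
  \<open>v\<close>.\<close>

lemma common_nbr:
  assumes "u \<in> V" "v \<in> V" "u \<noteq> v" "\<not> vadj u v"
  shows "\<exists>w\<in>V. vadj u w \<and> vadj v w"
proof -
  define cn where "cn u v \<longleftrightarrow> (\<exists>w\<in>V. vadj u w \<and> vadj v w)" for u v
  have cn_I: "cn u v \<and> cn v u" if "w \<in> V \<and> vadj u w \<and> vadj v w" for u v w
    using that by (auto simp: cn_def)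
  have c0: "cn X (C s) \<and> cn (C s) X"
    if "s < l" for s
  proof -
    show ?thesis by (rule cn_I[of "Y s 0 0"]) (use that k l in \<open>auto simp: vadj_def\<close>)
  qed
  have c1: "cn X (D s) \<and> cn (D s) X"
    if "s < l" for s
  proof -
    show ?thesis by (rule cn_I[of "Y s 0 0"]) (use that k l in \<open>auto simp: vadj_def\<close>)
  qed
  have c2: "cn X (A i j) \<and> cn (A i j) X"
    if "i < k" "j < k" for i j
  proof -
    show ?thesis by (rule cn_I[of "Y 0 i j"]) (use that k l in \<open>auto simp: vadj_def\<close>)
  qed
  have c3: "cn X (B i) \<and> cn (B i) X"
    if "i < k" for i
  proof -
    show ?thesis by (rule cn_I[of "Y 0 i 0"]) (use that k l in \<open>auto simp: vadj_def\<close>)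
  qed
  have c4: "cn X (B' i) \<and> cn (B' i) X"
    if "i < k" for i
  proof -
    show ?thesis by (rule cn_I[of "Y 0 0 i"]) (use that k l in \<open>auto simp: vadj_def\<close>)
  qed
  have c5: "cn (C s) (C t) \<and> cn (C t) (C s)"
    if "s < l" "t < l" for s t
  proof -
    obtain u where u: "u < l" "u \<noteq> s" "u \<noteq> t" using avoid[of s t] by blast
    show ?thesis by (rule cn_I[of "D u"]) (use that u k l in \<open>auto simp: vadj_def\<close>)
  qed
  have c6: "cn (D s) (D t) \<and> cn (D t) (D s)"
    if "s < l" "t < l" for s t
  proof -
    obtain u where u: "u < l" "u \<noteq> s" "u \<noteq> t" using avoid[of s t] by blast
    show ?thesis by (rule cn_I[of "C u"]) (use that u k l in \<open>auto simp: vadj_def\<close>)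
  qed
  have c7: "cn (C s) (D s) \<and> cn (D s) (C s)"
    if "s < l" for s
  proof -
    show ?thesis by (rule cn_I[of "Y s 0 0"]) (use that k l in \<open>auto simp: vadj_def\<close>)
  qed
  have c8: "cn (C s) (A i j) \<and> cn (A i j) (C s)"
    if "s < l" "i < k" "j < k" for s i j
  proof -
    show ?thesis by (rule cn_I[of "Y s i j"]) (use that k l in \<open>auto simp: vadj_def\<close>)
  qed
  have c9: "cn (D s) (A i j) \<and> cn (A i j) (D s)"
    if "s < l" "i < k" "j < k" for s i j
  proof -
    show ?thesis by (rule cn_I[of "Y s i j"]) (use that k l in \<open>auto simp: vadj_def\<close>)
  qed
  have c10: "cn (C s) (B i) \<and> cn (B i) (C s)"
    if "s < l" "i < k" for s i
  proof -
    show ?thesis by (rule cn_I[of "Y s i 0"]) (use that k l in \<open>auto simp: vadj_def\<close>)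
  qed
  have c11: "cn (D s) (B i) \<and> cn (B i) (D s)"
    if "s < l" "i < k" for s i
  proof -
    show ?thesis by (rule cn_I[of "Y s i 0"]) (use that k l in \<open>auto simp: vadj_def\<close>)
  qed
  have c12: "cn (C s) (B' i) \<and> cn (B' i) (C s)"
    if "s < l" "i < k" for s i
  proof -
    show ?thesis by (rule cn_I[of "Y s 0 i"]) (use that k l in \<open>auto simp: vadj_def\<close>)
  qed
  have c13: "cn (D s) (B' i) \<and> cn (B' i) (D s)"
    if "s < l" "i < k" for s i
  proof -
    show ?thesis by (rule cn_I[of "Y s 0 i"]) (use that k l in \<open>auto simp: vadj_def\<close>)
  qed
  have c14: "cn (A i j) (A i' j') \<and> cn (A i' j') (A i j)"
    if "i < k" "j < k" "i' < k" "j' < k" for i j i' j'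
  proof -
    obtain u where u: "u < k" "u \<noteq> i" "u \<noteq> i'" using avoid[of i i'] by blast
    show ?thesis by (rule cn_I[of "B u"]) (use that u k l in \<open>auto simp: vadj_def\<close>)
  qed
  have c15: "cn (A i j) (B i) \<and> cn (B i) (A i j)"
    if "i < k" "j < k" for i j
  proof -
    show ?thesis by (rule cn_I[of "Y 0 i j"]) (use that k l in \<open>auto simp: vadj_def\<close>)
  qed
  have c16: "cn (A i j) (B' j) \<and> cn (B' j) (A i j)"
    if "i < k" "j < k" for i j
  proof -
    show ?thesis by (rule cn_I[of "Y 0 i j"]) (use that k l in \<open>auto simp: vadj_def\<close>)
  qed
  have c17: "cn (B i) (B i') \<and> cn (B i') (B i)"
    if "i < k" "i' < k" for i i'
  proof -
    obtain u where u: "u < k" "u \<noteq> i" "u \<noteq> i'" using avoid[of i i'] by blast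
    show ?thesis by (rule cn_I[of "A u 0"]) (use that u k l in \<open>auto simp: vadj_def\<close>)
  qed
  have c18: "cn (B' i) (B' i') \<and> cn (B' i') (B' i)"
    if "i < k" "i' < k" for i i'
  proof -
    obtain u where u: "u < k" "u \<noteq> i" "u \<noteq> i'" using avoid[of i i'] by blast
    show ?thesis by (rule cn_I[of "A 0 u"]) (use that u k l in \<open>auto simp: vadj_def\<close>)
  qed
  have c19: "cn (B i) (B' j) \<and> cn (B' j) (B i)"
    if "i < k" "j < k" for i j
  proof -
    obtain u where u: "u < k" "u \<noteq> i" "u \<noteq> j" using avoid[of i j] by blast
    show ?thesis by (rule cn_I[of "A u u"]) (use that u k l in \<open>auto simp: vadj_def\<close>)
  qed
  have c20: "cn (Y s i j) (Y t i' j') \<and> cn (Y t i' j') (Y s i j)"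
    if "s < l" "i < k" "j < k" "t < l" "i' < k" "j' < k" for s i j t i' j'
  proof -
    show ?thesis by (rule cn_I[of "X"]) (use that k l in \<open>auto simp: vadj_def\<close>)
  qed
  have c21: "cn (Y s i j) (Z t i') \<and> cn (Z t i') (Y s i j)"
    if "s < l" "i < k" "j < k" "(t, i') \<in> S" for s i j t i'
  proof -
    show ?thesis by (rule cn_I[of "X"]) (use that S_mem[of t i'] k l in \<open>auto simp: vadj_def\<close>)
  qed
  have c22: "cn (Z s i) (Z t i') \<and> cn (Z t i') (Z s i)"
    if "(s, i) \<in> S" "(t, i') \<in> S" for s i t i'
  proof -
    show ?thesis by (rule cn_I[of "X"]) (use that S_mem[of s i] S_mem[of t i'] k l in \<open>auto simp: vadj_def\<close>)
  qed
  have c23: "cn (Y s i j) (C t) \<and> cn (C t) (Y s i j)"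
    if "s < l" "i < k" "j < k" "t < l" "t \<noteq> s" for s i j t
  proof -
    show ?thesis by (rule cn_I[of "D s"]) (use that k l in \<open>auto simp: vadj_def\<close>)
  qed
  have c24: "cn (Y s i j) (D t) \<and> cn (D t) (Y s i j)"
    if "s < l" "i < k" "j < k" "t < l" "t \<noteq> s" for s i j t
  proof -
    show ?thesis by (rule cn_I[of "C s"]) (use that k l in \<open>auto simp: vadj_def\<close>)
  qed
  have c25: "cn (Y s i j) (A i' j') \<and> cn (A i' j') (Y s i j)"
    if "s < l" "i < k" "j < k" "i' < k" "j' < k" "i' \<noteq> i" for s i j i' j'
  proof -
    show ?thesis by (rule cn_I[of "B i"]) (use that k l in \<open>auto simp: vadj_def\<close>)
  qed
  have c26: "cn (Y s i j) (A i' j') \<and> cn (A i' j') (Y s i j)"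
    if "s < l" "i < k" "j < k" "i' < k" "j' < k" "j' \<noteq> j" for s i j i' j'
  proof -
    show ?thesis by (rule cn_I[of "B' j"]) (use that k l in \<open>auto simp: vadj_def\<close>)
  qed
  have c27: "cn (Y s i j) (B i') \<and> cn (B i') (Y s i j)"
    if "s < l" "i < k" "j < k" "i' < k" "i' \<noteq> i" for s i j i'
  proof -
    show ?thesis by (rule cn_I[of "A i j"]) (use that k l in \<open>auto simp: vadj_def\<close>)
  qed
  have c28: "cn (Y s i j) (B' j') \<and> cn (B' j') (Y s i j)"
    if "s < l" "i < k" "j < k" "j' < k" "j' \<noteq> j" for s i j j'
  proof -
    show ?thesis by (rule cn_I[of "A i j"]) (use that k l in \<open>auto simp: vadj_def\<close>)
  qed
  have c29: "cn (Z s i) (C t) \<and> cn (C t) (Z s i)"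
    if "(s, i) \<in> S" "t < l" "t \<noteq> s" for s i t
  proof -
    show ?thesis by (rule cn_I[of "D s"]) (use that S_mem[of s i] k l in \<open>auto simp: vadj_def\<close>)
  qed
  have c30: "cn (Z s i) (D t) \<and> cn (D t) (Z s i)"
    if "(s, i) \<in> S" "t < l" "t \<noteq> s" for s i t
  proof -
    show ?thesis by (rule cn_I[of "C s"]) (use that S_mem[of s i] k l in \<open>auto simp: vadj_def\<close>)
  qed
  have c31: "cn (Z s i) (A i' j') \<and> cn (A i' j') (Z s i)"
    if "(s, i) \<in> S" "i' < k" "j' < k" "i' \<noteq> i" for s i i' j'
  proof -
    show ?thesis by (rule cn_I[of "B i"]) (use that S_mem[of s i] k l in \<open>auto simp: vadj_def\<close>)
  qed
  have c32: "cn (Z s i) (B i') \<and> cn (B i') (Z s i)"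
    if "(s, i) \<in> S" "i' < k" "i' \<noteq> i" for s i i'
  proof -
    show ?thesis by (rule cn_I[of "A i 0"]) (use that S_mem[of s i] k l in \<open>auto simp: vadj_def\<close>)
  qed
  have c33: "cn (Z s i) (B' j') \<and> cn (B' j') (Z s i)"
    if "(s, i) \<in> S" "j' < k" for s i j'
  proof -
    obtain u where u: "u < k" "u \<noteq> j'" "u \<noteq> j'" using avoid[of j' j'] by blast
    show ?thesis by (rule cn_I[of "A i u"]) (use that S_mem[of s i] u k l in \<open>auto simp: vadj_def\<close>)
  qed
  have "cn u v"
    by (cases u; cases v) (use assms in \<open>auto simp: vadj_def c0 c1 c2 c3 c4 c5 c6 c7 c8 c9 c10 c11 c12 c13 c14 c15 c16 c17 c18 c19 c20 c21 c22 c23 c24 c25 c26 c27 c28 c29 c30 c31 c32 c33\<close>)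
  then show ?thesis by (simp add: cn_def)
qed

text \<open>Adjacent vertices are told apart by either of them. \<open>X\<close> separates
  \<open>Y\<close> and \<open>Z\<close> from the members of their independent sets, and two
  \<open>Y\<close> or \<open>Z\<close> with different indices differ on some \<open>C\<close>,
  \<open>B\<close> or \<open>B'\<close>.\<close>

lemma distinguishing:
  assumes "u \<in> V" "v \<in> V" "u \<noteq> v"
  shows "\<exists>w\<in>V. vadj u w \<noteq> vadj v w"
proof (cases "vadj u v")
  case True
  then show ?thesis using assms vadj_irrefl by blast
next
  case False
  define df where "df u v \<longleftrightarrow> (\<exists>w\<in>V. vadj u w \<noteq> vadj v w)" for u v
  have df_I: "df u v \<and> df v u" if "w \<in> V \<and> vadj u w \<noteq> vadj v w" for u v w
    using that by (auto simp: df_def)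
  have d0: "df X (C s) \<and> df (C s) X"
    if "s < l" for s
  proof -
    obtain u where u: "u < l" "u \<noteq> s" "u \<noteq> s" using avoid[of s s] by blast
    show ?thesis by (rule df_I[of "D u"]) (use that u k l in \<open>auto simp: vadj_def\<close>)
  qed
  have d1: "df X (D s) \<and> df (D s) X"
    if "s < l" for s
  proof -
    obtain u where u: "u < l" "u \<noteq> s" "u \<noteq> s" using avoid[of s s] by blast
    show ?thesis by (rule df_I[of "C u"]) (use that u k l in \<open>auto simp: vadj_def\<close>)
  qed
  have d2: "df X (A i j) \<and> df (A i j) X"
    if "i < k" "j < k" for i j
  proof -
    obtain u where u: "u < k" "u \<noteq> i" "u \<noteq> i" using avoid[of i i] by blast
    show ?thesis by (rule df_I[of "B u"]) (use that u k l in \<open>auto simp: vadj_def\<close>)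
  qed
  have d3: "df X (B i) \<and> df (B i) X"
    if "i < k" for i
  proof -
    obtain u where u: "u < k" "u \<noteq> i" "u \<noteq> i" using avoid[of i i] by blast
    show ?thesis by (rule df_I[of "A u 0"]) (use that u k l in \<open>auto simp: vadj_def\<close>)
  qed
  have d4: "df X (B' i) \<and> df (B' i) X"
    if "i < k" for i
  proof -
    obtain u where u: "u < k" "u \<noteq> i" "u \<noteq> i" using avoid[of i i] by blast
    show ?thesis by (rule df_I[of "A 0 u"]) (use that u k l in \<open>auto simp: vadj_def\<close>)
  qed
  have d5: "df (C s) (C t) \<and> df (C t) (C s)"
    if "s < l" "t < l" "s \<noteq> t" for s t
  proof -
    show ?thesis by (rule df_I[of "D s"]) (use that k l in \<open>auto simp: vadj_def\<close>)
  qed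
  have d6: "df (D s) (D t) \<and> df (D t) (D s)"
    if "s < l" "t < l" "s \<noteq> t" for s t
  proof -
    show ?thesis by (rule df_I[of "C s"]) (use that k l in \<open>auto simp: vadj_def\<close>)
  qed
  have d7: "df (C s) (D s) \<and> df (D s) (C s)"
    if "s < l" for s
  proof -
    obtain u where u: "u < l" "u \<noteq> s" "u \<noteq> s" using avoid[of s s] by blast
    show ?thesis by (rule df_I[of "D u"]) (use that u k l in \<open>auto simp: vadj_def\<close>)
  qed
  have d8: "df (C s) (A i j) \<and> df (A i j) (C s)"
    if "s < l" "i < k" "j < k" for s i j
  proof -
    obtain u where u: "u < l" "u \<noteq> s" "u \<noteq> s" using avoid[of s s] by blast
    show ?thesis by (rule df_I[of "D u"]) (use that u k l in \<open>auto simp: vadj_def\<close>)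
  qed
  have d9: "df (C s) (B i) \<and> df (B i) (C s)"
    if "s < l" "i < k" for s i
  proof -
    obtain u where u: "u < l" "u \<noteq> s" "u \<noteq> s" using avoid[of s s] by blast
    show ?thesis by (rule df_I[of "D u"]) (use that u k l in \<open>auto simp: vadj_def\<close>)
  qed
  have d10: "df (C s) (B' i) \<and> df (B' i) (C s)"
    if "s < l" "i < k" for s i
  proof -
    obtain u where u: "u < l" "u \<noteq> s" "u \<noteq> s" using avoid[of s s] by blast
    show ?thesis by (rule df_I[of "D u"]) (use that u k l in \<open>auto simp: vadj_def\<close>)
  qed
  have d11: "df (D s) (A i j) \<and> df (A i j) (D s)"
    if "s < l" "i < k" "j < k" for s i j
  proof -
    obtain u where u: "u < l" "u \<noteq> s" "u \<noteq> s" using avoid[of s s] by blast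
    show ?thesis by (rule df_I[of "C u"]) (use that u k l in \<open>auto simp: vadj_def\<close>)
  qed
  have d12: "df (D s) (B i) \<and> df (B i) (D s)"
    if "s < l" "i < k" for s i
  proof -
    obtain u where u: "u < l" "u \<noteq> s" "u \<noteq> s" using avoid[of s s] by blast
    show ?thesis by (rule df_I[of "C u"]) (use that u k l in \<open>auto simp: vadj_def\<close>)
  qed
  have d13: "df (D s) (B' i) \<and> df (B' i) (D s)"
    if "s < l" "i < k" for s i
  proof -
    obtain u where u: "u < l" "u \<noteq> s" "u \<noteq> s" using avoid[of s s] by blast
    show ?thesis by (rule df_I[of "C u"]) (use that u k l in \<open>auto simp: vadj_def\<close>)
  qed
  have d14: "df (A i j) (A i' j') \<and> df (A i' j') (A i j)"
    if "i < k" "j < k" "i' < k" "j' < k" "i \<noteq> i'" for i j i' j'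
  proof -
    show ?thesis by (rule df_I[of "B i"]) (use that k l in \<open>auto simp: vadj_def\<close>)
  qed
  have d15: "df (A i j) (A i' j') \<and> df (A i' j') (A i j)"
    if "i < k" "j < k" "i' < k" "j' < k" "j \<noteq> j'" for i j i' j'
  proof -
    show ?thesis by (rule df_I[of "B' j"]) (use that k l in \<open>auto simp: vadj_def\<close>)
  qed
  have d16: "df (A i j) (B i') \<and> df (B i') (A i j)"
    if "i < k" "j < k" "i' < k" for i j i'
  proof -
    obtain u where u: "u < k" "u \<noteq> i" "u \<noteq> i" using avoid[of i i] by blast
    show ?thesis by (rule df_I[of "B u"]) (use that u k l in \<open>auto simp: vadj_def\<close>)
  qed
  have d17: "df (A i j) (B' i') \<and> df (B' i') (A i j)"
    if "i < k" "j < k" "i' < k" for i j i'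
  proof -
    obtain u where u: "u < k" "u \<noteq> i" "u \<noteq> i" using avoid[of i i] by blast
    show ?thesis by (rule df_I[of "B u"]) (use that u k l in \<open>auto simp: vadj_def\<close>)
  qed
  have d18: "df (B i) (B i') \<and> df (B i') (B i)"
    if "i < k" "i' < k" "i \<noteq> i'" for i i'
  proof -
    show ?thesis by (rule df_I[of "A i 0"]) (use that k l in \<open>auto simp: vadj_def\<close>)
  qed
  have d19: "df (B' i) (B' i') \<and> df (B' i') (B' i)"
    if "i < k" "i' < k" "i \<noteq> i'" for i i'
  proof -
    show ?thesis by (rule df_I[of "A 0 i"]) (use that k l in \<open>auto simp: vadj_def\<close>)
  qed
  have d20: "df (B i) (B' j) \<and> df (B' j) (B i)"
    if "i < k" "j < k" for i j
  proof -
    obtain u where u: "u < k" "u \<noteq> j" "u \<noteq> j" using avoid[of j j] by blast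
    show ?thesis by (rule df_I[of "A i u"]) (use that u k l in \<open>auto simp: vadj_def\<close>)
  qed
  have d21: "df (Y s i j) (C t) \<and> df (C t) (Y s i j)"
    if "s < l" "i < k" "j < k" "t < l" for s i j t
  proof -
    show ?thesis by (rule df_I[of "X"]) (use that k l in \<open>auto simp: vadj_def\<close>)
  qed
  have d22: "df (Y s i j) (D t) \<and> df (D t) (Y s i j)"
    if "s < l" "i < k" "j < k" "t < l" for s i j t
  proof -
    show ?thesis by (rule df_I[of "X"]) (use that k l in \<open>auto simp: vadj_def\<close>)
  qed
  have d23: "df (Y s i j) (A i' j') \<and> df (A i' j') (Y s i j)"
    if "s < l" "i < k" "j < k" "i' < k" "j' < k" for s i j i' j'
  proof -
    show ?thesis by (rule df_I[of "X"]) (use that k l in \<open>auto simp: vadj_def\<close>)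
  qed
  have d24: "df (Y s i j) (B i') \<and> df (B i') (Y s i j)"
    if "s < l" "i < k" "j < k" "i' < k" for s i j i'
  proof -
    show ?thesis by (rule df_I[of "X"]) (use that k l in \<open>auto simp: vadj_def\<close>)
  qed
  have d25: "df (Y s i j) (B' i') \<and> df (B' i') (Y s i j)"
    if "s < l" "i < k" "j < k" "i' < k" for s i j i'
  proof -
    show ?thesis by (rule df_I[of "X"]) (use that k l in \<open>auto simp: vadj_def\<close>)
  qed
  have d26: "df (Z s i) (C t) \<and> df (C t) (Z s i)"
    if "(s, i) \<in> S" "t < l" for s i t
  proof -
    show ?thesis by (rule df_I[of "X"]) (use that S_mem[of s i] k l in \<open>auto simp: vadj_def\<close>)
  qed
  have d27: "df (Z s i) (D t) \<and> df (D t) (Z s i)"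
    if "(s, i) \<in> S" "t < l" for s i t
  proof -
    show ?thesis by (rule df_I[of "X"]) (use that S_mem[of s i] k l in \<open>auto simp: vadj_def\<close>)
  qed
  have d28: "df (Z s i) (A i' j') \<and> df (A i' j') (Z s i)"
    if "(s, i) \<in> S" "i' < k" "j' < k" for s i i' j'
  proof -
    show ?thesis by (rule df_I[of "X"]) (use that S_mem[of s i] k l in \<open>auto simp: vadj_def\<close>)
  qed
  have d29: "df (Z s i) (B i') \<and> df (B i') (Z s i)"
    if "(s, i) \<in> S" "i' < k" for s i i'
  proof -
    show ?thesis by (rule df_I[of "X"]) (use that S_mem[of s i] k l in \<open>auto simp: vadj_def\<close>)
  qed
  have d30: "df (Z s i) (B' i') \<and> df (B' i') (Z s i)"
    if "(s, i) \<in> S" "i' < k" for s i i'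
  proof -
    show ?thesis by (rule df_I[of "X"]) (use that S_mem[of s i] k l in \<open>auto simp: vadj_def\<close>)
  qed
  have d31: "df (Y s i j) (Y t i' j') \<and> df (Y t i' j') (Y s i j)"
    if "s < l" "i < k" "j < k" "t < l" "i' < k" "j' < k" "s \<noteq> t" for s i j t i' j'
  proof -
    show ?thesis by (rule df_I[of "C s"]) (use that k l in \<open>auto simp: vadj_def\<close>)
  qed
  have d32: "df (Y s i j) (Y t i' j') \<and> df (Y t i' j') (Y s i j)"
    if "s < l" "i < k" "j < k" "t < l" "i' < k" "j' < k" "i \<noteq> i'" for s i j t i' j'
  proof -
    show ?thesis by (rule df_I[of "B i"]) (use that k l in \<open>auto simp: vadj_def\<close>)
  qed
  have d33: "df (Y s i j) (Y t i' j') \<and> df (Y t i' j') (Y s i j)"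
    if "s < l" "i < k" "j < k" "t < l" "i' < k" "j' < k" "j \<noteq> j'" for s i j t i' j'
  proof -
    show ?thesis by (rule df_I[of "B' j"]) (use that k l in \<open>auto simp: vadj_def\<close>)
  qed
  have d34: "df (Y s i j) (Z t i') \<and> df (Z t i') (Y s i j)"
    if "s < l" "i < k" "j < k" "(t, i') \<in> S" for s i j t i'
  proof -
    show ?thesis by (rule df_I[of "B' j"]) (use that S_mem[of t i'] k l in \<open>auto simp: vadj_def\<close>)
  qed
  have d35: "df (Z s i) (Z t i') \<and> df (Z t i') (Z s i)"
    if "(s, i) \<in> S" "(t, i') \<in> S" "s \<noteq> t" for s i t i'
  proof -
    show ?thesis by (rule df_I[of "C s"]) (use that S_mem[of s i] S_mem[of t i'] k l in \<open>auto simp: vadj_def\<close>)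
  qed
  have d36: "df (Z s i) (Z t i') \<and> df (Z t i') (Z s i)"
    if "(s, i) \<in> S" "(t, i') \<in> S" "i \<noteq> i'" for s i t i'
  proof -
    show ?thesis by (rule df_I[of "B i"]) (use that S_mem[of s i] S_mem[of t i'] k l in \<open>auto simp: vadj_def\<close>)
  qed
  have "df u v"
    by (cases u; cases v) (use assms False in \<open>auto simp: vadj_def d0 d1 d2 d3 d4 d5 d6 d7 d8 d9 d10 d11 d12 d13 d14 d15 d16 d17 d18 d19 d20 d21 d22 d23 d24 d25 d26 d27 d28 d29 d30 d31 d32 d33 d34 d35 d36\<close>)
  then show ?thesis by (simp add: df_def)
qed

end

section \<open>Saturation and the numbers of vertices and edges\<close>

context construction begin

lemma simple_E: "simple_graph V E"
proof -
  have "{u, v} \<in> nsets V 2" if "u \<in> V" "v \<in> V" "arc u v" for u v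
  proof -
    have "u \<noteq> v" using that(3) vadj_irrefl[of u] by (auto simp: vadj_def)
    then show ?thesis using that by (simp add: nsets_def)
  qed
  then show ?thesis using finV by (auto simp: simple_graph_def E_def)
qed

lemma twin_free_E: "twin_free V E"
  unfolding twin_free_def twins_def
proof (intro ballI notI, elim conjE)
  fix u v assume uv: "u \<in> V" "v \<in> V" "u \<noteq> v" and eq: "neighbourhood V E u = neighbourhood V E v"
  obtain w where w: "w \<in> V" "vadj u w \<noteq> vadj v w" using distinguishing[OF uv] by blast
  have "w \<in> neighbourhood V E u \<longleftrightarrow> w \<in> neighbourhood V E v" using eq by simp
  then show False using w uv by (simp add: neighbourhood_def E_iff)
qed

lemma saturated_E: "K_saturated 3 V E"
  unfolding K_saturated_def
proof (intro conjI ballI notI)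
  assume "contains_K 3 V E"
  then obtain T where T: "T \<subseteq> V" "card T = 3" "clique T E" by (auto simp: contains_K_def nsets_def)
  then obtain a b c where abc: "T = {a, b, c}" "a \<noteq> b" "b \<noteq> c" "a \<noteq> c" by (auto simp: card_3_iff)
  then have "{a, b} \<in> E" "{b, c} \<in> E" "{a, c} \<in> E" using T(3) by (auto simp: clique_def)
  then show False using no_triangle[of a b c] by (simp add: E_iff)
next
  fix e assume e: "e \<in> nsets V 2 - E"
  then obtain u v where uv: "e = {u, v}" "u \<in> V" "v \<in> V" "u \<noteq> v" by (blast elim: nsets2_E)
  then have "\<not> vadj u v" using e by (simp add: E_iff)
  then obtain w where w: "w \<in> V" "vadj u w" "vadj v w" using common_nbr[OF uv(2-4)] by blast
  have ne: "w \<noteq> u" "w \<noteq> v" using w vadj_irrefl by auto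
  have E: "{u, w} \<in> E" "{v, w} \<in> E" "{w, u} \<in> E" "{w, v} \<in> E"
    using w uv vadj_sym[of u w] vadj_sym[of v w] by (simp_all add: E_iff)
  have "clique {u, v, w} (insert e E)"
    using E uv(1) by (auto simp: clique_def insert_commute)
  moreover have "{u, v, w} \<in> nsets V 3" using uv w ne by (simp add: nsets_def)
  ultimately show "contains_K 3 V (insert e E)" unfolding contains_K_def by blast
qed

lemma card_V: "card V = 1 + 2 * l + k * k + 2 * k + l * k * k + card S"
proof -
  have inj: "inj_on (\<lambda>(s, i, j). Y s i j) T" "inj_on (\<lambda>(s, i). Z s i) T'" "inj_on (\<lambda>(i, j). A i j) T''" for T T' T''
    by (auto simp: inj_on_def)
  have c: "card VY = l * k * k" "card VZ = card S" "card VA = k * k"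
    by (simp_all add: VY_def VZ_def VA_def card_image[OF inj(1)] card_image[OF inj(2)] card_image[OF inj(3)])
  have f: "finite VY" "finite VZ" "finite VA" using finS by (simp_all add: VY_def VZ_def VA_def)
  have c': "card (C ` {..<l}) = l" "card (D ` {..<l}) = l" "card (B ` {..<k}) = k" "card (B' ` {..<k}) = k"
    by (simp_all add: card_image inj_on_def)
  define U1 where "U1 = {X} \<union> C ` {..<l}"
  define U2 where "U2 = U1 \<union> D ` {..<l}"
  define U3 where "U3 = U2 \<union> VA"
  define U4 where "U4 = U3 \<union> B ` {..<k}"
  define U5 where "U5 = U4 \<union> B' ` {..<k}"
  define U6 where "U6 = U5 \<union> VY"
  have V: "V = U6 \<union> VZ" unfolding V_def U1_def U2_def U3_def U4_def U5_def U6_def by simp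
  have fU: "finite U1" "finite U2" "finite U3" "finite U4" "finite U5" "finite U6"
    unfolding U6_def U5_def U4_def U3_def U2_def U1_def using f by simp_all
  have "card U1 = 1 + l" unfolding U1_def by (subst card_Un_disjoint) (auto simp: c')
  moreover have "card U2 = card U1 + l" unfolding U2_def
    by (subst card_Un_disjoint) (auto simp: c' fU U1_def)
  moreover have "card U3 = card U2 + k * k" unfolding U3_def
    by (subst card_Un_disjoint) (auto simp: c f fU U2_def U1_def dest: V_parts_disjoint)
  moreover have "card U4 = card U3 + k" unfolding U4_def
    by (subst card_Un_disjoint) (auto simp: c' f fU U3_def U2_def U1_def dest: V_parts_disjoint)
  moreover have "card U5 = card U4 + k" unfolding U5_def
    by (subst card_Un_disjoint) (auto simp: c' f fU U4_def U3_def U2_def U1_def dest: V_parts_disjoint)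
  moreover have "card U6 = card U5 + l * k * k" unfolding U6_def
    by (subst card_Un_disjoint) (auto simp: c f fU U5_def U4_def U3_def U2_def U1_def dest: V_parts_disjoint)
  moreover have "card V = card U6 + card S" unfolding V
    by (subst card_Un_disjoint) (auto simp: c f fU U6_def U5_def U4_def U3_def U2_def U1_def dest: V_parts_disjoint)
  ultimately show ?thesis by simp
qed

lemma card_arcs:
  assumes "finite W" "\<And>u. u \<in> W \<Longrightarrow> card {v\<in>V. arc u v} \<le> d"
  shows "card (\<Union>u\<in>W. (\<lambda>v. {u, v}) ` {v\<in>V. arc u v}) \<le> card W * d"
proof -
  have "card (\<Union>u\<in>W. (\<lambda>v. {u, v}) ` {v\<in>V. arc u v}) \<le> (\<Sum>u\<in>W. card ((\<lambda>v. {u, v}) ` {v\<in>V. arc u v}))"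
    by (rule card_UN_le[OF assms(1)])
  also have "\<dots> \<le> (\<Sum>u\<in>W. d)"
  proof (rule sum_mono)
    fix u assume "u \<in> W"
    have "card ((\<lambda>v. {u, v}) ` {v\<in>V. arc u v}) \<le> card {v\<in>V. arc u v}" by (rule card_image_le) (simp add: finV)
    then show "card ((\<lambda>v. {u, v}) ` {v\<in>V. arc u v}) \<le> d" using assms(2)[OF \<open>u \<in> W\<close>] by linarith
  qed
  finally show ?thesis by simp
qed

text \<open>Out-degrees of \<open>arc\<close>: 6 at a \<open>Y\<close>, at most \<open>k + 4\<close>
  at a \<open>Z\<close>, \<open>l\<close> at a \<open>C\<close> and \<open>2 * k\<close> at an
  \<open>A\<close>. For the parameters chosen below only the first term is of the order of the
  number of vertices.\<close>

lemma card_E: "card E \<le> l * k * k * 6 + card S * (k + 4) + l * l + k * k * (2 * k)"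
proof -
  let ?a = "\<lambda>W. (\<Union>u\<in>W. (\<lambda>v. {u, v}) ` {v\<in>V. arc u v})"
  have fS: "finite VY" "finite VZ" "finite VA" using finS by (simp_all add: VY_def VZ_def VA_def)
  have inj: "inj_on (\<lambda>(s, i, j). Y s i j) T" "inj_on (\<lambda>(s, i). Z s i) T'" "inj_on (\<lambda>(i, j). A i j) T''" for T T' T''
    by (auto simp: inj_on_def)
  have c: "card VY = l * k * k" "card VZ = card S" "card VA = k * k" "card (C ` {..<l}) = l"
    by (simp_all add: VY_def VZ_def VA_def card_image[OF inj(1)] card_image[OF inj(2)] card_image[OF inj(3)]
        card_image inj_on_def)
  have "E \<subseteq> ?a VY \<union> ?a VZ \<union> ?a (C ` {..<l}) \<union> ?a VA"
  proof
    fix e assume "e \<in> E"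
    then obtain u v where uv: "u \<in> V" "v \<in> V" "arc u v" "e = {u, v}" by (auto simp: E_def)
    have "u \<in> VY \<union> VZ \<union> C ` {..<l} \<union> VA" using uv(1,3) by (cases u) (simp_all add: V_parts_mem)
    moreover have a: "e \<in> ?a W" if "u \<in> W" for W using that uv(2-4) by blast
    ultimately show "e \<in> ?a VY \<union> ?a VZ \<union> ?a (C ` {..<l}) \<union> ?a VA"
      unfolding Un_iff by (elim disjE) (use a in \<open>simp_all only: simp_thms\<close>)
  qed
  then have "card E \<le> card (?a VY \<union> ?a VZ \<union> ?a (C ` {..<l}) \<union> ?a VA)"
    using fS finV by (intro card_mono) auto
  also have "\<dots> \<le> card (?a VY) + card (?a VZ) + card (?a (C ` {..<l})) + card (?a VA)"
    by (intro order.trans[OF card_Un_le] add_mono order_refl)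
  also have "\<dots> \<le> card VY * 6 + card VZ * (k + 4) + card (C ` {..<l}) * l + card VA * (2 * k)"
  proof (intro add_mono card_arcs fS finite_imageI finite_lessThan)
    fix u assume "u \<in> VY"
    then obtain s i j where u: "u = Y s i j" using V_parts_disjoint by blast
    have "{v\<in>V. arc u v} \<subseteq> set [X, C s, D s, A i j, B i, B' j]" by (auto simp: u)
    then have "card {v\<in>V. arc u v} \<le> card (set [X, C s, D s, A i j, B i, B' j])" by (rule card_mono[OF finite_set])
    also have "\<dots> \<le> 6" by (rule order.trans[OF card_length]) simp
    finally show "card {v\<in>V. arc u v} \<le> 6" .
  next
    fix u assume "u \<in> VZ"
    then obtain s i where u: "u = Z s i" using V_parts_disjoint by blast
    have "{v\<in>V. arc u v} \<subseteq> set [X, C s, D s, B i] \<union> A i ` {..<k}" by (auto simp: u)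
    then have "card {v\<in>V. arc u v} \<le> card (set [X, C s, D s, B i] \<union> A i ` {..<k})" by (intro card_mono) auto
    also have "\<dots> \<le> card (set [X, C s, D s, B i]) + card (A i ` {..<k})" by (rule card_Un_le)
    also have "card (set [X, C s, D s, B i]) \<le> 4" by (rule order.trans[OF card_length]) simp
    also have "card (A i ` {..<k}) \<le> k" using card_image_le[of "{..<k}" "A i"] by simp
    finally show "card {v\<in>V. arc u v} \<le> k + 4" by simp
  next
    fix u assume "u \<in> C ` {..<l}"
    then obtain s where u: "u = C s" by blast
    have "{v\<in>V. arc u v} \<subseteq> D ` {..<l}" by (auto simp: u)
    then have "card {v\<in>V. arc u v} \<le> card (D ` {..<l})" by (intro card_mono) auto
    then show "card {v\<in>V. arc u v} \<le> l" using card_image_le[of "{..<l}" D] by simp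
  next
    fix u assume "u \<in> VA"
    then obtain i j where u: "u = A i j" using V_parts_disjoint by blast
    have "{v\<in>V. arc u v} \<subseteq> B ` {..<k} \<union> B' ` {..<k}" by (auto simp: u)
    then have "card {v\<in>V. arc u v} \<le> card (B ` {..<k} \<union> B' ` {..<k})" by (intro card_mono) auto
    also have "\<dots> \<le> card (B ` {..<k}) + card (B' ` {..<k})" by (rule card_Un_le)
    finally show "card {v\<in>V. arc u v} \<le> 2 * k"
      using card_image_le[of "{..<k}" B] card_image_le[of "{..<k}" B'] by simp
  qed
  finally show ?thesis unfolding c .
qed

lemma tsat_graph_E: "tsat_graph V E 3"
  using simple_E twin_free_E saturated_E by (simp add: tsat_graph_def)

end

section \<open>Choice of the parameters\<close>

text \<open>With \<open>k\<close> equal to the square of \<open>x\<close> and \<open>l\<close> of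
  the order of its cube, there are about \<open>x ^ 7\<close> vertices \<open>Y\<close>, while the
  terms \<open>l * l\<close> and \<open>k ^ 3\<close> of the edge count are balanced at order
  \<open>x ^ 6\<close>.\<close>

lemma seventh_root: obtains x :: nat where "x ^ 7 \<le> N" "N < (x + 1) ^ 7"
proof -
  define y where "y = (LEAST y. N < y ^ 7)"
  have "N < (N + 1) ^ 7" using self_le_power[of "N + 1" 7] by simp
  then have y: "N < y ^ 7" unfolding y_def by (rule LeastI)
  then have "y \<noteq> 0" by (cases y) auto
  then obtain x where x: "y = x + 1" by (cases y) auto
  have "\<not> N < x ^ 7" using not_less_Least[of x "\<lambda>y. N < y ^ 7"] x by (simp add: y_def)
  then show ?thesis using that[of x] y x by simp
qed

lemma upper_construction:
  assumes x: "8 \<le> x" "x ^ 7 \<le> N" "N < (x + 1) ^ 7"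
  obtains V :: "nat set" and E where "tsat_graph V E 3" "card V = N" "card E \<le> 6 * N + 16500 * x ^ 6"
proof -
  define k where "k = x\<^sup>2"
  \<comment> \<open>The fixed part consists of \<open>X\<close>, the \<open>A\<close>, the
    \<open>B\<close> and the \<open>B'\<close>. Each further index \<open>s\<close> costs
    \<open>C s\<close>, \<open>D s\<close> and \<open>k * k\<close> vertices \<open>Y\<close>,
    whence the divisor \<open>k * k + 2\<close>; the remainder \<open>\<rho>\<close> is filled by
    vertices \<open>Z\<close>.\<close>
  define M where "M = N - (1 + 2 * k + k * k)"
  define l where "l = M div (k * k + 2)"
  define \<rho> where "\<rho> = M mod (k * k + 2)"
  have k: "64 \<le> k" using power_mono[OF x(1), of 2] by (simp add: k_def)
  \<comment> \<open>This ensures \<open>k + 1 \<le> l\<close>, so that the \<open>l * k\<close>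
    index pairs suffice for up to \<open>k * k + 1\<close> vertices \<open>Z\<close>. The bound
    \<open>8 * k ^ 3\<close> equals \<open>8 * x ^ 6\<close>, hence the assumption
    \<open>8 \<le> x\<close>.\<close>
  have "(k + 1) * (k * k + 2) + (1 + 2 * k + k * k) \<le> 8 * k ^ 3"
  proof -
    have "1 \<le> k ^ 3" "k \<le> k ^ 3" "k * k \<le> k ^ 3" using k by (simp_all add: self_le_power power3_eq_cube)
    moreover have "(k + 1) * (k * k + 2) + (1 + 2 * k + k * k) = k ^ 3 + 2 * (k * k) + 4 * k + 3"
      by (simp add: algebra_simps power3_eq_cube)
    moreover have "64 * (k * k) \<le> k ^ 3" using k by (simp add: power3_eq_cube)
    moreover have "64 * k \<le> k * k" using k by simp
    ultimately show ?thesis using k by linarith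
  qed
  also have "\<dots> \<le> x * x ^ 6" using x(1) by (simp add: k_def flip: power_mult)
  also have "\<dots> \<le> N" using x(2) by (simp add: power_eq_if)
  finally have big: "(k + 1) * (k * k + 2) + (1 + 2 * k + k * k) \<le> N" .
  then have M: "(k + 1) * (k * k + 2) \<le> M" "M + (1 + 2 * k + k * k) = N" unfolding M_def by linarith+
  have l1: "k + 1 \<le> l" unfolding l_def using M(1) by (subst less_eq_div_iff_mult_less_eq) simp_all
  have Ml: "M = l * (k * k + 2) + \<rho>" unfolding l_def \<rho>_def by (rule div_mult_mod_eq[symmetric])
  have \<rho>: "\<rho> \<le> k * k + 1" unfolding \<rho>_def using mod_less_divisor[of "k * k + 2" M] by linarith
  have "\<rho> \<le> card ({..<l} \<times> {..<k})"
  proof -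
    have "k * k + 1 \<le> (k + 1) * k" using k by simp
    also have "\<dots> \<le> l * k" by (rule mult_le_mono1[OF l1])
    finally show ?thesis using \<rho> by simp
  qed
  then obtain S where S: "S \<subseteq> {..<l} \<times> {..<k}" "card S = \<rho>" by (meson obtain_subset_with_card_n)
  interpret G: construction k l S by unfold_locales (use k l1 S in auto)
  have cV: "card G.V = N" unfolding G.card_V S(2) using M(2) Ml by (simp add: algebra_simps)
  have l2: "l \<le> 128 * x ^ 3"
  proof -
    have "l * x ^ 4 \<le> l * (k * k + 2)" by (simp add: k_def flip: power_add)
    also have "\<dots> \<le> N" using Ml M(2) by linarith
    also have "\<dots> \<le> (2 * x) ^ 7" using x(1,3) power_mono[of "x + 1" "2 * x" 7] by linarith
    also have "\<dots> = (128 * x ^ 3) * x ^ 4" by (simp add: power_mult_distrib flip: power_add)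
    finally show ?thesis using x(1) by simp
  qed
  have "card G.E \<le> l * k * k * 6 + \<rho> * (k + 4) + l * l + k * k * (2 * k)" using G.card_E S(2) by simp
  moreover have "l * k * k * 6 \<le> 6 * N"
  proof -
    have "l * k * k \<le> M" using Ml by (simp add: algebra_simps)
    then show ?thesis using M(2) by linarith
  qed
  moreover have "\<rho> * (k + 4) \<le> 4 * x ^ 6"
  proof -
    have "\<rho> * (k + 4) \<le> (2 * (k * k)) * (2 * k)" using \<rho> k by (intro mult_le_mono) (auto intro: order.trans)
    also have "\<dots> = 4 * x ^ 6" by (simp add: k_def flip: power_add)
    finally show ?thesis .
  qed
  moreover have "l * l \<le> 16384 * x ^ 6"
  proof -
    have "l * l \<le> (128 * x ^ 3) * (128 * x ^ 3)" by (rule mult_le_mono[OF l2 l2])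
    also have "\<dots> = 16384 * x ^ 6" by (simp flip: power_add)
    finally show ?thesis .
  qed
  moreover have "k * k * (2 * k) = 2 * x ^ 6" by (simp add: k_def flip: power_add)
  \<comment> \<open>The three error terms add up to \<open>4 + 16384 + 2\<close> times
    \<open>x ^ 6\<close>, rounded up to 16500.\<close>
  ultimately have cE: "card G.E \<le> 6 * N + 16500 * x ^ 6" by linarith
  obtain V' :: "nat set" and E' where "tsat_graph V' E' 3" "card V' = card G.V" "card E' = card G.E"
    by (rule tsat_graph_nat[OF G.tsat_graph_E])
  then show ?thesis using that cV cE by simp
qed

theorem upper_bound_3:
  fixes \<epsilon> :: real assumes "0 < \<epsilon>"
  obtains n0 where "\<And>N. n0 \<le> N \<Longrightarrow>
    \<exists>(V :: nat set) E. tsat_graph V E 3 \<and> card V = N \<and> real (card E) \<le> (6 + \<epsilon>) * real N"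
proof -
  define m where "m = max 8 (nat \<lceil>16500 / \<epsilon>\<rceil>)"
  have m: "8 \<le> m" "16500 / \<epsilon> \<le> real m" unfolding m_def by linarith+
  show ?thesis
  proof (rule that)
    fix N assume N: "m ^ 7 \<le> N"
    obtain x where x: "x ^ 7 \<le> N" "N < (x + 1) ^ 7" by (rule seventh_root)
    have mx: "m \<le> x"
    proof (rule ccontr)
      assume "\<not> m \<le> x"
      then have "(x + 1) ^ 7 \<le> m ^ 7" by (intro power_mono) auto
      then show False using N x by linarith
    qed
    obtain V :: "nat set" and E where VE: "tsat_graph V E 3" "card V = N" "card E \<le> 6 * N + 16500 * x ^ 6"
      by (rule upper_construction[OF _ x]) (use m mx in auto)
    have "16500 / \<epsilon> \<le> real x" using m(2) mx by linarith
    then have "16500 \<le> \<epsilon> * real x" using assms by (simp add: pos_divide_le_eq mult.commute)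
    then have "16500 * real x ^ 6 \<le> (\<epsilon> * real x) * real x ^ 6" by (rule mult_right_mono) simp
    also have "\<dots> = \<epsilon> * real (x ^ 7)" by (simp add: power_eq_if)
    also have "\<dots> \<le> \<epsilon> * real N" using assms x(1) by (intro mult_left_mono of_nat_mono) auto
    finally have "16500 * real x ^ 6 \<le> \<epsilon> * real N" .
    moreover have "real (card E) \<le> real (6 * N + 16500 * x ^ 6)" by (rule of_nat_mono[OF VE(3)])
    ultimately have "real (card E) \<le> (6 + \<epsilon>) * real N" by (simp add: algebra_simps)
    then show "\<exists>(V :: nat set) E. tsat_graph V E 3 \<and> card V = N \<and> real (card E) \<le> (6 + \<epsilon>) * real N"
      using VE by blast
  qed
qed

theorem upper_bound:
  fixes \<epsilon> :: real assumes "0 < \<epsilon>" "3 \<le> r"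
  obtains n0 where "\<And>n. n0 \<le> n \<Longrightarrow>
    \<exists>(V :: nat set) E. tsat_graph V E r \<and> card V = n \<and> real (card E) \<le> (real r + 3 + \<epsilon>) * real n"
proof -
  define m where "m = r - 3"
  obtain n0 where n0: "\<And>N. n0 \<le> N \<Longrightarrow>
    \<exists>(V :: nat set) E. tsat_graph V E 3 \<and> card V = N \<and> real (card E) \<le> (6 + \<epsilon>) * real N"
    using upper_bound_3[OF assms(1)] by blast
  show ?thesis
  proof (rule that)
    fix n assume n: "n0 + m \<le> n"
    then have nm: "n0 \<le> n - m" by simp
    obtain V :: "nat set" and E where VE: "tsat_graph V E 3" "card V = n - m" "real (card E) \<le> (6 + \<epsilon>) * real (n - m)"
      using n0[of "n - m"] nm by blast
    obtain V' :: "nat set" and E' where V': "tsat_graph V' E' (3 + m)" "card V' = card V + m"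
      "card E' \<le> card E + m * (card V + m)" using tsat_graph_add_universal[OF VE(1)] by blast
    have r: "3 + m = r" "real r = 3 + real m" using assms by (simp_all add: m_def)
    have c: "card V' = n" using V' VE n by simp
    have "real (card E') \<le> real (card E + m * (card V + m))" by (rule of_nat_mono[OF V'(3)])
    also have "\<dots> = real (card E) + real m * real n" using VE(2) n by simp
    also have "\<dots> \<le> (6 + \<epsilon>) * real n + real m * real n"
    proof -
      have "(6 + \<epsilon>) * real (n - m) \<le> (6 + \<epsilon>) * real n" using assms by (intro mult_left_mono) auto
      then show ?thesis using VE(3) by linarith
    qed
    also have "\<dots> = (real r + 3 + \<epsilon>) * real n" by (simp add: r(2) algebra_simps)
    finally show "\<exists>(V :: nat set) E. tsat_graph V E r \<and> card V = n \<and> real (card E) \<le> (real r + 3 + \<epsilon>) * real n"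
      using V'(1) c r(1) by auto
  qed
qed

section \<open>From \<epsilon>-bounds to little-o terms\<close>

text \<open>The error terms are the actual defects, cut off at 0. Then the inequalities hold for
  every \<open>n\<close>, and the assumptions say that the defects are small against
  \<open>n\<close>.\<close>

lemma little_o_bounds:
  fixes T :: "nat \<Rightarrow> nat" and a b :: real
  assumes "\<And>\<epsilon>. 0 < \<epsilon> \<Longrightarrow> \<forall>\<^sub>F n in sequentially. (a - \<epsilon>) * real n \<le> real (T n)"
    and "\<And>\<epsilon>. 0 < \<epsilon> \<Longrightarrow> \<forall>\<^sub>F n in sequentially. real (T n) \<le> (b + \<epsilon>) * real n"
  shows "\<exists>f g :: nat \<Rightarrow> real. f \<in> o(\<lambda>n. real n) \<and> g \<in> o(\<lambda>n. real n) \<and>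
    (\<forall>\<^sub>F n in sequentially. a * real n + f n \<le> real (T n) \<and> real (T n) \<le> b * real n + g n)"
proof (intro exI conjI)
  define f where "f n = min 0 (real (T n) - a * real n)" for n
  define g where "g n = max 0 (real (T n) - b * real n)" for n
  show "f \<in> o(\<lambda>n. real n)"
  proof (rule landau_o.smallI)
    fix c :: real assume "0 < c"
    show "\<forall>\<^sub>F n in sequentially. norm (f n) \<le> c * norm (real n)"
      using assms(1)[OF \<open>0 < c\<close>]
      by eventually_elim (use \<open>0 < c\<close> in \<open>auto simp: f_def min_def algebra_simps\<close>)
  qed
  show "g \<in> o(\<lambda>n. real n)"
  proof (rule landau_o.smallI)
    fix c :: real assume "0 < c"
    show "\<forall>\<^sub>F n in sequentially. norm (g n) \<le> c * norm (real n)"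
      using assms(2)[OF \<open>0 < c\<close>]
      by eventually_elim (use \<open>0 < c\<close> in \<open>auto simp: g_def max_def algebra_simps\<close>)
  qed
  show "\<forall>\<^sub>F n in sequentially. a * real n + f n \<le> real (T n) \<and> real (T n) \<le> b * real n + g n"
    by (rule always_eventually) (auto simp: f_def g_def min_def max_def)
qed

lemma tsat_upper:
  assumes "0 < \<epsilon>" "3 \<le> r"
  shows "\<forall>\<^sub>F n in sequentially. real (tsat n r) \<le> (real r + 3 + \<epsilon>) * real n"
proof -
  obtain n0 where n0: "\<And>n. n0 \<le> n \<Longrightarrow>
    \<exists>(V :: nat set) E. tsat_graph V E r \<and> card V = n \<and> real (card E) \<le> (real r + 3 + \<epsilon>) * real n"
    using upper_bound[OF assms] by blast
  show ?thesis
    using eventually_ge_at_top[of n0]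
  proof eventually_elim
    case (elim n)
    then obtain V :: "nat set" and E where "tsat_graph V E r" "card V = n" "real (card E) \<le> (real r + 3 + \<epsilon>) * real n"
      using n0 by blast
    then show ?case using tsat_graph_tsat(1)[of V E r] by simp
  qed
qed

text \<open>Provides an extremal graph to which the lower bounds can be applied. That the infimum is
  over a nonempty set comes from the construction, so the lower bounds for \<open>tsat\<close> rest
  on it as well.\<close>

lemma tsat_attained:
  assumes "3 \<le> r"
  shows "\<forall>\<^sub>F n in sequentially. \<exists>(V :: nat set) E. tsat_graph V E r \<and> card V = n \<and> card E = tsat n r"
proof -
  obtain n0 where n0: "\<And>n. n0 \<le> n \<Longrightarrow>
    \<exists>(V :: nat set) E. tsat_graph V E r \<and> card V = n \<and> real (card E) \<le> (real r + 3 + 1) * real n"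
    using upper_bound[OF zero_less_one assms] by blast
  show ?thesis
    using eventually_ge_at_top[of n0]
  proof eventually_elim
    case (elim n)
    then obtain V :: "nat set" and E where "tsat_graph V E r" "card V = n" using n0 by blast
    then show ?case using tsat_graph_tsat(2)[of V E r] by simp
  qed
qed

lemma tsat_lower:
  assumes "0 < \<epsilon>" "3 \<le> r"
  shows "\<forall>\<^sub>F n in sequentially. (real r + 2 - \<epsilon>) * real n \<le> real (tsat n r)"
proof -
  obtain n0 where n0: "\<And>(V :: nat set) E. \<lbrakk>simple_graph V E; twin_free V E; K_saturated r V E; n0 \<le> card V\<rbrakk>
    \<Longrightarrow> (real r + 2 - \<epsilon>) * real (card V) \<le> real (card E)"
    using K_saturated_lower[OF assms(2,1)] by blast
  show ?thesis
    using tsat_attained[OF assms(2)] eventually_ge_at_top[of n0]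
  proof eventually_elim
    case (elim n)
    then obtain V :: "nat set" and E where "tsat_graph V E r" "card V = n" "card E = tsat n r" by blast
    then show ?case using n0[of V E] elim by (simp add: tsat_graph_def)
  qed
qed

lemma tsat_lower_3:
  assumes "0 < \<epsilon>"
  shows "\<forall>\<^sub>F n in sequentially. (5 + 2 / 3 - \<epsilon>) * real n \<le> real (tsat n 3)"
proof -
  obtain n0 where n0: "\<And>(V :: nat set) E. \<lbrakk>simple_graph V E; twin_free V E; K_saturated 3 V E; n0 \<le> card V\<rbrakk>
    \<Longrightarrow> (5 + 2 / 3 - \<epsilon>) * real (card V) \<le> real (card E)"
    using K3_saturated_lower[OF assms] by blast
  show ?thesis
    using tsat_attained[OF order_refl] eventually_ge_at_top[of n0]
  proof eventually_elim
    case (elim n)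
    then obtain V :: "nat set" and E where VE: "tsat_graph V E 3" "card V = n" "card E = tsat n 3" by blast
    then have "(5 + 2 / 3 - \<epsilon>) * real (card V) \<le> real (card E)"
      using elim(2) by (intro n0) (simp_all add: tsat_graph_def)
    then show ?case unfolding VE(2,3) .
  qed
qed

theorem theorem2:
  shows "(\<forall>r::nat. r \<ge> 3 \<longrightarrow>
      (\<exists>f g :: nat \<Rightarrow> real. f \<in> o(\<lambda>n. real n) \<and> g \<in> o(\<lambda>n. real n) \<and>
        (\<forall>\<^sub>F n in sequentially.
           (real r + 2) * real n + f n \<le> real (tsat n r) \<and>
           real (tsat n r) \<le> (real r + 3) * real n + g n))) \<and>
    (\<exists>f g :: nat \<Rightarrow> real. f \<in> o(\<lambda>n. real n) \<and> g \<in> o(\<lambda>n. real n) \<and>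
        (\<forall>\<^sub>F n in sequentially.
           (5 + 2 / 3) * real n + f n \<le> real (tsat n 3) \<and>
           real (tsat n 3) \<le> 6 * real n + g n))"
proof (intro conjI allI impI)
  fix r :: nat assume r: "3 \<le> r"
  show "\<exists>f g :: nat \<Rightarrow> real. f \<in> o(\<lambda>n. real n) \<and> g \<in> o(\<lambda>n. real n) \<and>
        (\<forall>\<^sub>F n in sequentially. (real r + 2) * real n + f n \<le> real (tsat n r) \<and>
           real (tsat n r) \<le> (real r + 3) * real n + g n)"
    by (rule little_o_bounds) (use tsat_lower tsat_upper r in blast)+
next
  have "real 3 + 3 = 6" by simp
  then show "\<exists>f g :: nat \<Rightarrow> real. f \<in> o(\<lambda>n. real n) \<and> g \<in> o(\<lambda>n. real n) \<and>
        (\<forall>\<^sub>F n in sequentially. (5 + 2 / 3) * real n + f n \<le> real (tsat n 3) \<and>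
           real (tsat n 3) \<le> 6 * real n + g n)"
    using tsat_upper[OF _ order_refl] by (intro little_o_bounds tsat_lower_3) simp_all
qed

end
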